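(* Let $p$ be a prime, $H$ a positive integer and $\mathcal I=\{1,2,\dots,H\}\pmod p\subset\mathbb F_p$ (so $|\mathcal I|=H$). Let $\mathcal G$ be either a subgroup of $\mathbb F_p^*$, or a set $\{1,g,g^2,\dots,g^{N-1}\}\pmod p$ with $|\mathcal G|=N$ elements, where $g$ is a primitive root modulo $p$. For any fixed $\varepsilon>0$ there is $\delta=\delta(\varepsilon)>0$ such that if $|\mathcal I|>p^{1/4+\varepsilon}$ and $|\mathcal G|>p^{1/4}$, then $$|\mathcal I\cdot\mathcal I\cdot\mathcal I\cdot\mathcal G|=p+O(p^{1-\delta}),$$ where the implied constant depends only on $\varepsilon$.
   Context: $\mathbb F_p$ is the field of residue classes modulo $p$ and $\mathcal A\cdot\mathcal B=\{ab:a\in\mathcal A,b\in\mathcal B\}$ (iterated products defined analogously). *)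

theory Defs
  imports "HOL-Number_Theory.Number_Theory"
begin

text \<open>
  The field of residue classes modulo a prime \<open>p\<close> is \<^term>\<open>residue_ring (int p)\<close>, whose carrier
  consists of the representatives \<open>0, \<dots>, p - 1\<close>. Product sets are formed with the library's
  \<^const>\<open>set_mult\<close> in this ring.
\<close>

abbreviation Fp :: "nat \<Rightarrow> int ring" where
  "Fp p \<equiv> residue_ring (int p)"

definition initial_interval :: "nat \<Rightarrow> nat \<Rightarrow> int set" where
  "initial_interval p H = (\<lambda>k. int k mod int p) ` {1..H}"

definition geometric_progression :: "nat \<Rightarrow> nat \<Rightarrow> nat \<Rightarrow> int set" where
  "geometric_progression p g N = (\<lambda>k. int g ^ k mod int p) ` {..<N}"

definition subgroup_or_progression :: "nat \<Rightarrow> int set \<Rightarrow> bool" where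
  "subgroup_or_progression p G \<longleftrightarrow>
     subgroup G (units_of (Fp p)) \<or>
     (\<exists>g N. residue_primroot p g \<and> G = geometric_progression p g N \<and> card G = N)"

end

theory Submission
  imports Defs "HOL-Algebra.Algebraic_Closure_Type" "Berlekamp_Zassenhaus.Finite_Field" "HOL-Analysis.Analysis"
    "HOL-Real_Asymp.Real_Asymp"
begin

text \<open>
  Let \<open>\<Lambda>\<close> be the set of nonzero residues that are not of the form \<open>a x y z h\<^sup>i\<close>, where \<open>a \<le> A = p\<^bsup>1/k\<^esup>\<close>,
  \<open>x, y, z \<le> B = p\<^bsup>1/4+e\<^esup>\<close> and \<open>i < N\<close> with \<open>N\<close> of size \<open>p\<^bsup>1/4\<^esup>\<close>; the powers \<open>h\<^sup>i\<close> lie in the given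
  subgroup or progression, and \<open>a x\<close> lies in the interval. Expanding over the multiplicative
  characters, the trivial character contributes \<open>A B\<^sup>3 N |\<Lambda>|\<close>, and this has to be cancelled by the
  others. Burgess's bound saves \<open>p\<^bsup>-\<delta>\<^esup>\<close> in each of the three sums over \<open>{1..B}\<close>. By a high moment
  over the characters, the sum over \<open>{1..A}\<close> is smaller than \<open>A p\<^bsup>-\<tau>\<^esup>\<close> outside a set of at most
  \<open>p\<^bsup>2\<delta>\<^esup>\<close> characters, which the Burgess saving \<open>p\<^bsup>-3\<delta>\<^esup>\<close> makes negligible. For the remaining ones the
  Cauchy-Schwarz inequality applies, together with a bound \<open>p\<^bsup>o(1)\<^esup> B\<^sup>6 N\<^sup>2 / p\<close> for the number of
  solutions of \<open>x y z h\<^sup>i = x' y' z' h\<^sup>j\<close>. The latter follows from counting the points of the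
  lattices \<open>{(u, v). u = h\<^sup>t v}\<close> in a box: a lattice with a short vector \<open>(a, b)\<close> has too many of them,
  but small reduced fractions \<open>a / b\<close> that are powers of \<open>h\<close> are rare.

  Burgess's bound rests on the Weil bound for \<open>\<Sum>\<^sub>x chi (f x)\<close>. Stepanov's method bounds these sums
  over the extensions of the prime field up to a factor depending on \<open>f\<close>; as the L-function is a
  polynomial, they are power sums of its reciprocal roots, so the roots have modulus at most
  \<open>p\<^bsup>1/2\<^esup>\<close>.
\<close>

hide_const (open) Divisibility.prime Module.module.smult UnivPoly.up_ring.monom UnivPoly.up_ring.coeff Polynomials.degree
  Polynomials.ring.coeff Coset.order Polynomials.ring.monom Divisibility.irreducible

section \<open>Linear algebra and roots of polynomials\<close>

text \<open>Even a collision count that is sharp up to \<open>p^o(1)\<close> gives, by the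
  Cauchy-Schwarz inequality alone, only \<open>card \<Lambda> \<le> p^(1+o(1))\<close>. The saving
  has to come from a further variable, and this is the role of the very short factor
  \<open>a\<close>. It is paid for by the difference between the exponents \<open>1/4 + e\<close> of
  \<open>x\<close> and \<open>1/4 + \<epsilon>\<close> of the interval. If its sum saves
  \<open>p^(-\<tau>)\<close>, the square of that saving outweighs a loss of \<open>p^\<tau>\<close>
  in the collision count. The constants are not circular: Burgess's bound fixes
  \<open>\<delta>\<close>, the length of \<open>a\<close> then fixes \<open>\<tau>\<close>, and the
  collision count holds with a loss of \<open>p^\<tau>\<close> for every positive
  \<open>\<tau>\<close>. The exponents 1/4 enter at one more place than Burgess's bound. A lattice
  whose shortest vector has size \<open>s\<close> has about \<open>M^2/p + M/s\<close> points in the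
  box, where \<open>M = B^3\<close>. Summed over the \<open>N\<close> exponents, the second term is
  harmless only if \<open>M N\<close> exceeds \<open>p\<close> by a small power. Three factors of
  length \<open>p^(1/4+e)\<close> and \<open>p^(1/4)\<close> powers of \<open>h\<close> just achieve
  this.\<close>

lemma nontrivial_solution_exists:
  fixes a :: "'i \<Rightarrow> 'e \<Rightarrow> 'a::field"
  assumes "finite E" "finite U" "card E < card U"
  shows "\<exists>b. (\<exists>u\<in>U. b u \<noteq> 0) \<and> (\<forall>e\<in>E. (\<Sum>u\<in>U. b u * a u e) = 0)"
  using assms
proof (induction E arbitrary: U a rule: finite_induct)
  case empty
  then obtain u where "u \<in> U" by (metis card.empty equals0I less_nat_zero_code)
  then show ?case by (intro exI[of _ "\<lambda>_. 1"]) auto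
next
  case (insert f E)
  show ?case
  proof (cases "\<forall>u\<in>U. a u f = 0")
    case True
    from insert.IH[of U a] insert.prems insert.hyps
    obtain b where "\<exists>u\<in>U. b u \<noteq> 0" "\<forall>e\<in>E. (\<Sum>u\<in>U. b u * a u e) = 0" by auto
    with True show ?thesis by (intro exI[of _ b]) auto
  next
    case False
    then obtain v where v: "v \<in> U" "a v f \<noteq> 0" by auto
    define U' where "U' = U - {v}"
    have U': "finite U'" "U = insert v U'" "v \<notin> U'" using v insert.prems by (auto simp: U'_def)
    have "card E < card U'"
      using insert.prems insert.hyps U' by simp
    from insert.IH[OF U'(1) this, of "\<lambda>u e. a u e - a u f / a v f * a v e"]
    obtain b where b: "\<exists>u\<in>U'. b u \<noteq> 0"
      "\<forall>e\<in>E. (\<Sum>u\<in>U'. b u * (a u e - a u f / a v f * a v e)) = 0" by auto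
    define s where "s = (\<Sum>u\<in>U'. b u * a u f)"
    \<comment> \<open>The new equation is solved for the unknown \<open>v\<close>; the other
      unknowns satisfy the system from which \<open>v\<close> has been eliminated.\<close>
    define b' where "b' = (\<lambda>u. if u = v then - s / a v f else b u)"
    have sum: "(\<Sum>u\<in>U. b' u * a u e) = - s / a v f * a v e + (\<Sum>u\<in>U'. b u * a u e)" for e
    proof -
      have "(\<Sum>u\<in>U. b' u * a u e) = b' v * a v e + (\<Sum>u\<in>U'. b' u * a u e)"
        using U' by simp
      also have "(\<Sum>u\<in>U'. b' u * a u e) = (\<Sum>u\<in>U'. b u * a u e)"
        using U' by (intro sum.cong) (auto simp: b'_def)
      finally show ?thesis by (simp add: b'_def)
    qed
    have "(\<Sum>u\<in>U. b' u * a u e) = 0" if "e \<in> insert f E" for e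
    proof (cases "e = f")
      case True
      then show ?thesis unfolding sum using v by (simp add: s_def)
    next
      case False
      with that b(2) have "(\<Sum>u\<in>U'. b u * (a u e - a u f / a v f * a v e)) = 0" by auto
      also have "(\<Sum>u\<in>U'. b u * (a u e - a u f / a v f * a v e))
        = (\<Sum>u\<in>U'. b u * a u e - b u * a u f * (a v e / a v f))"
        by (intro sum.cong) (auto simp: field_simps)
      also have "\<dots> = (\<Sum>u\<in>U'. b u * a u e) - s * (a v e / a v f)"
        by (simp add: sum_subtractf s_def sum_distrib_right sum_divide_distrib)
      finally show ?thesis unfolding sum by (simp add: field_simps)
    qed
    moreover have "\<exists>u\<in>U. b' u \<noteq> 0" using b(1) U' by (auto simp: b'_def)
    ultimately show ?thesis by blast
  qed
qed

text \<open>Among the terms with nonzero coefficient, the one of largest degree cannot be cancelled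
  by the others.\<close>

lemma sum_smult_distinct_degrees_nonzero:
  fixes t :: "'i \<Rightarrow> 'a::idom poly"
  assumes "finite A" "\<And>u. u \<in> A \<Longrightarrow> t u \<noteq> 0" "inj_on (\<lambda>u. degree (t u)) A"
    and "v \<in> A" "c v \<noteq> 0"
  shows "(\<Sum>u\<in>A. smult (c u) (t u)) \<noteq> 0"
proof -
  define A' where "A' = {u\<in>A. c u \<noteq> 0}"
  have A': "finite A'" "A' \<noteq> {}" using assms by (auto simp: A'_def)
  obtain m where m: "m \<in> A'" "\<And>u. u \<in> A' \<Longrightarrow> degree (t u) \<le> degree (t m)"
    using finite_has_maximal[of "(\<lambda>u. degree (t u)) ` A'"] A'
    by (smt (verit, best) empty_is_image finite_imageI imageE image_eqI nle_le)
  have "coeff (\<Sum>u\<in>A. smult (c u) (t u)) (degree (t m)) = (\<Sum>u\<in>A. c u * coeff (t u) (degree (t m)))"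
    by (simp add: coeff_sum)
  also have "\<dots> = (\<Sum>u\<in>{m}. c u * coeff (t u) (degree (t m)))"
  proof (rule sum.mono_neutral_right)
    show "\<forall>u\<in>A - {m}. c u * coeff (t u) (degree (t m)) = 0"
    proof
      fix u assume u: "u \<in> A - {m}"
      show "c u * coeff (t u) (degree (t m)) = 0"
      proof (cases "c u = 0")
        case False
        with u have "u \<in> A'" by (auto simp: A'_def)
        moreover have "degree (t u) \<noteq> degree (t m)"
          using assms(3) u m(1) by (auto simp: A'_def inj_on_def)
        ultimately have "degree (t u) < degree (t m)" using m(2)[of u] by simp
        then show ?thesis by (simp add: coeff_eq_0)
      qed auto
    qed
  qed (use m assms in \<open>auto simp: A'_def\<close>)
  also have "\<dots> \<noteq> 0" using m(1) assms(2) by (auto simp: A'_def)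
  finally show ?thesis by auto
qed

section \<open>Counting roots over an algebraically closed field\<close>

lemma sum_order_eq_degree:
  fixes g :: "'a::alg_closed_field poly"
  assumes "g \<noteq> 0"
  shows "(\<Sum>x | poly g x = 0. order x g) = degree g"
proof -
  from alg_closed_imp_factorization[OF assms]
  obtain A where A: "size A = degree g" "g = smult (lead_coeff g) (\<Prod>x\<in>#A. [:-x, 1:])" by auto
  have ne: "lead_coeff g \<noteq> 0" using assms by simp
  have "proots g = proots (\<Prod>x\<in>#A. [:-x, 1:])"
    using ne by (subst A(2)) simp
  also have "\<dots> = A"
  proof -
    have "proots (\<Prod>x\<in>#A. [:-x, 1:]) = A"
    proof (induction A)
      case (add x A)
      have "(\<Prod>x\<in>#A. [:-x, 1:]) \<noteq> 0" by (auto simp: prod_mset_zero_iff)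
      then have "proots ([:-x, 1:] * (\<Prod>x\<in>#A. [:-x, 1:])) = {#x#} + A"
        by (subst proots_mult) (simp_all add: add del: mult_pCons_left)
      then show ?case by simp
    qed auto
    then show ?thesis .
  qed
  finally have "size (proots g) = degree g" using A by simp
  then show ?thesis
    using assms by (simp add: size_multiset_overloaded_eq)
qed

text \<open>The orders add up to the degree, and a root of order at least two would also be a root
  of the derivative.\<close>

lemma card_roots_separable:
  fixes g :: "'a::alg_closed_field poly"
  assumes "g \<noteq> 0" "\<And>x. poly g x = 0 \<Longrightarrow> poly (pderiv g) x \<noteq> 0"
  shows "card {x. poly g x = 0} = degree g"
proof -
  have "order x g = 1" if x: "poly g x = 0" for x
  proof (rule ccontr)
    assume "order x g \<noteq> 1"
    with x assms(1) have "2 \<le> order x g" using order_root[of g x] by linarith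
    then have "[:-x, 1:] ^ 2 dvd g" by (meson le_imp_power_dvd dvd_trans order_1)
    then obtain h where "g = [:-x, 1:] ^ 2 * h" by (rule dvdE)
    then have "poly (pderiv g) x = 0"
      by (simp only: power2_eq_square mult.assoc pderiv_mult) simp
    with assms(2)[OF x] show False by simp
  qed
  then have "(\<Sum>x | poly g x = 0. order x g) = card {x. poly g x = 0}" by simp
  with sum_order_eq_degree[OF assms(1)] show ?thesis by simp
qed

lemma card_nth_roots_alg_closed:
  fixes v :: "'a::alg_closed_field"
  assumes "v \<noteq> 0" "of_nat d \<noteq> (0::'a)"
  shows "card {y. y ^ d = v} = d"
proof -
  have d: "d > 0" using assms(2) by (cases d) auto
  define g where "g = monom 1 d - [:v:]"
  have deg: "degree g = d"
    unfolding g_def unfolding diff_conv_add_uminus using d by (subst degree_add_eq_left) (auto simp: degree_monom_eq)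
  have ev: "poly g y = y ^ d - v" for y by (simp add: g_def poly_monom)
  have pd: "pderiv g = monom (of_nat d) (d - 1)"
    by (simp add: g_def pderiv_diff pderiv_monom)
  have "card {x. poly g x = 0} = degree g"
  proof (rule card_roots_separable)
    show "g \<noteq> 0" using deg d by auto
    fix x assume "poly g x = 0"
    then have "x ^ d = v" by (simp add: ev)
    then have "x \<noteq> 0" using assms d by auto
    then show "poly (pderiv g) x \<noteq> 0" using assms by (simp add: pd poly_monom)
  qed
  then show ?thesis by (simp add: ev deg)
qed

text \<open>In characteristic p the derivative of \<open>x^q - x\<close> is the constant -1, so all
  its roots are simple.\<close>

lemma card_frobenius_fixed:
  assumes "prime CHAR('a::alg_closed_field)" "n > 0"
  shows "card {x::'a. x ^ (CHAR('a) ^ n) = x} = CHAR('a) ^ n"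
proof -
  define q where "q = CHAR('a) ^ n"
  have q: "q > 1" using assms unfolding q_def by (intro one_less_power prime_gt_1_nat)
  have q0: "of_nat q = (0::'a)" using assms(2) by (simp add: q_def of_nat_power zero_power)
  define g where "g = monom 1 q - monom (1::'a) 1"
  have deg: "degree g = q"
    unfolding g_def unfolding diff_conv_add_uminus using q by (subst degree_add_eq_left) (auto simp: degree_monom_eq)
  have ev: "poly g y = y ^ q - y" for y by (simp add: g_def poly_monom)
  have pd: "pderiv g = - 1"
    using q0 by (simp add: g_def pderiv_diff pderiv_monom)
  have "card {x. poly g x = 0} = degree g"
    by (rule card_roots_separable) (use deg q in \<open>auto simp: pd\<close>)
  then show ?thesis by (simp add: ev deg flip: q_def)
qed

section \<open>Stepanov's method\<close>

text \<open>Modulo \<open>d\<close> only \<open>D * j\<close> remains, and \<open>D\<close> is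
  invertible there. The weights \<open>d\<close> and \<open>D\<close> are the pole orders of
  \<open>x\<close> and \<open>y\<close> at infinity on the curve \<open>y^d = f x\<close>.\<close>

lemma weight_inj:
  fixes d D :: nat
  assumes "coprime D d" "j < d" "j' < d" "d * i + D * j = d * i' + D * j'"
  shows "i = i' \<and> j = j'"
proof -
  have "[D * j = D * j'] (mod d)"
    using assms(4) by (metis cong_add_lcancel_nat Cong.cong_def mod_mult_self4 add.commute)
  then have "[j = j'] (mod d)" using assms(1) by (simp add: cong_mult_lcancel_nat coprime_commute)
  then have "j = j'" using assms(2,3) by (simp add: Cong.cong_def)
  with assms show ?thesis by simp
qed

text \<open>The auxiliary function \<open>h = \<Sum> c x\<^bsup>i+Qi'\<^esup> y\<^bsup>j+Qj'\<^esup>\<close> lives on the curve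
  \<open>y\<^sup>d = f x\<close> and is stored by its components with respect to \<open>1, y, \<dots>, y\<^bsup>d-1\<^esup>\<close>. On points
  over the field with \<open>Q\<^sup>2\<close> elements its \<open>Q\<close>-th power agrees with
  \<open>\<Sum> c\<^sup>Q x\<^bsup>Qi+i'\<^esup> y\<^bsup>Qj+j'\<^esup>\<close>, and counting dimensions one can choose \<open>c\<close> so that the latter
  vanishes identically. The weight \<open>d\<cdot>deg + D\<cdot>j\<close> (the pole order at infinity) separates the
  monomials, so that \<open>h\<close> itself does not vanish.\<close>

lemma stepanov_bound:
  fixes f :: "'a::alg_closed_field poly"
  assumes p: "prime CHAR('a)" and cop: "coprime (degree f) d" and f0: "f \<noteq> 0" and d0: "d > 0"
    and Q: "Q = CHAR('a) ^ k" "k > 0" and dvd: "d dvd Q\<^sup>2 - 1"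
    and big: "(degree f + 3) * (1 + d * degree f) + degree f < Q div d"
  shows "d * card {x. x ^ Q\<^sup>2 = x \<and> poly f x ^ ((Q\<^sup>2 - 1) div d) = 1}
     \<le> Q\<^sup>2 + (1 + d * (2 * degree f + 3)) * Q"
proof -
  define D s where "D = degree f" and "s = Q div d"
  \<comment> \<open>The bound \<open>i < s - D\<close> keeps \<open>d * i + D * j\<close> below
    \<open>d * s \<le> Q\<close>, so that the lower half of a weight can be read off modulo
    \<open>Q\<close>. The surplus \<open>D + 3\<close> in the range of \<open>i'\<close> makes up
    for this loss and provides more unknowns than equations.\<close>
  define I0 I1 where "I0 = s - D" and "I1 = s + D + 3"
  define XS where "XS = {x. x ^ Q\<^sup>2 = x \<and> poly f x ^ ((Q\<^sup>2 - 1) div d) = 1}"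
  have Qgt: "Q > 1" unfolding Q(1) using p Q(2) by (intro one_less_power prime_gt_1_nat)
  have bigs: "(D + 3) * (1 + d * D) + D < s" using big by (simp add: D_def s_def)
  have sD: "D < s" using bigs by linarith
  have ds: "d * s \<le> Q" "Q < d * s + d"
    using d0 by (simp_all add: s_def) (metis add.commute dividend_less_div_times mult.commute)
  define U where "U = {..<I0} \<times> {..<d} \<times> {..<I1} \<times> {..<d}"
  define ex where "ex = (\<lambda>(i::nat,j::nat,i'::nat,j'::nat). i + Q * i' :: nat)"
  define ey where "ey = (\<lambda>(i::nat,j::nat,i'::nat,j'::nat). j + Q * j' :: nat)"
  define ex' where "ex' = (\<lambda>(i::nat,j::nat,i'::nat,j'::nat). Q * i + i' :: nat)"
  define ey' where "ey' = (\<lambda>(i::nat,j::nat,i'::nat,j'::nat). Q * j + j' :: nat)"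
  \<comment> \<open>The relation \<open>y^d = f x\<close> lowers the exponent of \<open>y\<close>:
    its quotient by \<open>d\<close> becomes a power of \<open>f\<close>, its remainder names the
    component.\<close>
  define t where "t = (\<lambda>u. monom 1 (ex u) * f ^ (ey u div d))"
  define t' where "t' = (\<lambda>u. monom 1 (ex' u) * f ^ (ey' u div d))"
  have finU: "finite U" by (simp add: U_def)
  have degt: "degree (t u) = ex u + (ey u div d) * D" and degt': "degree (t' u) = ex' u + (ey' u div d) * D" for u
    using f0 by (simp_all add: t_def t'_def degree_mult_eq degree_power_eq degree_monom_eq D_def)
  have eyle: "ey u div d \<le> Q" "ey' u div d \<le> Q" if "u \<in> U" for u
  proof -
    obtain i j i' j' where u: "u = (i,j,i',j')" by (metis prod_cases4)
    with that have j: "j < d" "j' < d" by (auto simp: U_def)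
    then have j1: "j \<le> d - 1" "j' \<le> d - 1" by auto
    have "ey u \<le> (d - 1) + Q * (d - 1)" "ey' u \<le> Q * (d - 1) + (d - 1)"
      using j1 by (auto simp: u ey_def ey'_def intro!: add_mono mult_left_mono)
    moreover have "(d - 1) + Q * (d - 1) < Suc Q * d"
      using d0 by (simp add: diff_mult_distrib2 add.commute) 
    ultimately have "ey u < Suc Q * d" "ey' u < Suc Q * d" by linarith+
    then show "ey u div d \<le> Q" "ey' u div d \<le> Q"
      by (simp_all add: less_mult_imp_div_less flip: less_Suc_eq_le)
  qed
  \<comment> \<open>\<open>N\<close> exceeds all degrees in \<open>x\<close> that occur after the
    \<open>Q\<close>-th power, so \<open>E\<close> has one equation for each coefficient of each
    component.\<close>
  define N where "N = Q * I0 + I1 + D * Q"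
  define E where "E = {..<d} \<times> {..<N}"
  define a where "a = (\<lambda>u (r,n). if ey' u mod d = r then coeff (t' u) n else 0)"
  have "card E < card U"
  proof -
    have "Q * I0 + D * Q = Q * s" using sD by (simp add: I0_def algebra_simps)
    then have N: "N = Q * s + s + D + 3" by (simp add: N_def I1_def)
    have "Q * s \<le> (d * s + d) * s" using ds by (intro mult_right_mono) auto
    moreover have "D * s + (D + 3) * s = s * (2 * D + 3)" by (simp add: algebra_simps)
    \<comment> \<open>After division by \<open>d\<close>, the unknowns exceed the equations by at
      least \<open>2 * d * s - s - (D + 3) * (1 + d * D)\<close>; this is where \<open>s\<close> has
      to be large.\<close>
    moreover have key: "(d * s + d) * s + s + D + 3 < d * ((s - D) * (s + D + 3))"
    proof -
      obtain v where v: "s = D + v" using sD less_imp_add_positive by blast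
      have "d * ((s - D) * (s + D + 3)) = d * (v * (v + 2 * D + 3))" by (simp add: v)
      have e0: "(d * s + d) * s + s + D + 3 + d * D * (D + 3) + 2 * d * s = d * (s * s + 3 * s) + s + (D + 3) * (1 + d * D)"
        by (simp add: algebra_simps)
      have e1: "d * ((s - D) * (s + D + 3)) + d * D * (D + 3) = d * (s * s + 3 * s)"
        unfolding v by (simp add: algebra_simps)
      have "s + (D + 3) * (1 + d * D) < 2 * s" using bigs by linarith
      also have "\<dots> \<le> 2 * d * s" using d0 by simp
      finally have e2: "s + (D + 3) * (1 + d * D) < 2 * d * s" .
      show ?thesis using e0 e1 e2 by linarith
    qed
    ultimately have "N < d * (I0 * I1)" unfolding N I0_def I1_def by linarith
    then have "d * N < d * (d * (I0 * I1))" using d0 by simp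
    moreover have "card U = d * (d * (I0 * I1))" by (simp add: U_def card_cartesian_product)
    ultimately show ?thesis by (simp add: E_def card_cartesian_product)
  qed
  moreover have "finite E" by (simp add: E_def)
  ultimately obtain b where b: "\<exists>u\<in>U. b u \<noteq> 0" "\<And>e. e \<in> E \<Longrightarrow> (\<Sum>u\<in>U. b u * a u e) = 0"
    using nontrivial_solution_exists[of E U a] finU by blast
  have degN: "degree (t' u) < N" if "u \<in> U" for u
  proof -
    obtain i j i' j' where u: "u = (i,j,i',j')" by (metis prod_cases4)
    with that have i: "i < I0" "i' < I1" by (auto simp: U_def)
    have "ex' u < Q * I0 + I1" using i by (auto simp: u ex'_def intro!: add_le_less_mono)
    moreover have "ey' u div d * D \<le> D * Q" using eyle[OF that] by (simp add: mult.commute)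
    ultimately show ?thesis unfolding degt' N_def by linarith
  qed
  have vanish: "(\<Sum>u | u \<in> U \<and> ey' u mod d = r. smult (b u) (t' u)) = 0" if "r < d" for r
  proof (rule poly_eqI)
    fix n
    have eq: "coeff (\<Sum>u | u \<in> U \<and> ey' u mod d = r. smult (b u) (t' u)) n = (\<Sum>u\<in>U. b u * a u (r, n))"
      using finU by (simp add: coeff_sum a_def sum.inter_filter if_distrib[of "\<lambda>x. b _ * x"] if_distrib[of "\<lambda>x. coeff x _"] cong: if_cong)
    show "coeff (\<Sum>u | u \<in> U \<and> ey' u mod d = r. smult (b u) (t' u)) n = coeff 0 n"
    proof (cases "n < N")
      case True
      with that b(2)[of "(r,n)"] show ?thesis by (simp add: eq E_def)
    next
      case False
      then have "coeff (t' u) n = 0" if "u \<in> U" for u using degN[OF that] by (intro coeff_eq_0) auto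
      then show ?thesis by (simp add: coeff_sum)
    qed
  qed
  \<comment> \<open>The linear conditions concern the \<open>Q\<close>-th powers \<open>b\<close> of
    the coefficients; the coefficients themselves are recovered by taking roots in the closed
    field.\<close>
  have "\<forall>u. \<exists>z. z ^ Q = b u" using nth_root_exists[of Q] Qgt by auto
  then obtain c where c: "\<And>u. c u ^ Q = b u" by metis
  have c0: "c u = 0 \<longleftrightarrow> b u = 0" for u using c[of u] Qgt by (metis power_0_left power_not_zero not_one_less_zero)
  define h where "h = (\<lambda>r. \<Sum>u | u \<in> U \<and> ey u mod d = r. smult (c u) (t u))"
  obtain v where v: "v \<in> U" "b v \<noteq> 0" using b by auto
  have hnz: "h (ey v mod d) \<noteq> 0"
    unfolding h_def
  proof (rule sum_smult_distinct_degrees_nonzero)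
    show "t u \<noteq> 0" for u using f0 by (simp add: t_def monom_eq_0_iff)
    show "inj_on (\<lambda>u. degree (t u)) {u \<in> U. ey u mod d = ey v mod d}"
    proof (rule inj_onI)
      fix u w assume u: "u \<in> {u \<in> U. ey u mod d = ey v mod d}" and w: "w \<in> {u \<in> U. ey u mod d = ey v mod d}"
        and deg: "degree (t u) = degree (t w)"
      obtain i j i' j' where ue: "u = (i,j,i',j')" by (metis prod_cases4)
      obtain k l k' l' where we: "w = (k,l,k',l')" by (metis prod_cases4)
      have bnds: "i < I0" "j < d" "i' < I1" "j' < d" "k < I0" "l < d" "k' < I1" "l' < d"
        using u w by (auto simp: ue we U_def)
      \<comment> \<open>Inside one component \<open>ey mod d\<close> is constant, so equal degrees
        mean equal weights \<open>d * ex + D * ey\<close>.\<close>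
      have wt: "d * degree (t z) + D * (ey z mod d) = d * ex z + D * ey z" for z
        
    proof -
      have "D * ey z = D * (d * (ey z div d)) + D * (ey z mod d)" by (metis distrib_left mult_div_mod_eq)
      then show ?thesis unfolding degt by (simp add: algebra_simps)
    qed
      have "d * ex u + D * ey u = d * ex w + D * ey w"
        using wt[of u] wt[of w] deg u w by simp
      then have eq: "(d * i + D * j) + Q * (d * i' + D * j') = (d * k + D * l) + Q * (d * k' + D * l')"
        by (simp add: ue we ex_def ey_def algebra_simps)
      \<comment> \<open>A lower half below \<open>Q\<close> is recovered modulo \<open>Q\<close>;
        the upper half then follows, and \<open>weight_inj\<close> applies to both.\<close>
      have small: "d * i + D * j < Q" if "i < I0" "j < d" for i j
      proof -
        have "d * i + D * j \<le> d * (I0 - 1) + D * d"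
          using that by (intro add_mono mult_left_mono) auto
        also have "\<dots> < d * I0 + D * d" using that d0 by auto
        also have "\<dots> = d * s" using sD by (simp add: I0_def diff_mult_distrib2)
        finally show ?thesis using ds by simp
      qed
      have s1: "d * i + D * j < Q" and s2: "d * k + D * l < Q" using bnds small by auto
      have "d * i + D * j = d * k + D * l"
        using arg_cong[OF eq, of "\<lambda>x. x mod Q"] s1 s2 by simp
      moreover from this eq have "d * i' + D * j' = d * k' + D * l'" using Qgt by simp
      ultimately show "u = w"
        using weight_inj[of D d j l i k] weight_inj[of D d j' l' i' k'] bnds cop by (auto simp: ue we D_def)
    qed
  qed (use finU v c0 in auto)
  have hx: "poly (h r) x = 0" if x: "x \<in> XS" and r: "r < d" for x r
  proof -
    define z where "z = poly f x"
    from x have xq: "x ^ Q\<^sup>2 = x" and zq: "z ^ ((Q\<^sup>2 - 1) div d) = 1" by (auto simp: XS_def z_def)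
    have Q2: "Q\<^sup>2 > 1" using Qgt using one_less_power[of Q 2] by simp
    have dlt: "(Q\<^sup>2 - 1) div d > 0" using Q2 dvd d0 by (metis dvd_div_eq_0_iff less_numeral_extra(3) zero_less_diff neq0_conv)
    have z0: "z \<noteq> 0" using zq dlt by (cases "z = 0") (auto simp: zero_power)
    \<comment> \<open>\<open>d\<close> divides \<open>Q^2 - 1\<close>, whereas the characteristic
      divides \<open>Q\<close>; hence there are exactly \<open>d\<close> points above
      \<open>x\<close>.\<close>
    have "of_nat d \<noteq> (0::'a)"
    proof
      assume "of_nat d = (0::'a)"
      then have "CHAR('a) dvd d" by (simp add: of_nat_eq_0_iff_char_dvd)
      with dvd have "CHAR('a) dvd Q\<^sup>2 - 1" by (metis gcd_nat.trans)
      moreover have "CHAR('a) dvd Q\<^sup>2" using Q by (simp add: power2_eq_square dvd_power)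
      ultimately have "CHAR('a) dvd 1" using Q2 by (metis dvd_diffD1 less_imp_le_nat)
      with p show False by auto
    qed
    then have cardY: "card {y. y ^ d = z} = d" using card_nth_roots_alg_closed z0 by blast
    \<comment> \<open>The components at \<open>x\<close> are the coefficients of a polynomial in
      \<open>y\<close> of degree below \<open>d\<close>. It vanishes at the \<open>d\<close> points
      above \<open>x\<close>, so every component vanishes at \<open>x\<close>.\<close>
    define G where "G = (\<Sum>r<d. monom (poly (h r) x) r)"
    have "G = 0"
    proof (rule ccontr)
      assume G: "G \<noteq> 0"
      have "degree G \<le> d - 1" unfolding G_def
        by (intro degree_sum_le) (auto intro: order.trans[OF degree_monom_le])
      moreover have "{y. y ^ d = z} \<subseteq> {y. poly G y = 0}"
      proof
        fix y assume "y \<in> {y. y ^ d = z}"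
        then have y: "y ^ d = z" by simp
        have yq: "y ^ Q\<^sup>2 = y"
        proof -
          have "y ^ (Q\<^sup>2 - 1) = y ^ (d * ((Q\<^sup>2 - 1) div d))" using dvd by simp
          also have "\<dots> = 1" by (simp only: power_mult y zq)
          finally show ?thesis using Q2 by (metis power_minus_mult mult_1 less_trans zero_less_one)
        qed
        have te: "poly (t u) x * y ^ (ey u mod d) = x ^ ex u * y ^ ey u" for u
        proof -
          have "y ^ ey u = y ^ (d * (ey u div d) + ey u mod d)" by simp
          also have "\<dots> = z ^ (ey u div d) * y ^ (ey u mod d)" by (simp only: power_add power_mult y)
          finally show ?thesis by (simp add: t_def poly_monom z_def)
        qed
        have te': "poly (t' u) x * y ^ (ey' u mod d) = x ^ ex' u * y ^ ey' u" for u
        proof -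
          have "y ^ ey' u = y ^ (d * (ey' u div d) + ey' u mod d)" by simp
          also have "\<dots> = z ^ (ey' u div d) * y ^ (ey' u mod d)" by (simp only: power_add power_mult y)
          finally show ?thesis by (simp add: t'_def poly_monom z_def)
        qed
        have split: "(\<Sum>u\<in>U. F u) = (\<Sum>r<d. \<Sum>u | u \<in> U \<and> m u mod d = r. F u)" for F :: "_ \<Rightarrow> 'a" and m :: "_ \<Rightarrow> nat"
          by (rule sum.group[symmetric]) (use finU d0 in auto)
        have "poly G y = (\<Sum>r<d. poly (h r) x * y ^ r)" by (simp add: G_def poly_sum poly_monom)
        also have "\<dots> = (\<Sum>r<d. \<Sum>u | u \<in> U \<and> ey u mod d = r. c u * (poly (t u) x * y ^ (ey u mod d)))"
          by (simp add: h_def poly_sum sum_distrib_right mult.assoc)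
        also have "\<dots> = (\<Sum>u\<in>U. c u * (x ^ ex u * y ^ ey u))"
          by (subst split[of _ ey]) (intro sum.cong refl, simp only: te)
        finally have "poly G y ^ Q = (\<Sum>u\<in>U. c u * (x ^ ex u * y ^ ey u)) ^ Q" by simp
        also have "\<dots> = (\<Sum>u\<in>U. (c u * (x ^ ex u * y ^ ey u)) ^ Q)"
          by (rule freshmans_dream_sum'[OF p Q(1)])
        also have "\<dots> = (\<Sum>u\<in>U. b u * (x ^ ex' u * y ^ ey' u))"
        proof (rule sum.cong[OF refl])
          fix u :: "nat \<times> nat \<times> nat \<times> nat"
          obtain i j i' j' where u: "u = (i,j,i',j')" by (metis prod_cases4)
          have pw: "(w ^ (i + Q * i')) ^ Q = w ^ (Q * i + i')" if "w ^ Q\<^sup>2 = w" for w :: 'a and i i'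
          proof -
            have "(w ^ (i + Q * i')) ^ Q = w ^ (Q * i) * (w ^ Q\<^sup>2) ^ i'"
              by (simp add: power_add[symmetric] power_mult[symmetric] power2_eq_square algebra_simps)
            then show ?thesis by (simp add: that power_add)
          qed
          show "(c u * (x ^ ex u * y ^ ey u)) ^ Q = b u * (x ^ ex' u * y ^ ey' u)"
            using pw[OF xq, of i i'] pw[OF yq, of j j']
            by (simp add: power_mult_distrib c u ex_def ey_def ex'_def ey'_def)
        qed
        also have "\<dots> = (\<Sum>r<d. \<Sum>u | u \<in> U \<and> ey' u mod d = r. b u * (poly (t' u) x * y ^ (ey' u mod d)))"
          by (subst split[of _ ey']) (intro sum.cong refl, simp only: te')
        also have "\<dots> = (\<Sum>r<d. poly (\<Sum>u | u \<in> U \<and> ey' u mod d = r. smult (b u) (t' u)) x * y ^ r)"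
          by (simp add: poly_sum sum_distrib_right mult.assoc)
        also have "\<dots> = 0" by (simp add: vanish)
        finally show "y \<in> {y. poly G y = 0}" using Qgt by auto
      qed
      ultimately have "d \<le> d - 1"
        using cardY card_poly_roots_bound[OF G] card_mono[OF poly_roots_finite[OF G]] by (metis le_trans)
      with d0 show False by simp
    qed
    moreover have "coeff G r = poly (h r) x"
      using r by (simp add: G_def coeff_sum)
    ultimately show ?thesis by simp
  qed
  define r where "r = ey v mod d"
  have r: "r < d" "h r \<noteq> 0" using hnz d0 by (auto simp: r_def)
  \<comment> \<open>No multiplicities are needed: one nonzero component vanishes on all of
    \<open>XS\<close>, and its degree is about \<open>Q^2 / d\<close>.\<close>
  have "XS \<subseteq> {x. poly (h r) x = 0}" using hx r by auto
  then have "card XS \<le> degree (h r)"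
    using card_poly_roots_bound[OF r(2)] card_mono[OF poly_roots_finite[OF r(2)]] le_trans by blast
  also have "degree (h r) \<le> s + Q * (s + D + 3) + D * Q"
    unfolding h_def
  proof (rule degree_sum_le)
    fix u assume "u \<in> {u \<in> U. ey u mod d = r}"
    then have uU: "u \<in> U" by simp
    obtain i j i' j' where u: "u = (i,j,i',j')" by (metis prod_cases4)
    with uU have i: "i < I0" "i' < I1" by (auto simp: U_def)
    have "ex u \<le> s + Q * (s + D + 3)"
      using i by (auto simp: u ex_def I0_def I1_def intro!: add_mono mult_left_mono)
    moreover have "ey u div d * D \<le> D * Q" using eyle[OF uU] by (simp add: mult.commute)
    ultimately have "degree (t u) \<le> s + Q * (s + D + 3) + D * Q" unfolding degt by linarith
    then show "degree (smult (c u) (t u)) \<le> s + Q * (s + D + 3) + D * Q"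
      using degree_smult_le le_trans by blast
  qed (use finU in auto)
  finally have "d * card XS \<le> d * (s + Q * (s + D + 3) + D * Q)" by simp
  also have "\<dots> = d * s + Q * (d * s) + d * (2 * D + 3) * Q" by (simp add: algebra_simps)
  also have "\<dots> \<le> Q + Q * Q + d * (2 * D + 3) * Q" using ds by (intro add_mono mult_left_mono) auto
  also have "\<dots> = Q\<^sup>2 + (1 + d * (2 * D + 3)) * Q" by (simp add: algebra_simps power2_eq_square)
  finally show ?thesis by (simp add: XS_def D_def)
qed

section \<open>Finite subfields of an algebraically closed field\<close>

text \<open>For \<open>m > 0\<close> this is the subfield with \<open>p^m\<close> elements. Taking
  fixed points of Frobenius powers puts all finite extensions into one type.\<close>

definition gf :: "nat \<Rightarrow> 'a::alg_closed_field set" where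
  "gf m = {x. x ^ (CHAR('a) ^ m) = x}"

text \<open>For \<open>x\<close> in \<open>gf m\<close> this is the characteristic polynomial of
  \<open>x\<close> over the prime field, a power of the minimal polynomial.\<close>

definition conj_poly :: "nat \<Rightarrow> 'a::alg_closed_field \<Rightarrow> 'a poly" where
  "conj_poly m x = (\<Prod>i<m. [:- (x ^ (CHAR('a) ^ i)), 1:])"

definition gf_degree :: "'a::alg_closed_field \<Rightarrow> nat" where
  "gf_degree x = (LEAST m. m > 0 \<and> x \<in> gf m)"

definition prime_field_poly :: "'a::alg_closed_field poly \<Rightarrow> bool" where
  "prime_field_poly h \<longleftrightarrow> (\<forall>n. coeff h n \<in> gf (Suc 0))"

definition monic_polys :: "nat \<Rightarrow> 'a::alg_closed_field poly set" where
  "monic_polys n = {h. prime_field_poly h \<and> degree h = n \<and> lead_coeff h = 1}"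

lemma prod_linear_dvd:
  fixes h :: "'a::idom poly"
  assumes "finite S" "\<And>s. s \<in> S \<Longrightarrow> poly h s = 0"
  shows "(\<Prod>s\<in>S. [:-s, 1:]) dvd h"
  using assms
proof (induction S arbitrary: h rule: finite_induct)
  case (insert s S)
  then have "[:-s, 1:] dvd h" by (simp add: poly_eq_0_iff_dvd)
  then obtain h' where h': "h = [:-s, 1:] * h'" by (rule dvdE)
  have "poly h' u = 0" if "u \<in> S" for u
    using insert.prems[of u] insert.hyps that unfolding h' by auto
  then have "(\<Prod>s\<in>S. [:-s, 1:]) dvd h'" using insert.IH by blast
  then show ?case using insert.hyps h' by (simp add: mult_dvd_mono del: mult_pCons_left)
qed auto

lemma prod_lessThan_add:
  fixes g :: "nat \<Rightarrow> 'a::comm_monoid_mult"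
  shows "(\<Prod>i<a + b. g i) = (\<Prod>i<a. g i) * (\<Prod>i<b. g (a + i))"
  by (induction b) (simp_all add: mult.assoc)

locale char_p_closed =
  fixes type :: "'a::alg_closed_field itself" and p :: nat
  assumes prime_p: "prime p" and CHAR_eq [simp]: "CHAR('a) = p"
begin

lemma char_prime: "prime CHAR('a)" using prime_p by simp

lemma p_gt_1: "p > 1" using prime_p by (rule prime_gt_1_nat)

lemma frob_add: "(x + y :: 'a) ^ (p ^ m) = x ^ (p ^ m) + y ^ (p ^ m)"
  by (rule freshmans_dream'[OF char_prime]) simp

lemma frob_sum: "(sum f A :: 'a) ^ (p ^ m) = (\<Sum>i\<in>A. f i ^ (p ^ m))"
  by (rule freshmans_dream_sum'[OF char_prime]) simp

lemma frob_diff: "(x - y :: 'a) ^ (p ^ m) = x ^ (p ^ m) - y ^ (p ^ m)"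
  using frob_add[of "x - y" y m] by (simp add: eq_diff_eq)

lemma frob_uminus: "(- x :: 'a) ^ (p ^ m) = - (x ^ (p ^ m))"
  using frob_diff[of 0 x m] p_gt_1 by (simp add: zero_power)

lemma frob_inj: "(x :: 'a) ^ (p ^ m) = y ^ (p ^ m) \<Longrightarrow> x = y"
  using frob_diff[of x y m] by simp

lemma frob_comp: "((x :: 'a) ^ (p ^ m)) ^ (p ^ n) = x ^ (p ^ (m + n))"
  by (simp add: power_add power_mult)

lemma
  shows gf_0: "(0::'a) \<in> gf m" and gf_1: "(1::'a) \<in> gf m"
    and gf_add: "(x::'a) \<in> gf m \<Longrightarrow> y \<in> gf m \<Longrightarrow> x + y \<in> gf m"
    and gf_diff: "(x::'a) \<in> gf m \<Longrightarrow> y \<in> gf m \<Longrightarrow> x - y \<in> gf m"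
    and gf_uminus: "(x::'a) \<in> gf m \<Longrightarrow> - x \<in> gf m"
    and gf_mult: "(x::'a) \<in> gf m \<Longrightarrow> y \<in> gf m \<Longrightarrow> x * y \<in> gf m"
    and gf_inverse: "(x::'a) \<in> gf m \<Longrightarrow> inverse x \<in> gf m"
    and gf_power: "(x::'a) \<in> gf m \<Longrightarrow> x ^ k \<in> gf m"
  using p_gt_1
  by (auto simp: gf_def frob_add frob_diff frob_uminus power_mult_distrib power_inverse zero_power
      mult.commute[of k] power_mult[symmetric]) (metis mult.commute power_mult)

lemma gf_sum: "(\<And>i. i \<in> A \<Longrightarrow> f i \<in> gf m) \<Longrightarrow> (sum f A :: 'a) \<in> gf m"
  by (induction A rule: infinite_finite_induct) (auto simp: gf_0 gf_add)

lemma gf_prod: "(\<And>i. i \<in> A \<Longrightarrow> f i \<in> gf m) \<Longrightarrow> (prod f A :: 'a) \<in> gf m"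
  by (induction A rule: infinite_finite_induct) (auto simp: gf_1 gf_mult)

lemma card_gf: "m > 0 \<Longrightarrow> card (gf m :: 'a set) = p ^ m"
  using card_frobenius_fixed[OF char_prime, of m] by (simp add: gf_def)

lemma finite_gf: "m > 0 \<Longrightarrow> finite (gf m :: 'a set)"
  using card_gf[of m] p_gt_1 by (intro card_ge_0_finite) simp

lemma gf_mono: "(x::'a) \<in> gf m \<Longrightarrow> x \<in> gf (m * k)"
  by (induction k) (auto simp: gf_def power_add power_mult)

lemma gf1_subset: "(x::'a) \<in> gf (Suc 0) \<Longrightarrow> x \<in> gf m"
  using gf_mono[of x "Suc 0" m] by simp

abbreviation frob_poly :: "'a poly \<Rightarrow> 'a poly" where
  "frob_poly \<equiv> map_poly (\<lambda>x. x ^ p)"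

lemma coeff_frob_poly: "coeff (frob_poly h) n = coeff h n ^ p"
  using p_gt_1 by (intro coeff_map_poly) (simp add: zero_power)

lemma prime_field_poly_iff: "prime_field_poly h \<longleftrightarrow> frob_poly h = h"
  by (auto simp: prime_field_poly_def gf_def poly_eq_iff coeff_frob_poly)

lemma frob_poly_mult: "frob_poly (g * h) = frob_poly g * frob_poly h"
proof (rule poly_eqI)
  fix n
  show "coeff (frob_poly (g * h)) n = coeff (frob_poly g * frob_poly h) n"
    using frob_sum[of "\<lambda>i. coeff g i * coeff h (n - i)" "{..n}" 1]
    by (simp add: coeff_frob_poly coeff_mult power_mult_distrib)
qed

lemma frob_poly_prod: "frob_poly (\<Prod>i\<in>A. f i) = (\<Prod>i\<in>A. frob_poly (f i))"
proof (induction A rule: infinite_finite_induct)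
  case (insert x F)
  then show ?case by (simp add: frob_poly_mult)
qed (simp_all add: map_poly_1)

lemma frob_poly_linear: "frob_poly [:- a, 1:] = [:- (a ^ p), 1:]"
  using frob_uminus[of a 1] p_gt_1 by (simp add: map_poly_pCons zero_power)

lemma prime_field_poly_mult: "prime_field_poly g \<Longrightarrow> prime_field_poly h \<Longrightarrow> prime_field_poly (g * h)"
  for g h :: "'a poly"
  by (simp add: prime_field_poly_iff frob_poly_mult)

lemma prime_field_poly_prod: "(\<And>i. i \<in> A \<Longrightarrow> prime_field_poly (f i)) \<Longrightarrow> prime_field_poly (prod f A)"
  for f :: "_ \<Rightarrow> 'a poly"
  by (simp add: prime_field_poly_iff frob_poly_prod)

lemma prime_field_poly_cancel:
  fixes g h :: "'a poly"
  assumes "prime_field_poly (g * h)" "prime_field_poly g" "g \<noteq> 0"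
  shows "prime_field_poly h"
  using assms by (simp add: prime_field_poly_iff frob_poly_mult)

lemma poly_frob: "prime_field_poly h \<Longrightarrow> poly h (x ^ p) = poly h x ^ p" for x :: 'a
proof -
  assume "prime_field_poly h"
  then have c: "coeff h i ^ p = coeff h i" for i by (simp add: prime_field_poly_def gf_def)
  have "poly h x ^ p = (\<Sum>i\<le>degree h. (coeff h i * x ^ i) ^ p)"
    using frob_sum[of "\<lambda>i. coeff h i * x ^ i" "{..degree h}" 1] by (simp add: poly_altdef)
  also have "\<dots> = (\<Sum>i\<le>degree h. coeff h i * (x ^ p) ^ i)"
    by (simp add: power_mult_distrib c) (simp add: power_mult[symmetric] mult.commute)
  finally show ?thesis by (simp add: poly_altdef)
qed

lemma poly_frob_power: "prime_field_poly h \<Longrightarrow> poly h (x ^ (p ^ i)) = poly h x ^ (p ^ i)" for x :: 'a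
  by (induction i) (simp_all add: poly_frob power_mult[symmetric] mult.commute[of p] flip: power_mult
      del: power_mult, metis poly_frob power_mult)

lemma poly_in_gf1: "prime_field_poly h \<Longrightarrow> w \<in> gf (Suc 0) \<Longrightarrow> poly h w \<in> gf (Suc 0)" for w :: 'a
  by (auto simp: poly_altdef prime_field_poly_def intro!: gf_sum gf_mult gf_power)

lemma degree_conj_poly [simp]: "degree (conj_poly m x) = m" for x :: 'a
  by (simp add: conj_poly_def degree_prod_eq_sum_degree)

lemma lead_coeff_conj_poly [simp]: "coeff (conj_poly m x) m = 1" for x :: 'a
proof -
  have "lead_coeff (conj_poly m x) = 1"
    unfolding conj_poly_def CHAR_eq by (subst lead_coeff_prod) simp
  then show ?thesis by simp
qed

lemma conj_poly_nonzero [simp]: "conj_poly m x \<noteq> 0" for x :: 'a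
  using lead_coeff_conj_poly[of m x] by (metis coeff_0 zero_neq_one)

lemma poly_conj_poly: "poly (conj_poly m x) w = (\<Prod>i<m. w - x ^ (p ^ i))" for x :: 'a
  by (simp add: conj_poly_def poly_prod)

text \<open>Frobenius permutes the linear factors cyclically, because
  \<open>x^(p^m) = x\<close>.\<close>

lemma prime_field_conj_poly:
  fixes x :: 'a
  assumes "x \<in> gf m"
  shows "prime_field_poly (conj_poly m x)"
proof (cases m)
  case 0
  then show ?thesis by (simp add: conj_poly_def prime_field_poly_iff map_poly_1)
next
  case (Suc k)
  define F where "F = (\<lambda>i. [:- (x ^ (p ^ i)), 1:])"
  have "frob_poly (conj_poly m x) = (\<Prod>i<m. F (Suc i))"
    unfolding conj_poly_def CHAR_eq frob_poly_prod frob_poly_linear F_def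
    by (simp add: power_mult[symmetric] mult.commute)
  also have "\<dots> * F 0 = (\<Prod>i<Suc m. F i)"
    by (subst prod.lessThan_Suc_shift) (simp add: mult.commute)
  also have "\<dots> = (\<Prod>i<m. F i) * F m" by simp
  also have "F m = F 0" using assms by (simp add: F_def gf_def)
  finally have "frob_poly (conj_poly m x) * F 0 = (\<Prod>i<m. F i) * F 0" .
  moreover have "F 0 \<noteq> 0" by (simp add: F_def)
  ultimately have "frob_poly (conj_poly m x) = (\<Prod>i<m. F i)" by (metis mult_right_cancel)
  then show ?thesis by (simp add: prime_field_poly_iff F_def conj_poly_def)
qed

lemma finite_monic_polys: "finite (monic_polys n :: 'a poly set)"
proof (rule finite_subset)
  show "monic_polys n \<subseteq> Poly ` {xs. set xs \<subseteq> (gf (Suc 0) :: 'a set) \<and> length xs = Suc n}"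
  proof
    fix h :: "'a poly" assume h: "h \<in> monic_polys n"
    then have "h \<noteq> 0" by (auto simp: monic_polys_def)
    then have "length (coeffs h) = Suc n" using h by (simp add: length_coeffs monic_polys_def)
    moreover have "set (coeffs h) \<subseteq> gf (Suc 0)"
      using h by (auto simp: coeffs_def monic_polys_def prime_field_poly_def)
    ultimately show "h \<in> Poly ` {xs. set xs \<subseteq> (gf (Suc 0) :: 'a set) \<and> length xs = Suc n}"
      by (intro image_eqI[of _ _ "coeffs h"]) auto
  qed
  show "finite (Poly ` {xs. set xs \<subseteq> (gf (Suc 0) :: 'a set) \<and> length xs = Suc n})"
    by (intro finite_imageI finite_lists_length_eq finite_gf) simp
qed

lemma monic_polys_mult:
  fixes g h :: "'a poly"
  assumes "g \<in> monic_polys m" "h \<in> monic_polys n"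
  shows "g * h \<in> monic_polys (m + n)"
proof -
  have "g \<noteq> 0" "h \<noteq> 0" using assms by (auto simp: monic_polys_def)
  with assms show ?thesis
    by (auto simp: monic_polys_def prime_field_poly_mult degree_mult_eq coeff_mult_degree_sum)
qed

lemma conj_poly_monic: "x \<in> gf m \<Longrightarrow> conj_poly m x \<in> monic_polys m" for x :: 'a
  by (simp add: monic_polys_def prime_field_conj_poly)

section \<open>Minimal polynomials over the prime field\<close>

context
  fixes x :: 'a and m0 :: nat
  assumes x: "x \<in> gf m0" "m0 > 0"
begin

lemma gf_degree: "gf_degree x > 0" "x \<in> gf (gf_degree x)"
  using LeastI[of "\<lambda>m. m > 0 \<and> x \<in> gf m" m0] x by (auto simp: gf_degree_def)

lemma gf_degree_le: "m > 0 \<Longrightarrow> x \<in> gf m \<Longrightarrow> gf_degree x \<le> m"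
  unfolding gf_degree_def by (rule Least_le) simp

text \<open>The remainder of \<open>n\<close> modulo the least positive exponent fixing
  \<open>x\<close> fixes \<open>x\<close> as well, so it is zero by minimality.\<close>

lemma in_gf_iff_degree_dvd: "x \<in> gf n \<longleftrightarrow> gf_degree x dvd n"
proof
  assume n: "x \<in> gf n"
  let ?e = "gf_degree x"
  have "x \<in> gf (?e * (n div ?e))" using gf_mono gf_degree by blast
  then have "x ^ (p ^ (?e * (n div ?e) + n mod ?e)) = x ^ (p ^ (n mod ?e))"
    unfolding gf_def CHAR_eq mem_Collect_eq by (metis frob_comp)
  with n have "x \<in> gf (n mod ?e)" by (simp add: gf_def)
  then have "n mod ?e = 0"
    using gf_degree_le[of "n mod ?e"] gf_degree(1) mod_less_divisor[of ?e n] by fastforce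
  then show "?e dvd n" by auto
qed (use gf_mono gf_degree in \<open>auto simp: dvd_def\<close>)

lemma inj_on_conjugates: "inj_on (\<lambda>i. x ^ (p ^ i)) {..<gf_degree x}"
proof -
  have "False" if "i < j" "j < gf_degree x" "x ^ (p ^ i) = x ^ (p ^ j)" for i j
  proof -
    have "x ^ (p ^ j) = (x ^ (p ^ (j - i))) ^ (p ^ i)" using that by (simp add: frob_comp)
    then have "x ^ (p ^ (j - i)) = x" using that frob_inj by metis
    then have "gf_degree x \<le> j - i" using that by (intro gf_degree_le) (auto simp: gf_def)
    with that show False by simp
  qed
  then show ?thesis by (intro inj_onI) (metis lessThan_iff linorder_neqE_nat)
qed

lemma conj_poly_power: "conj_poly (gf_degree x * k) x = conj_poly (gf_degree x) x ^ k"
proof (induction k)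
  case (Suc k)
  let ?e = "gf_degree x"
  have "conj_poly (?e * Suc k) x = (\<Prod>i<?e * k + ?e. [:- (x ^ (p ^ i)), 1:])"
    by (simp add: conj_poly_def add.commute)
  also have "\<dots> = conj_poly (?e * k) x * (\<Prod>i<?e. [:- (x ^ (p ^ (?e * k + i))), 1:])"
    unfolding conj_poly_def CHAR_eq by (rule prod_lessThan_add)
  also have "(\<Prod>i<?e. [:- (x ^ (p ^ (?e * k + i))), 1:]) = conj_poly ?e x"
  proof -
    have "x ^ (p ^ (?e * k)) = x" using gf_mono[OF gf_degree(2), of k] by (simp add: gf_def)
    then have "x ^ (p ^ (?e * k + i)) = x ^ (p ^ i)" for i by (metis frob_comp)
    then show ?thesis by (simp add: conj_poly_def)
  qed
  finally show ?case unfolding Suc.IH by (simp only: power_Suc2)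
qed (simp add: conj_poly_def)

lemma min_poly_prod: "conj_poly (gf_degree x) x = (\<Prod>s\<in>(\<lambda>i. x ^ (p ^ i)) ` {..<gf_degree x}. [:-s, 1:])"
  unfolding conj_poly_def CHAR_eq by (subst prod.reindex[OF inj_on_conjugates]) simp

lemma min_poly_dvd:
  assumes "prime_field_poly h" "poly h x = 0"
  shows "conj_poly (gf_degree x) x dvd h"
  unfolding min_poly_prod
  by (rule prod_linear_dvd) (use assms p_gt_1 in \<open>auto simp: poly_frob_power zero_power\<close>)

lemma order_min_poly: "order x (conj_poly (gf_degree x) x) = 1"
proof -
  let ?S = "(\<lambda>i. x ^ (p ^ i)) ` {..<gf_degree x}"
  have xS: "x \<in> ?S" using gf_degree(1) by (intro image_eqI[of _ _ 0]) auto
  let ?g = "\<Prod>s\<in>?S - {x}. [:-s, 1:]"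
  have g: "poly ?g x \<noteq> 0" by (auto simp: poly_prod)
  have eq: "conj_poly (gf_degree x) x = [:-x, 1:] * ?g"
    unfolding min_poly_prod by (rule prod.remove) (use xS in auto)
  have "order x ([:-x, 1:] * ?g) = order x [:-x, 1:] + order x ?g"
    by (rule order_mult) (use eq conj_poly_nonzero in metis)
  also have "order x ?g = 0" by (rule order_0I[OF g])
  also have "order x [:-x, 1:] = 1" using order_power_n_n[of x 1] by simp
  finally show ?thesis using eq by simp
qed

text \<open>\<open>conj_poly (gf_degree x) x\<close> is the minimal polynomial. It has
  \<open>x\<close> as a simple root and divides every polynomial over the prime field that vanishes
  at \<open>x\<close>; splitting it off repeatedly counts the order of \<open>x\<close>.\<close>

lemma min_poly_power_dvd_iff:
  assumes "prime_field_poly h" "h \<noteq> 0"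
  shows "conj_poly (gf_degree x) x ^ i dvd h \<longleftrightarrow> i \<le> order x h"
proof
  let ?P = "conj_poly (gf_degree x) x"
  assume "?P ^ i dvd h"
  moreover have "[:-x, 1:] dvd ?P"
    unfolding min_poly_prod using gf_degree(1)
    by (intro dvd_prodI image_eqI[of _ _ 0]) auto
  ultimately have "[:-x, 1:] ^ i dvd h" by (meson dvd_power_same dvd_trans)
  with assms show "i \<le> order x h" by (simp add: order_divides)
next
  let ?P = "conj_poly (gf_degree x) x"
  assume "i \<le> order x h"
  with assms show "?P ^ i dvd h"
  proof (induction i arbitrary: h)
    case (Suc i)
    then have "poly h x = 0" using order_root[of h x] by auto
    then obtain h' where h': "h = ?P * h'" using min_poly_dvd[OF Suc.prems(1)] by (auto elim: dvdE)
    have "prime_field_poly h'" "h' \<noteq> 0"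
      using prime_field_poly_cancel[of ?P h'] prime_field_conj_poly[OF gf_degree(2)] Suc.prems h' by auto
    moreover have "order x h = 1 + order x h'"
      using Suc.prems(2) unfolding h' by (subst order_mult) (auto simp: order_min_poly)
    ultimately have "?P ^ i dvd h'" using Suc.prems Suc.IH by auto
    then show ?case by (simp add: h' mult_dvd_mono)
  qed auto
qed

text \<open>An admissible \<open>m\<close> is \<open>gf_degree x * i\<close>, and
  \<open>conj_poly m x\<close> is then the \<open>i\<close>-th power of the minimal polynomial,
  which divides \<open>h\<close> precisely for \<open>i\<close> up to the order of
  \<open>x\<close>.\<close>

lemma card_conj_poly_dvd:
  fixes h :: "'a poly"
  assumes h: "h \<in> monic_polys n"
  shows "card {m\<in>{1..n}. x \<in> gf m \<and> conj_poly m x dvd h} = order x h"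
proof -
  let ?e = "gf_degree x"
  have hp: "prime_field_poly h" "h \<noteq> 0" "degree h = n" using h by (auto simp: monic_polys_def)
  have "{m\<in>{1..n}. x \<in> gf m \<and> conj_poly m x dvd h} = (\<lambda>i. ?e * i) ` {1..order x h}"
  proof (intro equalityI subsetI)
    fix m assume "m \<in> {m\<in>{1..n}. x \<in> gf m \<and> conj_poly m x dvd h}"
    then have m: "m \<ge> 1" "?e dvd m" "conj_poly m x dvd h" by (auto simp: in_gf_iff_degree_dvd)
    then obtain i where i: "m = ?e * i" by (auto elim: dvdE)
    have "i \<ge> 1" using m i by (cases i) auto
    moreover have "i \<le> order x h"
      using m i by (simp add: conj_poly_power min_poly_power_dvd_iff[OF hp(1,2)])
    ultimately show "m \<in> (\<lambda>i. ?e * i) ` {1..order x h}" using i by auto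
  next
    fix m assume "m \<in> (\<lambda>i. ?e * i) ` {1..order x h}"
    then obtain i where i: "m = ?e * i" "1 \<le> i" "i \<le> order x h"
      by (metis (no_types, lifting) atLeastAtMost_iff imageE)
    then have dvd: "conj_poly m x dvd h"
      by (simp add: conj_poly_power min_poly_power_dvd_iff[OF hp(1,2)])
    then have "m \<le> n" using dvd_imp_degree_le[OF dvd hp(2)] hp by simp
    moreover have "m \<ge> 1" using i gf_degree(1) by simp
    ultimately show "m \<in> {m\<in>{1..n}. x \<in> gf m \<and> conj_poly m x dvd h}"
      using dvd i by (auto simp: in_gf_iff_degree_dvd)
  qed
  moreover have "inj_on (\<lambda>i. ?e * i) {1..order x h}" using gf_degree(1) by (auto intro: inj_onI)
  ultimately show ?thesis by (simp add: card_image)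
qed

end

text \<open>Frobenius maps the finite set of roots into itself, so two of its powers agree at
  \<open>x\<close>.\<close>

lemma root_in_gf:
  fixes h :: "'a poly"
  assumes "prime_field_poly h" "h \<noteq> 0" "poly h x = 0"
  obtains m where "m > 0" "x \<in> gf m"
proof -
  have "range (\<lambda>i. x ^ (p ^ i)) \<subseteq> {z. poly h z = 0}"
    using assms p_gt_1 by (auto simp: poly_frob_power zero_power)
  then have "finite (range (\<lambda>i. x ^ (p ^ i)))"
    using poly_roots_finite[OF assms(2)] by (rule finite_subset)
  then have "\<not> inj (\<lambda>i. x ^ (p ^ i))"
    using finite_imageD infinite_UNIV_nat by blast
  then obtain i j where "i \<noteq> j" "x ^ (p ^ i) = x ^ (p ^ j)" by (auto simp: inj_def)
  then obtain i j where ij: "i < j" "x ^ (p ^ i) = x ^ (p ^ j)" by (metis linorder_neqE_nat)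
  have "x ^ (p ^ j) = (x ^ (p ^ (j - i))) ^ (p ^ i)" using ij by (simp add: frob_comp)
  then have "x ^ (p ^ (j - i)) = x" using ij frob_inj by metis
  with ij show ?thesis by (intro that[of "j - i"]) (auto simp: gf_def)
qed

text \<open>Exchanging the sums gives the sum of the orders of all roots of \<open>h\<close>, which
  is its degree. This provides the weight \<open>n\<close> in the logarithmic derivative of the
  L-function.\<close>

lemma sum_card_conj_poly_dvd:
  fixes h :: "'a poly"
  assumes h: "h \<in> monic_polys n"
  shows "(\<Sum>m=1..n. card {x\<in>gf m. conj_poly m x dvd h}) = n"
proof -
  have hp: "prime_field_poly h" "h \<noteq> 0" "degree h = n" using h by (auto simp: monic_polys_def)
  let ?R = "{x. poly h x = 0}"
  have finR: "finite ?R" using hp by (intro poly_roots_finite)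
  have root: "poly h x = 0" if "conj_poly m x dvd h" "m \<ge> 1" for m x
  proof -
    have "poly (conj_poly m x) x = 0" using that(2) by (auto simp: poly_conj_poly intro!: bexI[of _ 0])
    with that(1) show ?thesis by (auto elim!: dvdE)
  qed
  have "(\<Sum>m=1..n. card {x\<in>gf m. conj_poly m x dvd h}) = (\<Sum>m=1..n. \<Sum>x\<in>?R. if x \<in> gf m \<and> conj_poly m x dvd h then 1 else 0)"
  proof (rule sum.cong[OF refl])
    fix m assume m: "m \<in> {1..n}"
    have "{x\<in>gf m. conj_poly m x dvd h} = {x\<in>?R. x \<in> gf m \<and> conj_poly m x dvd h}"
      using root m by auto
    then show "card {x\<in>gf m. conj_poly m x dvd h} = (\<Sum>x\<in>?R. if x \<in> gf m \<and> conj_poly m x dvd h then 1 else 0)"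
      using finR by (simp add: sum.inter_filter[symmetric])
  qed
  also have "\<dots> = (\<Sum>x\<in>?R. \<Sum>m=1..n. if x \<in> gf m \<and> conj_poly m x dvd h then 1 else 0)"
    by (rule sum.swap)
  also have "\<dots> = (\<Sum>x\<in>?R. card {m\<in>{1..n}. x \<in> gf m \<and> conj_poly m x dvd h})"
    by (simp add: sum.inter_filter[symmetric])
  also have "\<dots> = (\<Sum>x\<in>?R. order x h)"
  proof (rule sum.cong[OF refl])
    fix x assume "x \<in> ?R"
    then obtain m where "m > 0" "x \<in> gf m" using root_in_gf[of h x] hp by auto
    then show "card {m\<in>{1..n}. x \<in> gf m \<and> conj_poly m x dvd h} = order x h"
      using card_conj_poly_dvd h by blast
  qed
  also have "\<dots> = n" using sum_order_eq_degree hp by auto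
  finally show ?thesis .
qed

end

section \<open>The L-function of a Kummer sum\<close>

text \<open>Multiplication by \<open>z\<close> permutes \<open>S\<close>; the products over
  \<open>S\<close> before and after are compared, as in the proof of Fermat's theorem.\<close>

lemma power_card_stable_set:
  fixes z :: "'a::field"
  assumes "finite S" "0 \<notin> S" "z \<noteq> 0" "\<And>y. y \<in> S \<Longrightarrow> z * y \<in> S"
  shows "z ^ card S = 1"
proof -
  have inj: "inj_on (\<lambda>y. z * y) S" using assms(3) by (auto intro: inj_onI)
  have "(\<lambda>y. z * y) ` S = S"
    using assms inj by (intro card_subset_eq) (auto simp: card_image)
  then have "(\<Prod>y\<in>S. y) = (\<Prod>y\<in>S. z * y)"
    using prod.reindex[OF inj, of "\<lambda>y. y"] by simp
  also have "\<dots> = z ^ card S * (\<Prod>y\<in>S. y)" by (simp add: prod.distrib)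
  finally show ?thesis using assms(1,2) by (simp add: prod_zero_iff)
qed

text \<open>\<open>d\<close> is the order of \<open>chi\<close>, encoded as the number of its values
  on the units. That \<open>d\<close> is prime to the total exponent is used twice: it is the degree
  condition of Stepanov's method, and it makes the high coefficients of the L-function
  vanish.\<close>

locale kummer_sum = char_p_closed type p for type :: "'a::alg_closed_field itself" and p +
  fixes chi :: "'a \<Rightarrow> complex" and W :: "'a set" and e :: "'a \<Rightarrow> nat" and d :: nat
  assumes chi_mult: "x \<in> gf (Suc 0) \<Longrightarrow> y \<in> gf (Suc 0) \<Longrightarrow> chi (x * y) = chi x * chi y"
    and chi_zero_iff: "x \<in> gf (Suc 0) \<Longrightarrow> chi x = 0 \<longleftrightarrow> x = 0"
    and d_eq: "d = card (chi ` (gf (Suc 0) - {0}))" and d_gt_1: "d > 1"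
    and W_subset: "W \<subseteq> gf (Suc 0)" and e_pos: "w \<in> W \<Longrightarrow> e w > 0"
    and coprime_sum: "coprime (sum e W) d"
begin

abbreviation punits :: "'a set" where "punits \<equiv> gf (Suc 0) - {0}"
abbreviation vals :: "complex set" where "vals \<equiv> chi ` punits"
definition char_kernel :: "'a set" where "char_kernel = {x\<in>punits. chi x = 1}"

lemma finite_W: "finite W" using W_subset finite_gf[of "Suc 0"] finite_subset by auto

lemma finite_punits: "finite punits" using finite_gf[of "Suc 0"] by auto

lemma card_punits: "card punits = p - 1"
  using card_gf[of "Suc 0"] finite_gf[of "Suc 0"] gf_0[of "Suc 0"] by (simp add: card_Diff_singleton)

lemma punits_mult: "x \<in> punits \<Longrightarrow> y \<in> punits \<Longrightarrow> x * y \<in> punits"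
  using gf_mult[of x "Suc 0" y] by auto

lemma punits_inverse: "x \<in> punits \<Longrightarrow> inverse x \<in> punits"
  using gf_inverse[of x "Suc 0"] by auto

lemma chi_1: "chi 1 = 1"
  using chi_mult[of 1 1] chi_zero_iff[of 1] gf_1[of "Suc 0"] by auto

lemma chi_0: "chi 0 = 0" using chi_zero_iff gf_0 by blast

lemma chi_power: "x \<in> gf (Suc 0) \<Longrightarrow> chi (x ^ n) = chi x ^ n"
  by (induction n) (simp_all add: chi_1 chi_mult gf_power)

lemma chi_prod: "(\<And>i. i \<in> A \<Longrightarrow> f i \<in> gf (Suc 0)) \<Longrightarrow> chi (prod f A) = (\<Prod>i\<in>A. chi (f i))"
  by (induction A rule: infinite_finite_induct) (simp_all add: chi_1 chi_mult gf_prod)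

lemma values_power: "z \<in> vals \<Longrightarrow> z ^ d = 1"
proof -
  assume "z \<in> vals"
  then obtain x where x: "x \<in> punits" "z = chi x" by auto
  have "z ^ card vals = 1"
  proof (rule power_card_stable_set)
    show "finite vals" using finite_punits by simp
    show "0 \<notin> vals" using chi_zero_iff by auto
    show "z \<noteq> 0" using x chi_zero_iff by auto
    fix y assume "y \<in> vals"
    then obtain u where u: "u \<in> punits" "y = chi u" by auto
    then have "z * y = chi (x * u)" using x chi_mult by auto
    then show "z * y \<in> vals" using punits_mult[OF x(1) u(1)] by auto
  qed
  then show ?thesis by (simp add: d_eq)
qed

lemma norm_values: "z \<in> vals \<Longrightarrow> norm z = 1"
  using power_eq_imp_eq_base[of "norm z" d 1] values_power[of z] d_gt_1 by (simp add: norm_power[symmetric])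

lemma exists_nontrivial: obtains g where "g \<in> punits" "chi g \<noteq> 1"
proof -
  have "\<not> vals \<subseteq> {1}" using d_gt_1 d_eq card_mono[of "{1::complex}" vals] by auto
  with that show ?thesis by auto
qed

text \<open>The fibres of \<open>chi\<close> on the units are cosets of the kernel.\<close>

lemma card_kernel: "d * card char_kernel = p - 1"
proof -
  have "card punits = (\<Sum>z\<in>vals. card {x\<in>punits. chi x = z})"
    using sum.image_gen[OF finite_punits, of "\<lambda>_. 1::nat" chi] by simp
  also have "\<dots> = (\<Sum>z\<in>vals. card char_kernel)"
  proof (rule sum.cong[OF refl])
    fix z assume "z \<in> vals"
    then obtain x where x: "x \<in> punits" "z = chi x" by auto
    have "bij_betw (\<lambda>y. x * y) char_kernel {y\<in>punits. chi y = z}"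
    proof (rule bij_betwI[where g = "\<lambda>y. inverse x * y"])
      show "(\<lambda>y. x * y) \<in> char_kernel \<rightarrow> {y\<in>punits. chi y = z}"
        using x punits_mult by (auto simp: char_kernel_def chi_mult gf_mult)
      have "chi (inverse x) * chi x = 1"
        using x chi_mult[of "inverse x" x] punits_inverse[of x] by (auto simp: chi_1)
      then show "(\<lambda>y. inverse x * y) \<in> {y\<in>punits. chi y = z} \<rightarrow> char_kernel"
        using x punits_inverse[of x] by (auto simp: char_kernel_def chi_mult gf_mult)
    qed (use x in auto)
    then show "card {y\<in>punits. chi y = z} = card char_kernel" by (metis bij_betw_same_card)
  qed
  finally show ?thesis using card_punits d_eq by simp
qed

lemma kernel_power: "x \<in> char_kernel \<Longrightarrow> x ^ card char_kernel = 1"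
  by (rule power_card_stable_set)
     (use finite_punits punits_mult in \<open>auto simp: char_kernel_def chi_mult intro: finite_subset[of _ punits]\<close>)

text \<open>Multiplication by a value other than 1 permutes the values.\<close>

lemma sum_values: "(\<Sum>z\<in>vals. z) = 0"
proof -
  obtain g where g: "g \<in> punits" "chi g \<noteq> 1" by (rule exists_nontrivial)
  have g0: "chi g \<noteq> 0" using g chi_zero_iff by auto
  have inj: "inj_on (\<lambda>z. chi g * z) vals" using g0 by (auto intro: inj_onI)
  have "(\<lambda>z. chi g * z) ` vals \<subseteq> vals"
  proof
    fix y assume "y \<in> (\<lambda>z. chi g * z) ` vals"
    then obtain x where x: "x \<in> punits" "y = chi g * chi x" by auto
    then have "y = chi (g * x)" using g chi_mult by auto
    then show "y \<in> vals" using punits_mult[OF g(1) x(1)] by auto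
  qed
  then have "(\<lambda>z. chi g * z) ` vals = vals"
    using inj finite_punits by (intro card_subset_eq) (auto simp: card_image)
  then have "(\<Sum>z\<in>vals. z) = (\<Sum>z\<in>vals. chi g * z)"
    using sum.reindex[OF inj, of "\<lambda>y. y"] by simp
  also have "\<dots> = chi g * (\<Sum>z\<in>vals. z)" by (simp add: sum_distrib_left)
  finally show ?thesis using g(2) by simp
qed

text \<open>For a monic \<open>h\<close>, the product of the \<open>h w ^ e w\<close> equals the
  product of the values of \<open>kummer_poly\<close> at the roots of \<open>h\<close>. This turns
  the character sum into a multiplicative function of polynomials over the prime field.\<close>

definition psi :: "'a poly \<Rightarrow> complex" where
  "psi h = (\<Prod>w\<in>W. chi (poly h w) ^ e w)"

definition lcoeff :: "nat \<Rightarrow> complex" where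
  "lcoeff n = (\<Sum>h\<in>monic_polys n. psi h)"

text \<open>By \<open>psi_conj_poly\<close> the summand is \<open>chi\<close> of the norm of
  \<open>kummer_poly\<close> at \<open>x\<close>, so these are the character sums over the extension
  fields.\<close>

definition gf_sum_char :: "nat \<Rightarrow> complex" where
  "gf_sum_char m = (\<Sum>x\<in>gf m. psi (conj_poly m x))"

lemma psi_mult: "prime_field_poly g \<Longrightarrow> prime_field_poly h \<Longrightarrow> psi (g * h) = psi g * psi h"
proof -
  assume gh: "prime_field_poly g" "prime_field_poly h"
  have "chi (poly (g * h) w) = chi (poly g w) * chi (poly h w)" if "w \<in> W" for w
    using that W_subset gh poly_in_gf1 chi_mult by auto
  then show ?thesis by (simp add: psi_def power_mult_distrib prod.distrib)
qed

lemma lcoeff_0: "lcoeff 0 = 1"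
proof -
  have "monic_polys 0 = {1 :: 'a poly}"
    using gf_1[of "Suc 0"] gf_0[of "Suc 0"]
    by (auto simp: monic_polys_def prime_field_poly_def coeff_1 elim!: degree_eq_zeroE)
  then show ?thesis by (simp add: lcoeff_def psi_def chi_1)
qed

text \<open>This is the logarithmic derivative of the Euler product of the L-function
  \<open>\<Sum>\<^sub>n lcoeff n T\<^sup>n\<close>, compared coefficient by coefficient.\<close>

lemma newton_lcoeff: "of_nat n * lcoeff n = (\<Sum>m=1..n. gf_sum_char m * lcoeff (n - m))"
proof -
  have "of_nat n * lcoeff n = (\<Sum>h\<in>monic_polys n. of_nat (\<Sum>m=1..n. card {x\<in>gf m. conj_poly m x dvd h}) * psi h)"
    unfolding lcoeff_def sum_distrib_left by (rule sum.cong) (simp_all only: sum_card_conj_poly_dvd)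
  also have "\<dots> = (\<Sum>h\<in>monic_polys n. \<Sum>m=1..n. \<Sum>x\<in>gf m. if conj_poly m x dvd h then psi h else 0)"
  proof (rule sum.cong[OF refl])
    fix h :: "'a poly"
    have "of_nat (card {x\<in>gf m. conj_poly m x dvd h}) * psi h = (\<Sum>x\<in>gf m. if conj_poly m x dvd h then psi h else 0)"
      if "m \<in> {1..n}" for m
      using finite_gf[of m] that by (simp add: sum.inter_filter[symmetric])
    then show "of_nat (\<Sum>m=1..n. card {x\<in>gf m. conj_poly m x dvd h}) * psi h =
      (\<Sum>m=1..n. \<Sum>x\<in>gf m. if conj_poly m x dvd h then psi h else 0)"
      by (simp add: sum_distrib_right)
  qed
  also have "\<dots> = (\<Sum>m=1..n. \<Sum>x\<in>gf m. \<Sum>h\<in>monic_polys n. if conj_poly m x dvd h then psi h else 0)"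
    by (subst sum.swap) (intro sum.cong refl sum.swap)
  also have "\<dots> = (\<Sum>m=1..n. \<Sum>x\<in>gf m. psi (conj_poly m x) * lcoeff (n - m))"
  proof (intro sum.cong refl)
    fix m and x :: 'a assume m: "m \<in> {1..n}" and x: "x \<in> gf m"
    let ?N = "conj_poly m x"
    have N: "prime_field_poly ?N" using x by (rule prime_field_conj_poly)
    have "(\<Sum>h\<in>monic_polys n. if ?N dvd h then psi h else 0) = (\<Sum>h\<in>{h\<in>monic_polys n. ?N dvd h}. psi h)"
      by (simp add: sum.inter_filter finite_monic_polys)
    also have "\<dots> = (\<Sum>h\<in>monic_polys (n - m). psi (?N * h))"
    proof (rule sum.reindex_cong[where l = "\<lambda>h. ?N * h"])
      show "inj_on (\<lambda>h. ?N * h) (monic_polys (n - m))" by (auto intro!: inj_onI)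
      show "{h\<in>monic_polys n. ?N dvd h} = (\<lambda>h. ?N * h) ` monic_polys (n - m)"
      proof (intro equalityI subsetI)
        fix h assume "h \<in> {h\<in>monic_polys n. ?N dvd h}"
        then obtain g where h: "h \<in> monic_polys n" "h = ?N * g" by (auto elim: dvdE)
        then have hp: "prime_field_poly h" "h \<noteq> 0" "degree h = n" "lead_coeff h = 1"
          by (auto simp: monic_polys_def)
        then have "prime_field_poly g" "g \<noteq> 0" using h N prime_field_poly_cancel by auto
        moreover have "degree g = n - m" using hp h calculation by (simp add: degree_mult_eq)
        moreover have "lead_coeff g = 1" using hp(4) unfolding h(2) lead_coeff_mult by simp
        ultimately have "g \<in> monic_polys (n - m)" by (auto simp: monic_polys_def)
        then show "h \<in> (\<lambda>h. ?N * h) ` monic_polys (n - m)" using h by auto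
      next
        fix h assume "h \<in> (\<lambda>h. ?N * h) ` monic_polys (n - m)"
        then show "h \<in> {h\<in>monic_polys n. ?N dvd h}"
          using monic_polys_mult[OF conj_poly_monic[OF x]] m by fastforce
      qed
    qed auto
    also have "\<dots> = (\<Sum>h\<in>monic_polys (n - m). psi ?N * psi h)"
      by (rule sum.cong) (auto simp: monic_polys_def psi_mult N)
    finally show "(\<Sum>h\<in>monic_polys n. if ?N dvd h then psi h else 0) = psi ?N * lcoeff (n - m)"
      by (simp add: lcoeff_def sum_distrib_left)
  qed
  finally show ?thesis by (simp add: gf_sum_char_def sum_distrib_right)
qed

text \<open>Multiplying all the values \<open>h w\<close> by the same unit \<open>g\<close> is a permutation of the monic
  polynomials of a degree \<open>n \<ge> card W\<close>, and it multiplies \<open>psi\<close> by \<open>chi g ^ sum e W \<noteq> 1\<close>.\<close>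

lemma lcoeff_eq_0:
  assumes "n \<ge> card W"
  shows "lcoeff n = 0"
proof -
  obtain g where g: "g \<in> punits" "chi g \<noteq> 1" by (rule exists_nontrivial)
  \<comment> \<open>\<open>B\<close> is monic of degree \<open>n\<close> and vanishes on
    \<open>W\<close>, so \<open>F g h\<close> is again monic while its values on \<open>W\<close>
    are those of \<open>h\<close> multiplied by \<open>g\<close>.\<close>
  define B where "B = (\<Prod>w\<in>W. [:-w, 1:]) * monom 1 (n - card W)"
  have lin: "prime_field_poly [:-w, 1:]" if "w \<in> gf (Suc 0)" for w :: 'a
    using that gf_uminus[of w "Suc 0"] gf_1[of "Suc 0"] gf_0[of "Suc 0"]
    by (auto simp: prime_field_poly_def coeff_pCons split: nat.splits)
  have "prime_field_poly (monom (1::'a) (n - card W))"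
    using gf_0[of "Suc 0"] gf_1[of "Suc 0"] by (auto simp: prime_field_poly_def)
  then have Bp: "prime_field_poly B"
    unfolding B_def using lin W_subset by (intro prime_field_poly_mult prime_field_poly_prod) auto
  have Bd: "degree B = n"
    unfolding B_def using assms finite_W
    by (subst degree_mult_eq) (auto simp: degree_prod_eq_sum_degree degree_monom_eq monom_eq_0_iff)
  have Bl: "lead_coeff B = 1"
    unfolding B_def lead_coeff_mult lead_coeff_prod by (simp add: degree_monom_eq)
  have Bz: "poly B w = 0" if "w \<in> W" for w
    using that finite_W by (auto simp: B_def poly_prod)
  define F where "F = (\<lambda>g h. smult g h + smult (1 - g) B)"
  have F: "F a h \<in> monic_polys n" if h: "h \<in> monic_polys n" and a: "a \<in> gf (Suc 0)" for a h
  proof -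
    have hp: "prime_field_poly h" "degree h = n" "coeff h n = 1" using h by (auto simp: monic_polys_def)
    have pf: "prime_field_poly (F a h)"
      using hp Bp a gf_1[of "Suc 0"] by (auto simp: prime_field_poly_def F_def intro!: gf_add gf_mult gf_diff)
    have co: "coeff (F a h) n = 1" using hp Bl Bd by (simp add: F_def)
    have "degree (F a h) \<le> n" unfolding F_def
      using hp Bd by (intro degree_add_le) (auto intro: order.trans[OF degree_smult_le])
    moreover have "n \<le> degree (F a h)" using co by (intro le_degree) simp
    ultimately show ?thesis using pf co by (simp add: monic_polys_def)
  qed
  have FF: "F a (F b h) = h" if "a * b = 1" for a b h
  proof -
    have "F a (F b h) = smult (a * b) h + smult (a * (1 - b) + (1 - a)) B"
      by (simp add: F_def smult_add_right smult_add_left)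
    also have "a * (1 - b) + (1 - a) = 0" using that by (simp add: algebra_simps)
    finally show ?thesis using that by simp
  qed
  have bij: "bij_betw (F g) (monic_polys n) (monic_polys n)"
    by (rule bij_betwI[where g = "F (inverse g)"]) (use g F punits_inverse[OF g(1)] in \<open>auto simp: FF\<close>)
  have psiF: "psi (F g h) = chi g ^ sum e W * psi h" if "h \<in> monic_polys n" for h
  proof -
    have "chi (poly (F g h) w) = chi g * chi (poly h w)" if w: "w \<in> W" for w
    proof -
      have "poly h w \<in> gf (Suc 0)" using \<open>h \<in> monic_polys n\<close> w W_subset by (auto simp: monic_polys_def poly_in_gf1)
      then show ?thesis using g by (simp add: F_def Bz[OF w] chi_mult)
    qed
    then show ?thesis by (simp add: psi_def power_mult_distrib prod.distrib power_sum)
  qed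
  have "lcoeff n = (\<Sum>h\<in>monic_polys n. psi (F g h))"
    unfolding lcoeff_def using sum.reindex_bij_betw[OF bij, of psi] by simp
  also have "\<dots> = chi g ^ sum e W * lcoeff n"
    by (simp add: psiF lcoeff_def sum_distrib_left)
  finally have "lcoeff n = 0 \<or> chi g ^ sum e W = 1" by simp
  \<comment> \<open>The exponent is invertible modulo \<open>d\<close>, so some power of
    \<open>chi g ^ sum e W\<close> is \<open>chi g\<close> itself.\<close>
  moreover have "chi g ^ sum e W \<noteq> 1"
  proof
    assume 1: "chi g ^ sum e W = 1"
    obtain a where "[sum e W * a = Suc 0] (mod d)"
      using cong_solve_coprime_nat[OF coprime_sum] by auto
    then have a: "sum e W * a mod d = 1" using d_gt_1 by (simp add: Cong.cong_def)
    have "chi g ^ d = 1" using values_power[of "chi g"] g by simp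
    moreover have "chi g ^ (sum e W * a) = chi g ^ (d * (sum e W * a div d) + sum e W * a mod d)"
      by simp
    ultimately have "chi g ^ (sum e W * a) = chi g"
      unfolding power_add power_mult[of _ d] a by simp
    moreover have "chi g ^ (sum e W * a) = 1" using 1 by (simp add: power_mult)
    ultimately show False using g by simp
  qed
  ultimately show ?thesis by simp
qed

section \<open>Character sums over extensions of even degree\<close>

definition kummer_poly :: "'a poly" where
  "kummer_poly = (\<Prod>w\<in>W. [:w, -1:] ^ e w)"

lemma poly_kummer_poly: "poly kummer_poly x = (\<Prod>w\<in>W. (w - x) ^ e w)"
  by (simp add: kummer_poly_def poly_prod)

lemma kummer_poly_nonzero: "kummer_poly \<noteq> 0"
  using finite_W by (simp add: kummer_poly_def)

lemma degree_kummer_poly: "degree kummer_poly = sum e W"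
  by (simp add: kummer_poly_def degree_prod_eq_sum_degree degree_power_eq)

text \<open>Points of \<open>W\<close> are fixed by Frobenius, so the conjugates of
  \<open>w - x\<close> are the powers \<open>(w - x)^(p^i)\<close>, and their product is a
  norm.\<close>

lemma psi_conj_poly:
  assumes x: "x \<in> gf m"
  shows "(\<Prod>i<m. poly kummer_poly x ^ (p ^ i)) \<in> gf (Suc 0)"
    and "psi (conj_poly m x) = chi (\<Prod>i<m. poly kummer_poly x ^ (p ^ i))"
proof -
  have ev: "poly (conj_poly m x) w = (\<Prod>i<m. (w - x) ^ (p ^ i))" if "w \<in> W" for w
  proof -
    have "w ^ (p ^ i) = w" for i using that W_subset gf1_subset[of w i] by (auto simp: gf_def)
    then show ?thesis by (simp add: poly_conj_poly frob_diff)
  qed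
  have mem: "poly (conj_poly m x) w \<in> gf (Suc 0)" if "w \<in> W" for w
    using that W_subset prime_field_conj_poly[OF x] poly_in_gf1 by auto
  have eq: "(\<Prod>w\<in>W. poly (conj_poly m x) w ^ e w) = (\<Prod>i<m. poly kummer_poly x ^ (p ^ i))"
  proof -
    have "(\<Prod>w\<in>W. poly (conj_poly m x) w ^ e w) = (\<Prod>w\<in>W. \<Prod>i<m. ((w - x) ^ e w) ^ (p ^ i))"
      by (intro prod.cong refl) (simp add: ev prod_power_distrib power_mult[symmetric] mult.commute)
    also have "\<dots> = (\<Prod>i<m. \<Prod>w\<in>W. ((w - x) ^ e w) ^ (p ^ i))" by (rule prod.swap)
    finally show ?thesis by (simp add: poly_kummer_poly prod_power_distrib)
  qed
  show "(\<Prod>i<m. poly kummer_poly x ^ (p ^ i)) \<in> gf (Suc 0)"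
    unfolding eq[symmetric] by (intro gf_prod gf_power mem)
  show "psi (conj_poly m x) = chi (\<Prod>i<m. poly kummer_poly x ^ (p ^ i))"
    unfolding eq[symmetric] psi_def by (subst chi_prod) (auto intro!: gf_power mem prod.cong simp: chi_power mem)
qed

lemma sum_power_p: "(p - 1) * (\<Sum>i<m. p ^ i) = p ^ m - 1"
proof (induction m)
  case (Suc m)
  have "(p - 1) * (\<Sum>i<Suc m. p ^ i) = (p ^ m - 1) + (p - 1) * p ^ m"
    by (simp only: sum.lessThan_Suc distrib_left Suc)
  also have "\<dots> = p ^ Suc m - 1"
  proof -
    have "(p - 1) * p ^ m = p ^ Suc m - p ^ m" by (simp add: diff_mult_distrib)
    moreover have "1 \<le> p ^ m" "p ^ m \<le> p ^ Suc m" using p_gt_1 by auto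
    ultimately show ?thesis by linarith
  qed
  finally show ?case .
qed simp

text \<open>The norm followed by the power \<open>card char_kernel\<close> is the power
  \<open>M = (Q^2 - 1) div d\<close>, so the \<open>M\<close>-th power of \<open>kummer_poly\<close>
  at \<open>x\<close> is constant on a level set. A scalar \<open>\<gamma>\<close> with
  \<open>\<gamma>^M = inverse a\<close> moves that constant to 1, where Stepanov's bound
  applies.\<close>

lemma card_level_set:
  fixes k :: nat
  defines "Q \<equiv> p ^ k"
  assumes z: "z \<noteq> 0" and k: "k > 0"
    and big: "(sum e W + 3) * (1 + d * sum e W) + sum e W < Q div d"
  shows "d * card {x\<in>gf (2 * k). psi (conj_poly (2 * k) x) = z} \<le> Q\<^sup>2 + (1 + d * (2 * sum e W + 3)) * Q"
proof (cases "{x\<in>gf (2 * k). psi (conj_poly (2 * k) x) = z} = {}")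
  case True
  show ?thesis unfolding True by simp
next
  case False
  then obtain x0 where x0: "x0 \<in> gf (2 * k)" "psi (conj_poly (2 * k) x0) = z" by auto
  let ?f = kummer_poly
  define nm where "nm = (\<lambda>y::'a. \<Prod>i<2*k. y ^ (p ^ i))"
  have Q2: "Q\<^sup>2 = p ^ (2 * k)" by (simp add: Q_def power_mult mult.commute)
  define M where "M = (Q\<^sup>2 - 1) div d"
  have dM: "(\<Sum>i<2*k. p ^ i) * card char_kernel * d = Q\<^sup>2 - 1"
  proof -
    have "(\<Sum>i<2*k. p ^ i) * card char_kernel * d = (d * card char_kernel) * (\<Sum>i<2*k. p ^ i)"
      by (simp only: mult.commute mult.left_commute)
    then show ?thesis by (simp only: card_kernel sum_power_p Q2)
  qed
  then have M: "M = (\<Sum>i<2*k. p ^ i) * card char_kernel" unfolding M_def dM[symmetric]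
    using d_gt_1 by simp
  have dvd: "d dvd Q\<^sup>2 - 1" using dM by (metis dvd_triv_right)
  have nmM: "nm y ^ card char_kernel = y ^ M" for y
    by (simp add: nm_def M power_sum[symmetric] power_mult)
  have "Q > 1" unfolding Q_def using p_gt_1 k by (intro one_less_power)
  then have "Q\<^sup>2 > 1" by (metis one_less_power pos2)
  then have "d \<le> Q\<^sup>2 - 1" using dvd by (intro dvd_imp_le) auto
  then have M0: "M > 0" unfolding M_def using d_gt_1 by (simp add: div_greater_zero_iff)
  define a where "a = poly ?f x0 ^ M"
  have nm0: "nm (poly ?f x0) \<noteq> 0"
  proof
    assume "nm (poly ?f x0) = 0"
    then have "z = chi 0" using x0(2) psi_conj_poly(2)[OF x0(1)] by (simp only: nm_def)
    with z chi_0 show False by simp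
  qed
  have "a = nm (poly ?f x0) ^ card char_kernel" by (simp only: a_def nmM)
  with nm0 have a0: "a \<noteq> 0" by simp
  obtain \<gamma> where \<gamma>: "\<gamma> ^ M = inverse a" using nth_root_exists[OF M0] by blast
  with a0 M0 have \<gamma>0: "\<gamma> \<noteq> 0" by (auto simp: zero_power)
  define f1 where "f1 = smult \<gamma> ?f"
  have f1: "f1 \<noteq> 0" "degree f1 = sum e W"
    using \<gamma>0 kummer_poly_nonzero degree_kummer_poly by (auto simp: f1_def)
  have sub: "{x\<in>gf (2 * k). psi (conj_poly (2 * k) x) = z} \<subseteq> {x. x ^ Q\<^sup>2 = x \<and> poly f1 x ^ M = 1}"
  proof
    fix x assume "x \<in> {x\<in>gf (2 * k). psi (conj_poly (2 * k) x) = z}"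
    then have x: "x \<in> gf (2 * k)" "psi (conj_poly (2 * k) x) = z" by auto
    define u v where "u = nm (poly ?f x)" and "v = nm (poly ?f x0)"
    have uv: "u \<in> gf (Suc 0)" "v \<in> gf (Suc 0)" "chi u = z" "chi v = z"
      using psi_conj_poly[OF x(1)] psi_conj_poly[OF x0(1)] x x0 by (auto simp: u_def v_def nm_def)
    have v0: "v \<noteq> 0" "u \<noteq> 0" using uv z chi_0 by auto
    have "chi (u * inverse v * v) = chi (u * inverse v) * chi v"
      using uv gf_inverse[of v "Suc 0"] by (intro chi_mult gf_mult)
    then have "chi (u * inverse v) * chi v = chi u" using v0 by (simp add: mult.assoc)
    then have "chi (u * inverse v) = 1" using uv z by simp
    then have "u * inverse v \<in> char_kernel"
      using uv v0 gf_inverse[of v "Suc 0"] by (simp add: char_kernel_def gf_mult)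
    then have "(u * inverse v) ^ card char_kernel = 1" by (rule kernel_power)
    then have "u ^ card char_kernel = v ^ card char_kernel" using v0 by (simp add: power_mult_distrib power_inverse field_simps)
    then have "poly ?f x ^ M = a" by (simp add: u_def v_def nmM a_def)
    then have "poly f1 x ^ M = 1" using a0 \<gamma> by (simp add: f1_def power_mult_distrib)
    moreover have "x ^ Q\<^sup>2 = x" using x(1) by (simp add: gf_def Q2)
    ultimately show "x \<in> {x. x ^ Q\<^sup>2 = x \<and> poly f1 x ^ M = 1}" by simp
  qed
  have "{x::'a. x ^ Q\<^sup>2 = x \<and> poly f1 x ^ M = 1} \<subseteq> gf (2 * k)"
  proof
    fix x :: 'a assume "x \<in> {x. x ^ Q\<^sup>2 = x \<and> poly f1 x ^ M = 1}"
    then have "x ^ Q\<^sup>2 = x" by blast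
    then show "x \<in> gf (2 * k)" unfolding gf_def CHAR_eq Q2 by (rule CollectI)
  qed
  then have "finite {x::'a. x ^ Q\<^sup>2 = x \<and> poly f1 x ^ M = 1}"
    by (rule finite_subset) (rule finite_gf, use k in linarith)
  then have "d * card {x\<in>gf (2 * k). psi (conj_poly (2 * k) x) = z} \<le> d * card {x. x ^ Q\<^sup>2 = x \<and> poly f1 x ^ M = 1}"
    by (intro mult_left_mono card_mono sub) simp_all
  also have "\<dots> \<le> Q\<^sup>2 + (1 + d * (2 * degree f1 + 3)) * Q"
    unfolding M_def
  proof (rule stepanov_bound[OF char_prime _ f1(1) _ _ k dvd])
    show "coprime (degree f1) d" using f1(2) coprime_sum by simp
    show "(degree f1 + 3) * (1 + d * degree f1) + degree f1 < Q div d" unfolding f1(2) by (rule big)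
  qed (use d_gt_1 in \<open>simp_all add: Q_def\<close>)
  finally show ?thesis by (simp add: f1)
qed

text \<open>Stepanov's method bounds the level sets only from above, by about
  \<open>Q^2 / d\<close>. But together they fill the field up to \<open>D\<close> points, so their
  deficits from the upper bound sum to \<open>O(Q)\<close>. The degrees are even because the method
  works over the field with \<open>Q^2\<close> elements.\<close>

lemma gf_sum_char_bound:
  obtains C :: real and k0 where "\<And>k. k \<ge> k0 \<Longrightarrow> norm (gf_sum_char (2 * k)) \<le> C * real p ^ k"
proof -
  define D where "D = sum e W"
  define big where "big = (D + 3) * (1 + d * D) + D"
  define C0 where "C0 = 1 + d * (2 * D + 3)"
  show ?thesis
  proof (rule that[of "d * (big + 1)" "C0 + D"])
    fix k assume k: "k \<ge> d * (big + 1)"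
    define Q where "Q = p ^ k"
    have "0 < d * (big + 1)" using d_gt_1 by simp
    then have k0: "k > 0" using k by linarith
    have "k < p ^ k" using p_gt_1 power_gt_expt by auto
    then have "d * (big + 1) \<le> Q" using k by (simp add: Q_def)
    then have "big + 1 \<le> Q div d" using d_gt_1 by (simp add: less_eq_div_iff_mult_less_eq mult.commute)
    then have bg: "(sum e W + 3) * (1 + d * sum e W) + sum e W < Q div d" by (simp add: big_def D_def)
    have Q2: "Q\<^sup>2 = p ^ (2 * k)" by (simp add: Q_def power_mult mult.commute)
    define S where "S = (gf (2 * k) :: 'a set)"
    have S: "finite S" "card S = Q\<^sup>2" using finite_gf[of "2*k"] card_gf[of "2*k"] k0 by (auto simp: S_def Q2)
    define \<phi> where "\<phi> = (\<lambda>x. psi (conj_poly (2 * k) x))"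
    define n where "n = (\<lambda>z. card {x\<in>S. \<phi> x = z})"
    have phi_vals: "\<phi> x \<in> vals \<or> (\<phi> x = 0 \<and> poly kummer_poly x = 0)" if "x \<in> S" for x
    proof -
      let ?u = "\<Prod>i<2*k. poly kummer_poly x ^ (p ^ i)"
      have u: "?u \<in> gf (Suc 0)" "\<phi> x = chi ?u" using psi_conj_poly[of x "2*k"] that by (auto simp: \<phi>_def S_def)
      show ?thesis
      proof (cases "?u = 0")
        case True
        then have "poly kummer_poly x = 0" by (auto simp: prod_zero_iff)
        moreover have "\<phi> x = 0" using u(2) unfolding True by (simp only: chi_0)
        ultimately show ?thesis by simp
      next
        case False
        then have "?u \<in> punits" using u by simp
        then show ?thesis using u by auto
      qed
    qed
    have Vfin: "finite vals" using finite_punits by simp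
    have fib: "{x\<in>S. \<phi> x \<in> V} = (\<Union>z\<in>V. {x\<in>S. \<phi> x = z})" for V by auto
    have cardV: "card {x\<in>S. \<phi> x \<in> V} = (\<Sum>z\<in>V. card {x\<in>S. \<phi> x = z})" if "finite V" for V
      unfolding fib using that S by (intro card_UN_disjoint) auto
    have sumV: "(\<Sum>x\<in>{x\<in>S. \<phi> x \<in> V}. \<phi> x) = (\<Sum>z\<in>V. \<Sum>x\<in>{x\<in>S. \<phi> x = z}. \<phi> x)" if "finite V" for V
      unfolding fib using that S by (intro sum.UNION_disjoint) auto
    have nV: "real (n z) \<le> (real Q ^ 2 + C0 * Q) / d" if "z \<in> vals" for z
    proof -
      have "z \<noteq> 0" using that chi_zero_iff by auto
      from card_level_set[OF this k0 bg[unfolded Q_def]]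
      have "d * n z \<le> Q\<^sup>2 + C0 * Q" by (simp add: n_def S_def \<phi>_def C0_def D_def Q_def)
      then have "real (d * n z) \<le> real (Q\<^sup>2 + C0 * Q)" by (rule of_nat_mono)
      then show ?thesis using d_gt_1 by (simp add: field_simps)
    qed
    have sumS: "real (\<Sum>z\<in>vals. n z) \<ge> real Q ^ 2 - D"
    proof -
      have "card S \<le> card {x\<in>S. \<phi> x \<in> vals} + card {x. poly kummer_poly x = 0}"
      proof -
        have "S \<subseteq> {x\<in>S. \<phi> x \<in> vals} \<union> {x. poly kummer_poly x = 0}" using phi_vals by auto
        then have "card S \<le> card ({x\<in>S. \<phi> x \<in> vals} \<union> {x. poly kummer_poly x = 0})"
          using S poly_roots_finite[OF kummer_poly_nonzero] by (intro card_mono) auto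
        then show ?thesis using card_Un_le le_trans by blast
      qed
      moreover have "card {x. poly kummer_poly x = 0} \<le> D"
        using card_poly_roots_bound[OF kummer_poly_nonzero] by (simp add: degree_kummer_poly D_def)
      moreover have "card {x\<in>S. \<phi> x \<in> vals} = (\<Sum>z\<in>vals. n z)"
        unfolding n_def by (rule cardV[OF Vfin])
      ultimately have "Q\<^sup>2 \<le> (\<Sum>z\<in>vals. n z) + D" using S by linarith
      then have "real (Q\<^sup>2) \<le> real ((\<Sum>z\<in>vals. n z) + D)" by (rule of_nat_mono)
      then show ?thesis by simp
    qed
    \<comment> \<open>Subtracting the same \<open>M\<close> from every multiplicity changes nothing,
      as the values of \<open>chi\<close> sum to zero; all differences \<open>M - n z\<close> are
      then nonnegative.\<close>
    define M where "M = (real Q ^ 2 + C0 * Q) / d"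
    have "gf_sum_char (2 * k) = (\<Sum>x\<in>S. \<phi> x)" by (simp add: gf_sum_char_def S_def \<phi>_def)
    also have "\<dots> = (\<Sum>x\<in>{x\<in>S. \<phi> x \<in> vals}. \<phi> x)"
      using S phi_vals by (intro sum.mono_neutral_right) auto
    also have "\<dots> = (\<Sum>z\<in>vals. \<Sum>x\<in>{x\<in>S. \<phi> x = z}. \<phi> x)"
      by (rule sumV[OF Vfin])
    also have "\<dots> = (\<Sum>z\<in>vals. of_nat (n z) * z)" by (intro sum.cong) (auto simp: n_def)
    also have "\<dots> = (\<Sum>z\<in>vals. of_real (real (n z) - M) * z) + of_real M * (\<Sum>z\<in>vals. z)"
    proof -
      have "of_nat (n z) * z = of_real (real (n z) - M) * z + of_real M * z" for z
        by (simp add: left_diff_distrib)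
      then show ?thesis by (simp only: sum.distrib sum_distrib_left)
    qed
    also have "\<dots> = (\<Sum>z\<in>vals. of_real (real (n z) - M) * z)" by (simp add: sum_values)
    finally have "norm (gf_sum_char (2 * k)) \<le> (\<Sum>z\<in>vals. norm (of_real (real (n z) - M) * z))"
      by (simp only: norm_sum)
    also have "\<dots> = (\<Sum>z\<in>vals. M - real (n z))"
      using nV by (intro sum.cong refl) (simp add: norm_mult norm_values M_def norm_of_real del: of_real_diff)
    also have "\<dots> = d * M - real (\<Sum>z\<in>vals. n z)"
      by (simp add: sum_subtractf d_eq)
    also have "\<dots> \<le> (real Q ^ 2 + C0 * Q) - (real Q ^ 2 - D)"
      using sumS d_gt_1 by (simp add: M_def)
    also have "\<dots> \<le> (C0 + D) * real Q"
    proof -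
      have "real D * 1 \<le> real D * real Q"
        using p_gt_1 by (intro mult_left_mono) (auto simp: Q_def)
      then show ?thesis by (simp add: algebra_simps)
    qed
    finally show "norm (gf_sum_char (2 * k)) \<le> (C0 + D) * real p ^ k" by (simp add: Q_def)
  qed
qed

end

section \<open>The Weil bound\<close>

lemma sum_power_combination:
  fixes q :: "'a::comm_ring_1 poly"
  shows "(\<Sum>l\<le>degree q. coeff q l * (\<Sum>z\<in>Z. m z * z ^ (n + l))) = (\<Sum>z\<in>Z. m z * z ^ n * poly q z)"
proof -
  have "(\<Sum>l\<le>degree q. coeff q l * (\<Sum>z\<in>Z. m z * z ^ (n + l))) = (\<Sum>l\<le>degree q. \<Sum>z\<in>Z. m z * z ^ n * (coeff q l * z ^ l))"
    by (simp add: sum_distrib_left power_add mult_ac)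
  also have "\<dots> = (\<Sum>z\<in>Z. \<Sum>l\<le>degree q. m z * z ^ n * (coeff q l * z ^ l))" by (rule sum.swap)
  finally show ?thesis by (simp add: poly_altdef sum_distrib_left)
qed

text \<open>A polynomial that vanishes at all the bases but one turns a bound for the
  exponential sum into a bound for the powers of the remaining base.\<close>

lemma exponential_sum_growth:
  fixes m :: "complex \<Rightarrow> complex"
  assumes "finite Z" "\<And>z. z \<in> Z \<Longrightarrow> m z \<noteq> 0" "B \<ge> 0"
    and bound: "\<And>n. n \<ge> N \<Longrightarrow> norm (\<Sum>z\<in>Z. m z * z ^ n) \<le> C * B ^ n"
    and z: "z \<in> Z"
  shows "norm z \<le> B"
proof (rule ccontr)
  assume "\<not> norm z \<le> B"
  then have gt: "B < norm z" by simp
  define q where "q = (\<Prod>u\<in>Z-{z}. [:-u, 1:])"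
  define K where "K = norm (m z) * norm (poly q z)"
  define C2 where "C2 = (\<Sum>l\<le>degree q. norm (coeff q l) * (C * B ^ l))"
  have "poly q z \<noteq> 0" using assms(1) by (auto simp: q_def poly_prod)
  then have K: "K > 0" using assms(2)[OF z] by (simp add: K_def)
  have qz: "poly q u = 0" if "u \<in> Z - {z}" for u
    using that assms(1) by (auto simp: q_def poly_prod)
  have main: "norm z ^ n * K \<le> B ^ n * C2" if n: "n \<ge> N" for n
  proof -
    have "(\<Sum>u\<in>Z. m u * u ^ n * poly q u) = (\<Sum>u\<in>{z}. m u * u ^ n * poly q u)"
      using assms(1) z qz by (intro sum.mono_neutral_right) auto
    then have "m z * z ^ n * poly q z = (\<Sum>l\<le>degree q. coeff q l * (\<Sum>u\<in>Z. m u * u ^ (n + l)))"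
      by (simp add: sum_power_combination)
    then have "norm z ^ n * K = norm (\<Sum>l\<le>degree q. coeff q l * (\<Sum>u\<in>Z. m u * u ^ (n + l)))"
      by (simp add: K_def norm_mult norm_power flip: \<open>m z * z ^ n * poly q z = _\<close>)
    also have "\<dots> \<le> (\<Sum>l\<le>degree q. norm (coeff q l) * (C * B ^ (n + l)))"
      using bound n by (intro sum_norm_le) (auto simp: norm_mult intro!: mult_left_mono)
    also have "\<dots> = B ^ n * C2"
      by (simp add: C2_def sum_distrib_left power_add mult_ac)
    finally show ?thesis .
  qed
  show False
  proof (cases "B = 0")
    case True
    then have "norm z ^ Suc N * K \<le> 0" using main[of "Suc N"] by simp
    moreover have "norm z ^ Suc N * K > 0" using gt True K by simp
    ultimately show False by linarith
  next
    case False
    then have B: "B > 0" using assms(3) by simp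
    then have "norm z / B > 1" using gt by simp
    then obtain n where n: "C2 / K < (norm z / B) ^ n" using real_arch_pow by blast
    have "(norm z / B) ^ n \<le> (norm z / B) ^ (n + N)"
      using \<open>norm z / B > 1\<close> by (intro power_increasing) auto
    with n have "C2 / K < (norm z / B) ^ (n + N)" by linarith
    then have "C2 / K < norm z ^ (n + N) / B ^ (n + N)" by (simp add: power_divide)
    then have "C2 * B ^ (n + N) < norm z ^ (n + N) * K"
      using K B by (simp add: field_simps)
    with main[of "n + N"] show False by (simp add: mult.commute)
  qed
qed

definition power_sum_fps :: "complex list \<Rightarrow> complex fps" where
  "power_sum_fps ws = Abs_fps (\<lambda>m. if m = 0 then 0 else \<Sum>w\<leftarrow>ws. w ^ m)"

text \<open>This is the logarithmic derivative \<open>X F' / F = - \<Sum> p_m X^m\<close> with the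
  power sums \<open>p_m\<close>, cleared of the denominator.\<close>

lemma fps_log_deriv_prod_list:
  "fps_X * fps_deriv (\<Prod>w\<leftarrow>ws. 1 - fps_const w * fps_X) =
     - ((\<Prod>w\<leftarrow>ws. 1 - fps_const w * fps_X) * power_sum_fps ws)"
proof (induction ws)
  case Nil
  have "power_sum_fps [] = 0" by (rule fps_ext) (simp add: power_sum_fps_def)
  then show ?case by simp
next
  case (Cons a ws)
  define F where "F = (\<Prod>w\<leftarrow>ws. 1 - fps_const w * fps_X)"
  define G where "G = Abs_fps (\<lambda>m. if m = 0 then 0 else a ^ m)"
  have G: "(1 - fps_const a * fps_X) * G = fps_const a * fps_X"
  proof (rule fps_ext)
    fix n show "((1 - fps_const a * fps_X) * G) $ n = (fps_const a * fps_X) $ n"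
      by (cases n; cases "n - 1") (auto simp: left_diff_distrib mult.assoc G_def fps_X_nth)
  qed
  have S: "power_sum_fps (a # ws) = G + power_sum_fps ws"
    by (rule fps_ext) (simp add: power_sum_fps_def G_def)
  have "fps_X * fps_deriv ((1 - fps_const a * fps_X) * F) =
      - (fps_const a * fps_X * F) + (1 - fps_const a * fps_X) * (fps_X * fps_deriv F)"
    by (simp add: algebra_simps)
  also have "fps_X * fps_deriv F = - (F * power_sum_fps ws)" using Cons by (simp add: F_def)
  also have "- (fps_const a * fps_X * F) + (1 - fps_const a * fps_X) * - (F * power_sum_fps ws)
    = - (((1 - fps_const a * fps_X) * F) * (G + power_sum_fps ws))"
    by (subst G[symmetric]) (simp add: algebra_simps)
  finally show ?case by (simp add: F_def S)
qed

text \<open>The constant term 1 excludes the root 0, so every linear factor can be normalised to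
  have constant term 1.\<close>

lemma complex_poly_as_prod_list:
  fixes P :: "complex poly"
  assumes "poly P 0 = 1"
  obtains ws where "length ws = degree P" "P = (\<Prod>w\<leftarrow>ws. [:1, -w:])"
proof -
  have P0: "P \<noteq> 0" using assms by auto
  from alg_closed_imp_factorization[OF P0] obtain A
    where A: "size A = degree P" "P = smult (lead_coeff P) (\<Prod>x\<in>#A. [:-x, 1:])" by auto
  obtain xs where xs: "mset xs = A" using ex_mset by blast
  obtain l where P: "P = smult l (\<Prod>x\<leftarrow>xs. [:-x, 1:])"
    using A(2) by (auto simp flip: xs prod_mset_prod_list mset_map)
  have nz: "0 \<notin> set xs"
  proof
    assume "0 \<in> set xs"
    then have "poly (\<Prod>x\<leftarrow>xs. [:-x, 1:]) 0 = 0" by (induction xs) auto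
    with assms show False by (subst (asm) P) simp
  qed
  have "\<exists>c. (\<Prod>x\<leftarrow>xs. [:-x, 1:]) = smult c (\<Prod>x\<leftarrow>xs. [:1, -inverse x:])"
    using nz
  proof (induction xs)
    case (Cons x xs)
    then obtain c where c: "(\<Prod>x\<leftarrow>xs. [:-x, 1:]) = smult c (\<Prod>x\<leftarrow>xs. [:1, -inverse x:])" by auto
    have "[:-x, 1:] = smult (-x) [:1, -inverse x:]" using Cons.prems by simp
    then have "[:-x, 1:] * (\<Prod>x\<leftarrow>xs. [:-x, 1:]) = smult (-x * c) ([:1, -inverse x:] * (\<Prod>x\<leftarrow>xs. [:1, -inverse x:]))"
      by (simp only: c mult_smult_left mult_smult_right smult_smult mult.commute)
    then show ?case by (intro exI[of _ "- x * c"]) (simp only: list.map prod_list.Cons)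
  qed (auto intro: exI[of _ 1])
  then obtain c where "(\<Prod>x\<leftarrow>xs. [:-x, 1:]) = smult c (\<Prod>x\<leftarrow>xs. [:1, -inverse x:])" by auto
  then have Pc: "P = smult (l * c) (\<Prod>w\<leftarrow>map inverse xs. [:1, -w:])"
    by (simp add: P o_def)
  have one: "poly (\<Prod>w\<leftarrow>ys. [:1, -w:]) (0::complex) = 1" for ys by (induction ys) auto
  have "l * c = 1" using assms unfolding Pc poly_smult one by simp
  then have "P = (\<Prod>w\<leftarrow>map inverse xs. [:1, -w:])" using Pc by simp
  then show ?thesis using A(1) xs by (intro that[of "map inverse xs"]) auto
qed

text \<open>The recursion says \<open>X F' = U F\<close> for the generating polynomial
  \<open>F\<close> of \<open>c\<close> and the series \<open>U\<close> of \<open>T\<close>.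
  Comparison with the factored form of \<open>F\<close> identifies \<open>U\<close>.\<close>

lemma newton_power_sums:
  fixes c T :: "nat \<Rightarrow> complex"
  assumes c0: "c 0 = 1" and cN: "\<And>n. n \<ge> N \<Longrightarrow> c n = 0"
    and newton: "\<And>n. of_nat n * c n = (\<Sum>m=1..n. T m * c (n - m))"
  obtains ws where "length ws \<le> N" "\<And>m. m > 0 \<Longrightarrow> T m = - (\<Sum>w\<leftarrow>ws. w ^ m)"
proof -
  define P where "P = (\<Sum>n<N. monom (c n) n)"
  have cP: "coeff P n = c n" for n
    using cN[of n] by (auto simp: P_def coeff_sum)
  then have "poly P 0 = 1" using c0 by (simp add: poly_0_coeff_0)
  then obtain ws where ws: "length ws = degree P" "P = (\<Prod>w\<leftarrow>ws. [:1, -w:])"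
    using complex_poly_as_prod_list by blast
  have deg: "degree P \<le> N" by (rule degree_le) (simp add: cP cN)
  define F where "F = fps_of_poly P"
  have "fps_of_poly (\<Prod>w\<leftarrow>ws. [:1, -w:]) = (\<Prod>w\<leftarrow>ws. 1 - fps_const w * fps_X)"
    by (induction ws) (simp_all add: fps_of_poly_mult fps_of_poly_pCons fps_of_poly_0 mult.commute del: mult_pCons_left)
  then have F: "F = (\<Prod>w\<leftarrow>ws. 1 - fps_const w * fps_X)" using ws(2) by (simp add: F_def)
  define U where "U = Abs_fps (\<lambda>m. if m = 0 then 0 else T m)"
  have "fps_X * fps_deriv F = U * F"
  proof (rule fps_ext)
    fix n
    have "(U * F) $ n = (\<Sum>m=0..n. (if m = 0 then 0 else T m) * c (n - m))"
      by (simp add: fps_mult_nth U_def F_def cP)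
    also have "\<dots> = (\<Sum>m=1..n. T m * c (n - m))"
      by (intro sum.mono_neutral_cong_right) auto
    also have "\<dots> = (fps_X * fps_deriv F) $ n"
      unfolding newton[symmetric] by (cases n) (simp_all add: F_def cP)
    finally show "(fps_X * fps_deriv F) $ n = (U * F) $ n" ..
  qed
  also have "fps_X * fps_deriv F = - (F * power_sum_fps ws)"
    unfolding F by (rule fps_log_deriv_prod_list)
  finally have UF: "- (F * power_sum_fps ws) = U * F" .
  have "F * (U + power_sum_fps ws) = U * F + F * power_sum_fps ws" by (simp add: distrib_left mult.commute)
  then have "F * (U + power_sum_fps ws) = 0" unfolding UF[symmetric] by simp
  moreover have "F $ 0 = 1" by (simp add: F_def cP c0)
  then have "F \<noteq> 0" by auto
  ultimately have U: "U = - power_sum_fps ws" by (simp add: eq_neg_iff_add_eq_0)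
  show ?thesis
  proof (rule that[of ws])
    show "length ws \<le> N" using ws deg by simp
    fix m :: nat assume "m > 0"
    then show "T m = - (\<Sum>w\<leftarrow>ws. w ^ m)"
      using arg_cong[OF U, of "\<lambda>f. f $ m"] by (simp add: U_def power_sum_fps_def)
  qed
qed

context kummer_sum
begin

text \<open>Only the power sums of even index are bounded, so \<open>exponential_sum_growth\<close>
  is applied to the squares of the reciprocal roots. Different roots may share a square; the
  multiplicities \<open>mz\<close> are positive, so no base drops out.\<close>

theorem weil_bound_closed_field:
  "norm (\<Sum>x\<in>gf (Suc 0). \<Prod>w\<in>W. chi (w - x) ^ e w) \<le> real (card W) * sqrt (real p)"
proof -
  obtain ws where ws: "length ws \<le> card W" "\<And>m. m > 0 \<Longrightarrow> gf_sum_char m = - (\<Sum>w\<leftarrow>ws. w ^ m)"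
    by (rule newton_power_sums[of lcoeff "card W" gf_sum_char, OF lcoeff_0 lcoeff_eq_0 newton_lcoeff]) blast+
  obtain C :: real and k0 where Ck: "\<And>k. k \<ge> k0 \<Longrightarrow> norm (gf_sum_char (2 * k)) \<le> C * real p ^ k"
    using gf_sum_char_bound by blast
  define Z where "Z = (\<lambda>w. w\<^sup>2) ` set ws"
  define mz where "mz = (\<lambda>z. of_nat (card {i\<in>{..<length ws}. (ws ! i)\<^sup>2 = z}) :: complex)"
  have sq: "norm (w\<^sup>2) \<le> real p" if w: "w \<in> set ws" for w
  proof (rule exponential_sum_growth[where Z = Z and m = mz and N = "Suc k0" and C = C])
    show "finite Z" by (simp add: Z_def)
    show "w\<^sup>2 \<in> Z" using w by (auto simp: Z_def)
    fix z assume "z \<in> Z"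
    then obtain i where "i < length ws" "(ws ! i)\<^sup>2 = z" by (auto simp: Z_def in_set_conv_nth)
    then have "{i\<in>{..<length ws}. (ws ! i)\<^sup>2 = z} \<noteq> {}" by auto
    then show "mz z \<noteq> 0" by (auto simp: mz_def card_eq_0_iff)
  next
    fix n assume n: "n \<ge> Suc k0"
    have Z: "Z = (\<lambda>i. (ws ! i)\<^sup>2) ` {..<length ws}" by (auto simp: Z_def set_conv_nth)
    have "(\<Sum>w\<leftarrow>ws. w ^ (2 * n)) = (\<Sum>i<length ws. ((ws ! i)\<^sup>2) ^ n)"
      by (simp add: sum_list_sum_nth lessThan_atLeast0 power_mult)
    also have "\<dots> = (\<Sum>z\<in>Z. \<Sum>i\<in>{i\<in>{..<length ws}. (ws ! i)\<^sup>2 = z}. ((ws ! i)\<^sup>2) ^ n)"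
      unfolding Z by (rule sum.image_gen) simp
    also have "\<dots> = (\<Sum>z\<in>Z. mz z * z ^ n)" by (intro sum.cong refl) (simp add: mz_def)
    finally have "gf_sum_char (2 * n) = - (\<Sum>z\<in>Z. mz z * z ^ n)" using ws(2)[of "2*n"] n by simp
    then show "norm (\<Sum>z\<in>Z. mz z * z ^ n) \<le> C * real p ^ n" using Ck[of n] n by simp
  qed simp
  have nw: "norm w \<le> sqrt (real p)" if "w \<in> set ws" for w
    using sq[OF that] by (simp add: norm_power real_le_rsqrt)
  have "gf_sum_char 1 = (\<Sum>x\<in>gf (Suc 0). \<Prod>w\<in>W. chi (w - x) ^ e w)"
    by (simp add: gf_sum_char_def psi_def poly_conj_poly)
  then have "norm (\<Sum>x\<in>gf (Suc 0). \<Prod>w\<in>W. chi (w - x) ^ e w) = norm (\<Sum>w\<leftarrow>ws. w)"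
    using ws(2)[of 1] by simp
  also have "\<dots> \<le> (\<Sum>w\<leftarrow>ws. norm w)" by (induction ws) (auto intro: norm_triangle_le)
  also have "\<dots> \<le> (\<Sum>w\<leftarrow>ws. sqrt (real p))" by (rule sum_list_mono) (rule nw)
  also have "\<dots> = real (length ws) * sqrt (real p)" by (simp add: sum_list_triv)
  also have "\<dots> \<le> real (card W) * sqrt (real p)" using ws(1) by (intro mult_right_mono) auto
  finally show ?thesis .
qed

end

section \<open>Transfer to characters of the integers modulo p\<close>

definition dirichlet_char :: "nat \<Rightarrow> (int \<Rightarrow> complex) \<Rightarrow> bool" where
  "dirichlet_char p chi \<longleftrightarrow> (\<forall>a b. chi (a * b) = chi a * chi b) \<and>
     (\<forall>a b. [a = b] (mod int p) \<longrightarrow> chi a = chi b) \<and> (\<forall>a. chi a = 0 \<longleftrightarrow> int p dvd a)"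

text \<open>The values of a character on the units form a cyclic group, whose size is the order of
  the character.\<close>

definition char_order :: "nat \<Rightarrow> (int \<Rightarrow> complex) \<Rightarrow> nat" where
  "char_order p chi = card (chi ` {1..<int p})"

definition weil_bound :: "nat \<Rightarrow> bool" where
  "weil_bound p \<longleftrightarrow> (\<forall>chi W e. dirichlet_char p chi \<longrightarrow> char_order p chi > 1 \<longrightarrow> W \<subseteq> {0..<int p} \<longrightarrow>
     (\<forall>w\<in>W. 0 < e w) \<longrightarrow> coprime (\<Sum>w\<in>W. e w) (char_order p chi) \<longrightarrow>
     norm (\<Sum>x\<in>{0..<int p}. \<Prod>w\<in>W. chi (w - x) ^ e w) \<le> real (card W) * sqrt (real p))"

text \<open>A field of each prime order \<open>p\<close> is not available as a type depending on \<open>p\<close>. It is enough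
  to have one for a hypothetical counterexample to the theorem, and this is a closed term.\<close>

definition weil_counterexample :: nat where
  "weil_counterexample = (if \<exists>p. prime p \<and> \<not> weil_bound p then SOME p. prime p \<and> \<not> weil_bound p else 2)"

lemma prime_weil_counterexample: "prime weil_counterexample"
  using someI_ex[of "\<lambda>p. prime p \<and> \<not> weil_bound p"]
  by (auto simp: weil_counterexample_def)

lemma weil_bound_from_counterexample:
  assumes "weil_bound weil_counterexample" "prime p"
  shows "weil_bound p"
  using someI_ex[of "\<lambda>p. prime p \<and> \<not> weil_bound p"] assms
  by (auto simp: weil_counterexample_def split: if_splits)

typedef residue = "{0..<weil_counterexample}"
  using prime_gt_0_nat[OF prime_weil_counterexample] by (intro exI[of _ 0]) simp

lemma card_residue: "CARD(residue) = weil_counterexample"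
  using type_definition.card[OF type_definition_residue] by simp

instance residue :: prime_card
  by standard (simp add: card_residue prime_weil_counterexample)

type_synonym closed_residue_field = "residue mod_ring alg_closure"

lemma CHAR_closed_residue_field: "CHAR(closed_residue_field) = weil_counterexample"
  by (simp add: card_residue)

text \<open>The closure of the residue field has the characteristic in question, and
  \<open>of_int\<close> identifies \<open>{0..<p}\<close> with its prime field. The character is
  carried over along the inverse \<open>\<kappa>\<close> of this identification.\<close>

lemma weil_bound_weil_counterexample: "weil_bound weil_counterexample"
  unfolding weil_bound_def
proof (intro allI impI)
  define p where "p = weil_counterexample"
  have pp: "prime p" unfolding p_def by (rule prime_weil_counterexample)
  fix chi :: "int \<Rightarrow> complex" and W :: "int set" and e :: "int \<Rightarrow> nat"
  assume chi: "dirichlet_char weil_counterexample chi" and ord: "char_order weil_counterexample chi > 1"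
    and W: "W \<subseteq> {0..<int weil_counterexample}" and e: "\<forall>w\<in>W. 0 < e w"
    and cop: "coprime (\<Sum>w\<in>W. e w) (char_order weil_counterexample chi)"
  note * = chi ord W e cop
  note * = *[folded p_def]
  define \<iota> where "\<iota> = (of_int :: int \<Rightarrow> closed_residue_field)"
  interpret char_p_closed "TYPE(closed_residue_field)" p
    by unfold_locales (use pp CHAR_closed_residue_field in \<open>auto simp: p_def\<close>)
  have cong: "\<iota> a = \<iota> b \<longleftrightarrow> [a = b] (mod int p)" for a b
    unfolding \<iota>_def by (simp add: of_int_eq_iff_cong_CHAR card_residue p_def)
  have inj: "inj_on \<iota> {0..<int p}"
    by (auto intro!: inj_onI simp: cong Cong.cong_def)
  have nat_gf: "of_nat n \<in> (gf (Suc 0) :: closed_residue_field set)" for n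
    by (induction n) (auto intro!: gf_0 gf_1 gf_add)
  have "\<iota> ` {0..<int p} \<subseteq> gf (Suc 0)"
  proof
    fix x assume "x \<in> \<iota> ` {0..<int p}"
    then obtain a where a: "a \<ge> 0" "x = of_int a" by (auto simp: \<iota>_def)
    then have "x = of_nat (nat a)" by simp
    then show "x \<in> gf (Suc 0)" using nat_gf by simp
  qed
  then have img: "\<iota> ` {0..<int p} = gf (Suc 0)"
    using inj by (intro card_subset_eq finite_gf) (auto simp: card_image card_gf)
  define \<kappa> where "\<kappa> = inv_into {0..<int p} \<iota>"
  have \<kappa>: "\<kappa> x \<in> {0..<int p}" "\<iota> (\<kappa> x) = x" if "x \<in> gf (Suc 0)" for x
    using that unfolding img[symmetric] \<kappa>_def by (rule inv_into_into, rule f_inv_into_f)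
  have \<kappa>\<iota>: "\<kappa> (\<iota> a) = a" if "a \<in> {0..<int p}" for a
    using that inj by (simp add: \<kappa>_def)
  have chic: "chi a = chi b" if "\<iota> a = \<iota> b" for a b
    using *(1) that by (simp add: dirichlet_char_def cong)
  have chi\<kappa>: "chi (\<kappa> (\<iota> a)) = chi a" for a
  proof -
    have "\<iota> a = \<iota> (a mod int p)" by (simp add: cong Cong.cong_def)
    moreover have "a mod int p \<in> {0..<int p}" using p_gt_1 by simp
    ultimately have "\<iota> a \<in> gf (Suc 0)" unfolding img[symmetric] by (metis imageI)
    then have "\<iota> (\<kappa> (\<iota> a)) = \<iota> a" by (rule \<kappa>(2))
    then show ?thesis by (rule chic)
  qed
  have unit_img: "gf (Suc 0) - {0} = \<iota> ` {1..<int p}"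
  proof -
    have "{0..<int p} = insert 0 {1..<int p}" using p_gt_1 by auto
    then have "gf (Suc 0) = insert 0 (\<iota> ` {1..<int p})" using img by (simp add: \<iota>_def)
    moreover have "0 \<notin> \<iota> ` {1..<int p}"
    proof
      assume "0 \<in> \<iota> ` {1..<int p}"
      then obtain a where "a \<in> {1..<int p}" "\<iota> a = \<iota> 0" by (auto simp: \<iota>_def)
      then show False by (auto simp: cong Cong.cong_def)
    qed
    ultimately show ?thesis by auto
  qed
  have d: "char_order p chi = card ((\<lambda>x. chi (\<kappa> x)) ` (gf (Suc 0) - {0}))"
    unfolding unit_img char_order_def image_image chi\<kappa> ..
  have sumW: "(\<Sum>w\<in>\<iota> ` W. e (\<kappa> w)) = (\<Sum>w\<in>W. e w)"
  proof (subst sum.reindex)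
    show "inj_on \<iota> W" using *(3) by (rule inj_on_subset[OF inj])
    show "sum ((\<lambda>x. e (\<kappa> x)) \<circ> \<iota>) W = sum e W"
      unfolding o_def using *(3) \<kappa>\<iota> by (intro sum.cong refl arg_cong[of _ _ e]) blast
  qed
  interpret kummer_sum "TYPE(closed_residue_field)" p "\<lambda>x. chi (\<kappa> x)" "\<iota> ` W" "\<lambda>x. e (\<kappa> x)" "char_order p chi"
  proof
    fix x y :: closed_residue_field assume xy: "x \<in> gf (Suc 0)" "y \<in> gf (Suc 0)"
    have "x * y = \<iota> (\<kappa> x * \<kappa> y)" using \<kappa>(2) xy by (simp add: \<iota>_def)
    then show "chi (\<kappa> (x * y)) = chi (\<kappa> x) * chi (\<kappa> y)"
      using *(1) by (simp add: chi\<kappa> dirichlet_char_def)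
  next
    fix x :: closed_residue_field assume x: "x \<in> gf (Suc 0)"
    have "chi (\<kappa> x) = 0 \<longleftrightarrow> \<iota> (\<kappa> x) = \<iota> 0"
      using *(1) by (simp add: dirichlet_char_def cong cong_0_iff)
    then show "chi (\<kappa> x) = 0 \<longleftrightarrow> x = 0" using \<kappa>[OF x] by (simp add: \<iota>_def)
  next
    show "char_order p chi = card ((\<lambda>x. chi (\<kappa> x)) ` (gf (Suc 0) - {0}))" by (rule d)
    show "1 < char_order p chi" by (rule *(2))
    show "\<iota> ` W \<subseteq> gf (Suc 0)" using *(3) img by auto
    show "0 < e (\<kappa> w)" if wW: "w \<in> \<iota> ` W" for w
    proof -
      obtain v where "v \<in> W" "w = \<iota> v" using wW by blast
      then show ?thesis using *(3,4) \<kappa>\<iota>[of v] by auto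
    qed
    show "coprime (\<Sum>w\<in>\<iota> ` W. e (\<kappa> w)) (char_order p chi)" unfolding sumW by (rule *(5))
  qed
  have injW: "inj_on \<iota> W" using *(3) by (rule inj_on_subset[OF inj])
  have "(\<Sum>x\<in>gf (Suc 0). \<Prod>w\<in>\<iota> ` W. chi (\<kappa> (w - x)) ^ e (\<kappa> w)) = (\<Sum>x\<in>{0..<int p}. \<Prod>w\<in>W. chi (w - x) ^ e w)"
    unfolding img[symmetric] sum.reindex[OF inj] prod.reindex[OF injW] o_def
  proof (intro sum.cong prod.cong refl)
    fix x w assume "w \<in> W"
    then have "\<kappa> (\<iota> w) = w" using *(3) \<kappa>\<iota> by auto
    moreover have "\<iota> w - \<iota> x = \<iota> (w - x)" by (simp add: \<iota>_def)
    ultimately show "chi (\<kappa> (\<iota> w - \<iota> x)) ^ e (\<kappa> (\<iota> w)) = chi (w - x) ^ e w" by (simp add: chi\<kappa>)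
  qed
  with weil_bound_closed_field
  show "norm (\<Sum>x\<in>{0..<int weil_counterexample}. \<Prod>w\<in>W. chi (w - x) ^ e w) \<le> real (card W) * sqrt (real weil_counterexample)"
    by (simp add: card_image[OF injW] flip: p_def)
qed

lemma weil_bound_prime:
  assumes "prime p"
  shows "weil_bound p"
  using weil_bound_from_counterexample[OF weil_bound_weil_counterexample assms] .

section \<open>Burgess's inequality\<close>

lemma dirichlet_charD:
  assumes "dirichlet_char p chi"
  shows "chi (a * b) = chi a * chi b" "[a = b] (mod int p) \<Longrightarrow> chi a = chi b" "chi a = 0 \<longleftrightarrow> int p dvd a"
  using assms by (auto simp: dirichlet_char_def)

lemma obtain_inverse_mod:
  assumes "prime p" "\<not> int p dvd a"
  obtains b where "[a * b = 1] (mod int p)" "\<not> int p dvd b"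
proof -
  have "coprime a (int p)" using assms by (meson prime_imp_coprime prime_nat_int_transfer coprime_commute)
  then obtain b where b: "[a * b = 1] (mod int p)" using cong_solve_coprime_int by blast
  moreover have "\<not> int p dvd b"
  proof
    assume "int p dvd b"
    then have "[a * b = 0] (mod int p)" by (simp add: cong_0_iff)
    with b have "[0 = 1] (mod int p)" by (meson cong_sym cong_trans)
    then have "int p dvd 1" by (metis cong_0_iff cong_sym)
    with assms(1) show False using prime_gt_1_nat[OF assms(1)] by simp
  qed
  ultimately show ?thesis by (rule that)
qed

locale dirichlet =
  fixes p :: nat and chi :: "int \<Rightarrow> complex" and d :: nat
  assumes prime_p: "prime p" and char: "dirichlet_char p chi" and d_eq: "d = char_order p chi"
begin

lemmas chi_mult = dirichlet_charD(1)[OF char]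
lemmas chi_cong = dirichlet_charD(2)[OF char]
lemmas chi_eq_0_iff = dirichlet_charD(3)[OF char]

lemma p_gt_1: "p > 1" using prime_p by (rule prime_gt_1_nat)

lemma chi_0 [simp]: "chi 0 = 0" by (simp add: chi_eq_0_iff)

lemma chi_1 [simp]: "chi 1 = 1"
proof -
  have "chi 1 \<noteq> 0" using p_gt_1 by (simp add: chi_eq_0_iff)
  moreover have "chi 1 * chi 1 = chi 1" using chi_mult[of 1 1] by simp
  ultimately show ?thesis by simp
qed

lemma chi_prod: "chi (prod f A) = (\<Prod>i\<in>A. chi (f i))"
  by (induction A rule: infinite_finite_induct) (simp_all add: chi_mult)

lemma chi_mod: "chi (a mod int p) = chi a"
  by (rule chi_cong) (simp add: Cong.cong_def)

lemma chi_in_image: "\<not> int p dvd a \<Longrightarrow> chi a \<in> chi ` {1..<int p}"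
proof -
  assume a: "\<not> int p dvd a"
  have "0 \<le> a mod int p" "a mod int p < int p" using p_gt_1 by simp_all
  moreover have "a mod int p \<noteq> 0" using a by (simp add: dvd_eq_mod_eq_0)
  ultimately have "a mod int p \<in> {1..<int p}" by simp
  then show ?thesis by (metis chi_mod imageI)
qed

lemma not_dvd_residue: "a \<in> {1..<int p} \<Longrightarrow> \<not> int p dvd a"
  by (auto dest: zdvd_imp_le)

lemma chi_power_order: "\<not> int p dvd a \<Longrightarrow> chi a ^ d = 1"
proof -
  assume a: "\<not> int p dvd a"
  have "chi a ^ card (chi ` {1..<int p}) = 1"
  proof (rule power_card_stable_set)
    show "0 \<notin> chi ` {1..<int p}" using not_dvd_residue chi_eq_0_iff by (metis imageE)
    show "chi a \<noteq> 0" using a by (simp add: chi_eq_0_iff)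
    fix y assume "y \<in> chi ` {1..<int p}"
    then obtain b where b: "y = chi b" "\<not> int p dvd b" using not_dvd_residue by auto
    then have "\<not> int p dvd a * b" using a prime_p by (simp add: prime_dvd_mult_iff)
    then show "chi a * y \<in> chi ` {1..<int p}" using chi_in_image[of "a * b"] by (simp add: b chi_mult)
  qed simp
  then show ?thesis by (simp add: d_eq char_order_def)
qed

lemma d_pos: "d > 0"
proof -
  have "{1..<int p} \<noteq> {}" using p_gt_1 by simp
  then show ?thesis by (simp add: d_eq char_order_def card_gt_0_iff)
qed

lemma norm_chi: "\<not> int p dvd a \<Longrightarrow> norm (chi a) = 1"
  using power_eq_imp_eq_base[of "norm (chi a)" d 1] chi_power_order[of a] d_pos by (simp add: norm_power[symmetric])

lemma norm_chi_le_1: "norm (chi a) \<le> 1"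
  using norm_chi[of a] chi_eq_0_iff[of a] by (cases "int p dvd a") auto

text \<open>This turns the conjugated factors of a moment into powers of \<open>chi\<close>. The
  condition \<open>d > 1\<close> matters where \<open>chi\<close> vanishes.\<close>

lemma cnj_chi: "d > 1 \<Longrightarrow> cnj (chi a) = chi a ^ (d - 1)"
proof (cases "int p dvd a")
  case True
  assume "d > 1"
  with True show ?thesis using chi_eq_0_iff[of a] by (simp add: zero_power)
next
  case False
  assume "d > 1"
  have "chi a * chi a ^ (d - 1) = chi a * cnj (chi a)"
    using chi_power_order[OF False] norm_chi[OF False] d_pos
    by (simp add: power_eq_if[of "chi a" d] complex_norm_square[symmetric])
  then show ?thesis using False chi_eq_0_iff by simp
qed

text \<open>The substitution \<open>x = 1/u - w0\<close> moves the root \<open>-w0\<close> to infinity, so that the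
  degree of the transformed polynomial becomes prime to \<open>d\<close>.\<close>

lemma complete_sum_bound:
  fixes W :: "int set" and E :: "int \<Rightarrow> nat"
  assumes d: "d > 1" and W: "W \<subseteq> {0..<int p}" and w0: "w0 \<in> W"
    and E_pos: "\<And>w. w \<in> W \<Longrightarrow> E w > 0" and E_w0: "E w0 = 1 \<or> E w0 = d - 1"
    and E_sum: "(\<Sum>w\<in>W. E w) = r * d"
  shows "norm (\<Sum>x\<in>{0..<int p}. \<Prod>w\<in>W. chi (x + w) ^ E w) \<le> real (card W) * sqrt (real p) + 1"
proof -
  define W1 where "W1 = W - {w0}"
  have fin: "finite W" using W finite_subset by auto
  have inv_ex: "\<exists>b. [a * b = 1] (mod int p) \<and> \<not> int p dvd b" if "\<not> int p dvd a" for a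
    using obtain_inverse_mod[OF prime_p that] by metis
  define iv where "iv = (\<lambda>a. SOME b. [a * b = 1] (mod int p) \<and> \<not> int p dvd b)"
  have iv: "[a * iv a = 1] (mod int p)" "\<not> int p dvd iv a" if "\<not> int p dvd a" for a
    using someI_ex[OF inv_ex[OF that]] by (auto simp: iv_def)
  have diff: "\<not> int p dvd w - w0" if "w \<in> W1" for w
  proof
    assume "int p dvd w - w0"
    then have "[w = w0] (mod int p)" by (simp add: cong_iff_dvd_diff)
    moreover have "w \<in> {0..<int p}" "w0 \<in> {0..<int p}" using that W w0 by (auto simp: W1_def)
    ultimately have "w = w0" by (simp add: Cong.cong_def)
    with that show False by (simp add: W1_def)
  qed
  \<comment> \<open>In the variable \<open>u\<close>, the factor belonging to \<open>w\<close>
    becomes linear with the root \<open>-1 / (w - w0)\<close>, up to a constant.\<close>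
  define b where "b = (\<lambda>w. (- iv (w - w0)) mod int p)"
  have b_range: "b w \<in> {0..<int p}" for w using p_gt_1 by (simp add: b_def)
  have fac: "[(w - w0) * u + 1 = (w0 - w) * (b w - u)] (mod int p)" if "w \<in> W1" for w u
  proof -
    have "[(w0 - w) * b w = (w0 - w) * (- iv (w - w0))] (mod int p)"
      by (intro cong_mult cong_refl) (simp add: b_def Cong.cong_def)
    also have "(w0 - w) * (- iv (w - w0)) = (w - w0) * iv (w - w0)" by (simp add: algebra_simps)
    also have "[(w - w0) * iv (w - w0) = 1] (mod int p)" by (rule iv(1)[OF diff[OF that]])
    finally have "[(w0 - w) * b w = 1] (mod int p)" .
    then have "[(w0 - w) * b w + (w - w0) * u = 1 + (w - w0) * u] (mod int p)" by (intro cong_add cong_refl)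
    moreover have "(w0 - w) * (b w - u) = (w0 - w) * b w + (w - w0) * u" by (simp add: algebra_simps)
    ultimately show ?thesis by (simp add: add.commute cong_sym)
  qed
  have b_inj: "inj_on b W1"
  proof (rule inj_onI)
    fix v w assume vw: "v \<in> W1" "w \<in> W1" "b v = b w"
    have z: "[(w - w0) * b w + 1 = 0] (mod int p)" if "w \<in> W1" for w
      using fac[OF that, of "b w"] by simp
    have "[(v - w0) * b w + 1 = (w - w0) * b w + 1] (mod int p)"
      using z[OF vw(1)] z[OF vw(2)] vw(3) by (metis cong_sym cong_trans)
    then have "[(v - w0) * b w = (w - w0) * b w] (mod int p)" by (simp add: cong_add_rcancel)
    then have "int p dvd (v - w) * b w" by (simp add: cong_iff_dvd_diff algebra_simps)
    moreover have "\<not> int p dvd b w"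
    proof
      assume "int p dvd b w"
      then have "[(w - w0) * b w + 1 = 0 + 1] (mod int p)" by (intro cong_add cong_refl) (simp add: cong_0_iff)
      with z[OF vw(2)] have "[0 = 1] (mod int p)" by (metis add_0 cong_sym cong_trans)
      then have "int p dvd 1" by (metis cong_0_iff cong_sym)
      with p_gt_1 show False by simp
    qed
    ultimately have "int p dvd v - w" using prime_p by (simp add: prime_dvd_mult_iff)
    then have "[v = w] (mod int p)" by (simp add: cong_iff_dvd_diff)
    moreover have "v \<in> {0..<int p}" "w \<in> {0..<int p}" using vw W by (auto simp: W1_def)
    ultimately show "v = w" by (simp add: Cong.cong_def)
  qed
  define F where "F = (\<lambda>x. \<Prod>w\<in>W. chi (x + w) ^ E w)"
  define G where "G = (\<lambda>u. \<Prod>w\<in>W1. chi (b w - u) ^ E w)"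
  define K where "K = (\<Prod>w\<in>W1. chi (w0 - w) ^ E w)"
  have F_cong: "F x = F y" if "[x = y] (mod int p)" for x y
    unfolding F_def using that by (intro prod.cong refl arg_cong2[of _ _ _ _ "(^)"] chi_cong cong_add) auto
  have FG: "F (iv u - w0) = K * G u" if u: "\<not> int p dvd u" for u
  proof -
    \<comment> \<open>The exponents sum to a multiple of \<open>d\<close>, so every linear factor
      can be multiplied by \<open>u\<close> without changing the product of the characters; this
      clears the denominators.\<close>
    have "(\<Prod>w\<in>W. chi u ^ E w) = 1"
      using E_sum chi_power_order[OF u] by (simp add: power_sum[symmetric] power_mult mult.commute[of r])
    then have "F (iv u - w0) = (\<Prod>w\<in>W. chi u ^ E w) * F (iv u - w0)" by simp
    also have "\<dots> = (\<Prod>w\<in>W. chi (u * (iv u - w0 + w)) ^ E w)"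
      by (simp add: F_def prod.distrib[symmetric] power_mult_distrib[symmetric] chi_mult)
    also have "\<dots> = chi (u * iv u) ^ E w0 * (\<Prod>w\<in>W1. chi (u * (iv u - w0 + w)) ^ E w)"
      unfolding W1_def using fin w0 by (subst prod.remove[of W w0]) auto
    also have "chi (u * iv u) = chi 1" by (rule chi_cong[OF iv(1)[OF u]])
    also have "(\<Prod>w\<in>W1. chi (u * (iv u - w0 + w)) ^ E w) = (\<Prod>w\<in>W1. (chi (w0 - w) * chi (b w - u)) ^ E w)"
    proof (intro prod.cong refl)
      fix w assume w: "w \<in> W1"
      have "[u * iv u + (w - w0) * u = 1 + (w - w0) * u] (mod int p)"
        by (intro cong_add cong_refl iv(1)[OF u])
      then have "[u * (iv u - w0 + w) = (w - w0) * u + 1] (mod int p)" by (simp add: algebra_simps)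
      then have "chi (u * (iv u - w0 + w)) = chi ((w0 - w) * (b w - u))"
        using fac[OF w, of u] by (intro chi_cong) (rule cong_trans)
      then show "chi (u * (iv u - w0 + w)) ^ E w = (chi (w0 - w) * chi (b w - u)) ^ E w" by (simp add: chi_mult)
    qed
    finally show ?thesis by (simp add: K_def G_def power_mult_distrib prod.distrib)
  qed
  have Fw0: "F x = 0" if "[x = - w0] (mod int p)" for x
  proof -
    have "F x = F (- w0)" by (rule F_cong[OF that])
    also have "\<dots> = 0" using w0 fin E_pos[OF w0] by (auto simp: F_def zero_power intro!: bexI[of _ w0])
    finally show ?thesis .
  qed
  have "(\<Sum>x\<in>{0..<int p}. F x) = (\<Sum>x\<in>{0..<int p} - {(- w0) mod int p}. F x)"
    using Fw0[of "(- w0) mod int p"] by (intro sum.mono_neutral_right) (auto simp: Cong.cong_def)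
  \<comment> \<open>The term \<open>u = 0\<close> corresponds to \<open>x\<close> at infinity and
    has no counterpart on the left. Adding it to complete the sum over \<open>u\<close> costs the
    summand 1 in the claim.\<close>
  also have "\<dots> = (\<Sum>u\<in>{1..<int p}. K * G u)"
  proof (rule sum.reindex_bij_witness[where i = "\<lambda>u. (iv u - w0) mod int p" and j = "\<lambda>x. iv (x + w0) mod int p"])
    fix x assume x: "x \<in> {0..<int p} - {(- w0) mod int p}"
    have nd: "\<not> int p dvd x + w0"
    proof
      assume "int p dvd x + w0"
      then have "[x = - w0] (mod int p)" by (simp add: cong_iff_dvd_diff)
      with x show False by (simp add: Cong.cong_def)
    qed
    define u where "u = iv (x + w0) mod int p"
    have ivnd: "\<not> int p dvd iv (x + w0)" by (rule iv(2)[OF nd])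
    have und: "\<not> int p dvd u" using ivnd by (simp add: u_def dvd_mod_iff)
    have u_range: "u \<in> {1..<int p}"
    proof -
      have "0 \<le> u" "u < int p" using p_gt_1 by (simp_all add: u_def)
      moreover have "u \<noteq> 0" using und by auto
      ultimately show ?thesis by simp
    qed
    then show "iv (x + w0) mod int p \<in> {1..<int p}" by (simp add: u_def)
    have "[u = iv (x + w0)] (mod int p)" by (simp add: u_def Cong.cong_def)
    then have "[(x + w0) * u = (x + w0) * iv (x + w0)] (mod int p)" by (intro cong_mult cong_refl)
    then have "[(x + w0) * u = 1] (mod int p)" using iv(1)[OF nd] by (rule cong_trans)
    moreover have "[iv u * u = 1] (mod int p)" using iv(1)[OF und] by (simp add: mult.commute)
    ultimately have "[iv u * u = (x + w0) * u] (mod int p)" by (metis cong_sym cong_trans)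
    then have "int p dvd (iv u - (x + w0)) * u" by (simp add: cong_iff_dvd_diff algebra_simps)
    then have "int p dvd iv u - (x + w0)" using und prime_p by (simp add: prime_dvd_mult_iff)
    then have c: "[iv u - w0 = x] (mod int p)" by (simp add: cong_iff_dvd_diff algebra_simps)
    then show "(iv (iv (x + w0) mod int p) - w0) mod int p = x" using x by (simp add: u_def Cong.cong_def)
    show "K * G (iv (x + w0) mod int p) = F x"
      using FG[OF und] F_cong[OF c] by (simp add: u_def)
  next
    fix u assume u: "u \<in> {1..<int p}"
    have und: "\<not> int p dvd u" by (rule not_dvd_residue[OF u])
    define x where "x = (iv u - w0) mod int p"
    have c: "[x = iv u - w0] (mod int p)" by (simp add: x_def Cong.cong_def)
    have c': "[x + w0 = iv u] (mod int p)" using cong_add[OF c cong_refl[of w0]] by simp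
    have "\<not> int p dvd x + w0" using c' iv(2)[OF und] by (metis cong_dvd_iff dvd_refl cong_0_iff cong_sym cong_trans)
    note nd = this
    show "(iv u - w0) mod int p \<in> {0..<int p} - {(- w0) mod int p}"
    proof -
      have "x \<noteq> (- w0) mod int p"
      proof
        assume "x = (- w0) mod int p"
        then have "[x = - w0] (mod int p)" by (simp add: Cong.cong_def)
        then have "int p dvd x + w0" by (simp add: cong_iff_dvd_diff)
        with nd show False by simp
      qed
      then show ?thesis using p_gt_1 by (simp add: x_def)
    qed
    have "[(x + w0) * iv (x + w0) = 1] (mod int p)" by (rule iv(1)[OF nd])
    moreover have "[(x + w0) * u = iv u * u] (mod int p)" by (intro cong_mult c' cong_refl)
    moreover have "[iv u * u = 1] (mod int p)" using iv(1)[OF und] by (simp add: mult.commute)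
    ultimately have "[(x + w0) * iv (x + w0) = (x + w0) * u] (mod int p)" by (metis cong_sym cong_trans)
    then have "int p dvd (x + w0) * (iv (x + w0) - u)" by (simp add: cong_iff_dvd_diff algebra_simps)
    then have "int p dvd iv (x + w0) - u" using nd prime_p by (simp add: prime_dvd_mult_iff)
    then have "[iv (x + w0) = u] (mod int p)" by (simp add: cong_iff_dvd_diff)
    then show "iv ((iv u - w0) mod int p + w0) mod int p = u" using u by (simp add: x_def Cong.cong_def)
  qed
  also have "\<dots> = K * (\<Sum>u\<in>{0..<int p}. G u) - K * G 0"
  proof -
    have "{0..<int p} = insert 0 {1..<int p}" using p_gt_1 by auto
    then show ?thesis by (simp add: sum_distrib_left[symmetric] algebra_simps)
  qed
  finally have eq: "(\<Sum>x\<in>{0..<int p}. F x) = K * (\<Sum>u\<in>{0..<int p}. G u) - K * G 0" .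
  have normK: "norm K \<le> 1"
    unfolding K_def prod_norm[symmetric]
    by (intro prod_le_1) (auto simp: norm_power intro!: power_le_one norm_chi_le_1)
  have normG: "norm (G 0) \<le> 1"
    unfolding G_def prod_norm[symmetric]
    by (intro prod_le_1) (auto simp: norm_power intro!: power_le_one norm_chi_le_1)
  have weil: "norm (\<Sum>u\<in>{0..<int p}. G u) \<le> real (card W1) * sqrt (real p)"
  proof -
    define e where "e = (\<lambda>z. E (inv_into W1 b z))"
    have eb: "e (b w) = E w" if "w \<in> W1" for w using that b_inj by (simp add: e_def)
    have sum_e: "(\<Sum>z\<in>b ` W1. e z) = (\<Sum>w\<in>W1. E w)"
      by (simp add: sum.reindex[OF b_inj] eb)
    have "(\<Sum>w\<in>W. E w) = E w0 + (\<Sum>w\<in>W1. E w)"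
      unfolding W1_def using fin w0 by (rule sum.remove)
    then have rd: "r * d = E w0 + (\<Sum>w\<in>W1. E w)" using E_sum by simp
    \<comment> \<open>The total exponent is \<open>r * d\<close>, so what remains without
      \<open>w0\<close> is congruent to -1 or 1 modulo \<open>d\<close>.\<close>
    have cop: "coprime (\<Sum>w\<in>W1. E w) d"
    proof (rule coprimeI)
      fix c assume c: "c dvd (\<Sum>w\<in>W1. E w)" "c dvd d"
      have "c dvd r * d" using c by simp
      then have c0: "c dvd E w0" using c(1) unfolding rd by (simp add: dvd_add_left_iff)
      from E_w0 show "is_unit c"
      proof
        assume "E w0 = d - 1"
        then have "c dvd d - (d - 1)" using c c0 by (simp add: dvd_diff_nat)
        then show ?thesis using d by simp
      qed (use c0 in simp)
    qed
    have "norm (\<Sum>x\<in>{0..<int p}. \<Prod>z\<in>b ` W1. chi (z - x) ^ e z) \<le> real (card (b ` W1)) * sqrt (real p)"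
    proof (rule weil_bound_prime[OF prime_p, unfolded weil_bound_def, rule_format, OF char])
      show "1 < char_order p chi" using d d_eq by simp
      show "coprime (sum e (b ` W1)) (char_order p chi)" using cop sum_e d_eq by simp
      show "b ` W1 \<subseteq> {0..<int p}" using b_range by blast
      fix z assume "z \<in> b ` W1"
      then obtain w where "w \<in> W1" "z = b w" by blast
      then show "0 < e z" using eb E_pos by (simp add: W1_def)
    qed
    moreover have "(\<Sum>x\<in>{0..<int p}. \<Prod>z\<in>b ` W1. chi (z - x) ^ e z) = (\<Sum>u\<in>{0..<int p}. G u)"
      by (simp add: G_def prod.reindex[OF b_inj] eb)
    ultimately show ?thesis by (simp add: card_image[OF b_inj])
  qed
  have "norm (\<Sum>x\<in>{0..<int p}. F x) \<le> norm K * norm (\<Sum>u\<in>{0..<int p}. G u) + norm K * norm (G 0)"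
    unfolding eq using norm_triangle_ineq4 by (metis norm_mult)
  also have "\<dots> \<le> 1 * norm (\<Sum>u\<in>{0..<int p}. G u) + 1 * 1"
    using normK normG by (intro add_mono mult_mono) auto
  also have "\<dots> \<le> real (card W1) * sqrt (real p) + 1" using weil by simp
  also have "\<dots> \<le> real (card W) * sqrt (real p) + 1"
    using fin by (auto simp: W1_def intro!: mult_right_mono card_mono)
  finally show ?thesis by (simp add: F_def)
qed

end

section \<open>Moments of short character sums\<close>

lemma sum_lessThan_add:
  fixes g :: "nat \<Rightarrow> 'a::comm_monoid_add"
  shows "(\<Sum>i<a + b. g i) = (\<Sum>i<a. g i) + (\<Sum>i<b. g (a + i))"
  by (induction b) (simp_all add: add.assoc)

lemma power_sum_le_sum_powers:
  fixes a :: "'i \<Rightarrow> real"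
  assumes "\<And>i. i \<in> S \<Longrightarrow> a i \<ge> 0"
  shows "(\<Sum>i\<in>S. a i) ^ Suc n \<le> real (card S) ^ n * (\<Sum>i\<in>S. a i ^ Suc n)"
proof (cases "finite S \<and> S \<noteq> {}")
  case True
  define c where "c = real (card S)"
  have c: "c > 0" using True by (simp add: c_def card_gt_0_iff)
  have conv: "convex_on {0::real..} (\<lambda>x. x ^ Suc n)"
    using convex_power_odd[of "Suc n"] convex_on_subset[OF convex_power_even[of "Suc n"]] by (cases "odd (Suc n)") auto
  have "(\<Sum>i\<in>S. (1 / c) *\<^sub>R a i) ^ Suc n \<le> (\<Sum>i\<in>S. (1 / c) * a i ^ Suc n)"
    by (rule convex_on_sum[OF _ _ conv]) (use True assms c in \<open>auto simp: c_def\<close>)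
  then have "((\<Sum>i\<in>S. a i) / c) ^ Suc n \<le> (\<Sum>i\<in>S. a i ^ Suc n) / c"
    by (simp add: sum_divide_distrib)
  then have "(\<Sum>i\<in>S. a i) ^ Suc n / c ^ Suc n \<le> (\<Sum>i\<in>S. a i ^ Suc n) / c"
    by (simp only: power_divide)
  then have "(\<Sum>i\<in>S. a i) ^ Suc n \<le> (\<Sum>i\<in>S. a i ^ Suc n) / c * c ^ Suc n"
    using c by (simp add: pos_divide_le_eq del: power_Suc)
  also have "\<dots> = c ^ n * (\<Sum>i\<in>S. a i ^ Suc n)" using c by simp
  finally show ?thesis by (simp add: c_def)
qed auto

text \<open>Jensen's inequality is used for the power \<open>r\<close>, then the Cauchy-Schwarz
  inequality over the points \<open>x\<close>; the sum of the squared multiplicities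
  \<open>\<nu> x\<close> counts the pairs with the same image.\<close>

lemma sum_power_fibre_bound:
  fixes w :: "'x \<Rightarrow> real" and \<xi> :: "'q \<Rightarrow> 'x"
  assumes fin: "finite P" "finite A" and sub: "\<xi> ` P \<subseteq> A" and w: "\<And>x. w x \<ge> 0" and r: "r \<ge> 1"
  shows "(\<Sum>q\<in>P. w (\<xi> q)) ^ (2 * r)
    \<le> real (card P) ^ (2 * r - 2) * real (card {(q, q'). q \<in> P \<and> q' \<in> P \<and> \<xi> q = \<xi> q'}) * (\<Sum>x\<in>A. w x ^ (2 * r))"
proof -
  obtain n where n: "r = Suc n" using r by (cases r) auto
  define \<nu> where "\<nu> = (\<lambda>x. real (card {q\<in>P. \<xi> q = x}))"
  have sq: "(w x ^ r)\<^sup>2 = w x ^ (2 * r)" for x by (simp add: power_mult[symmetric] mult.commute)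
  have 1: "(\<Sum>q\<in>P. w (\<xi> q)) ^ r \<le> real (card P) ^ n * (\<Sum>q\<in>P. w (\<xi> q) ^ r)"
    unfolding n by (rule power_sum_le_sum_powers) (rule w)
  have group: "(\<Sum>q\<in>P. f (\<xi> q)) = (\<Sum>x\<in>A. \<nu> x * f x)" for f :: "'x \<Rightarrow> real"
    using sum.group[OF fin sub, of "\<lambda>q. f (\<xi> q)"] by (simp add: \<nu>_def)
  have coll: "real (card {(q, q'). q \<in> P \<and> q' \<in> P \<and> \<xi> q = \<xi> q'}) = (\<Sum>x\<in>A. \<nu> x ^ 2)"
  proof -
    have "{(q, q'). q \<in> P \<and> q' \<in> P \<and> \<xi> q = \<xi> q'} = (SIGMA q:P. {q'\<in>P. \<xi> q' = \<xi> q})" by auto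
    then have "card {(q, q'). q \<in> P \<and> q' \<in> P \<and> \<xi> q = \<xi> q'} = (\<Sum>q\<in>P. card {q'\<in>P. \<xi> q' = \<xi> q})"
      using fin by simp
    then have "real (card {(q, q'). q \<in> P \<and> q' \<in> P \<and> \<xi> q = \<xi> q'}) = (\<Sum>q\<in>P. \<nu> (\<xi> q))"
      by (simp add: \<nu>_def)
    then show ?thesis unfolding group by (simp add: power2_eq_square)
  qed
  have "(\<Sum>q\<in>P. w (\<xi> q)) ^ (2 * r) = ((\<Sum>q\<in>P. w (\<xi> q)) ^ r)\<^sup>2" by (simp add: power_mult[symmetric] mult.commute)
  also have "\<dots> \<le> (real (card P) ^ n * (\<Sum>q\<in>P. w (\<xi> q) ^ r))\<^sup>2"
    using 1 w by (intro power_mono) (auto intro!: sum_nonneg zero_le_power)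
  also have "\<dots> = real (card P) ^ (2 * r - 2) * (\<Sum>x\<in>A. \<nu> x * w x ^ r)\<^sup>2"
  proof -
    have "(real (card P) ^ n)\<^sup>2 = real (card P) ^ (2 * r - 2)" by (simp add: n power_mult[symmetric] mult.commute)
    moreover have "(\<Sum>q\<in>P. w (\<xi> q) ^ r) = (\<Sum>x\<in>A. \<nu> x * w x ^ r)" by (rule group)
    ultimately show ?thesis by (simp only: power_mult_distrib)
  qed
  also have "\<dots> \<le> real (card P) ^ (2 * r - 2) * ((\<Sum>x\<in>A. \<nu> x ^ 2) * (\<Sum>x\<in>A. (w x ^ r)\<^sup>2))"
    by (intro mult_left_mono Cauchy_Schwarz_ineq_sum) auto
  finally show ?thesis by (simp only: coll sq mult.assoc)
qed

text \<open>Such a function factors through \<open>r\<close> labels: \<open>h\<close> chooses the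
  label of an argument and \<open>g\<close> the value of a label.\<close>

lemma card_small_image_functions:
  fixes V :: "'b set"
  assumes "finite A" "A \<noteq> {}" "finite V"
  shows "card {v \<in> A \<rightarrow>\<^sub>E V. card (v ` A) \<le> r} \<le> card V ^ r * r ^ card A"
proof -
  let ?P = "({..<r} \<rightarrow>\<^sub>E V) \<times> (A \<rightarrow>\<^sub>E {..<r})"
  have "{v \<in> A \<rightarrow>\<^sub>E V. card (v ` A) \<le> r} \<subseteq> (\<lambda>(g, h). restrict (\<lambda>i. g (h i)) A) ` ?P"
  proof
    fix v assume "v \<in> {v \<in> A \<rightarrow>\<^sub>E V. card (v ` A) \<le> r}"
    then have v: "v \<in> A \<rightarrow>\<^sub>E V" "card (v ` A) \<le> r" by auto
    obtain f where f: "bij_betw f {0..<card (v ` A)} (v ` A)"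
      using ex_bij_betw_nat_finite[of "v ` A"] assms(1) by auto
    define fi where "fi = inv_into {0..<card (v ` A)} f"
    obtain a0 where a0: "a0 \<in> A" using assms(2) by auto
    \<comment> \<open>Labels beyond the size of the image get the arbitrary value
      \<open>v a0\<close>, so that \<open>g\<close> still maps into \<open>V\<close>.\<close>
    define g where "g = restrict (\<lambda>k. if k < card (v ` A) then f k else v a0) {..<r}"
    define h where "h = restrict (\<lambda>i. fi (v i)) A"
    have fi: "fi (v i) < card (v ` A)" "f (fi (v i)) = v i" if "i \<in> A" for i
    proof -
      have "v i \<in> f ` {0..<card (v ` A)}" using f that by (simp add: bij_betw_def)
      then show "fi (v i) < card (v ` A)" "f (fi (v i)) = v i"
        using inv_into_into[of "v i" f "{0..<card (v ` A)}"] by (auto simp: fi_def f_inv_into_f)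
    qed
    have fV: "f k \<in> V" if "k < card (v ` A)" for k
    proof -
      have "f k \<in> v ` A" using f that by (auto simp: bij_betw_def)
      then show ?thesis using v(1) by (auto simp: PiE_iff)
    qed
    have "g \<in> {..<r} \<rightarrow>\<^sub>E V" using fV a0 v(1) by (auto simp: g_def PiE_iff)
    moreover have "h \<in> A \<rightarrow>\<^sub>E {..<r}" using fi(1) v(2) by (auto simp: h_def intro: less_le_trans)
    moreover have "v = restrict (\<lambda>i. g (h i)) A"
    proof
      fix i show "v i = restrict (\<lambda>i. g (h i)) A i"
        using fi[of i] v by (cases "i \<in> A") (auto simp: g_def h_def PiE_iff extensional_def intro: less_le_trans)
    qed
    ultimately show "v \<in> (\<lambda>(g, h). restrict (\<lambda>i. g (h i)) A) ` ?P" by auto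
  qed
  then have "card {v \<in> A \<rightarrow>\<^sub>E V. card (v ` A) \<le> r} \<le> card ?P"
    using assms by (intro surj_card_le[of ?P]) (auto intro!: finite_cartesian_product finite_PiE)
  then show ?thesis using assms by (simp add: card_cartesian_product card_PiE)
qed

context dirichlet
begin

text \<open>The value that occurs only once has total exponent 1 or \<open>d - 1\<close> and serves
  as \<open>w0\<close> in \<open>complete_sum_bound\<close>. The \<open>r\<close> plain and the
  \<open>r\<close> conjugated factors have exponent sum
  \<open>r + r * (d - 1) = r * d\<close>.\<close>

lemma tuple_sum_bound:
  fixes v :: "nat \<Rightarrow> int" and r :: nat
  assumes d: "d > 1" and v: "\<And>i. i < 2 * r \<Longrightarrow> v i \<in> {0..<int p}"
    and i0: "i0 < 2 * r" "\<And>j. j < 2 * r \<Longrightarrow> j \<noteq> i0 \<Longrightarrow> v j \<noteq> v i0"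
  shows "norm (\<Sum>x\<in>{0..<int p}. \<Prod>i<2*r. if i < r then chi (x + v i) else cnj (chi (x + v i)))
     \<le> real (2 * r) * sqrt (real p) + 1"
proof -
  define ex where "ex = (\<lambda>i. if i < r then 1 else d - 1)"
  define A where "A = {..<2 * r}"
  define E where "E = (\<lambda>w. \<Sum>i\<in>{i\<in>A. v i = w}. ex i)"
  have ex: "ex i > 0" for i using d by (simp add: ex_def)
  have fin: "finite A" by (simp add: A_def)
  have prod_eq: "(\<Prod>i<2*r. if i < r then chi (x + v i) else cnj (chi (x + v i))) = (\<Prod>w\<in>v ` A. chi (x + w) ^ E w)" for x
  proof -
    have "(\<Prod>i<2*r. if i < r then chi (x + v i) else cnj (chi (x + v i))) = (\<Prod>i\<in>A. chi (x + v i) ^ ex i)"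
      unfolding A_def by (intro prod.cong refl) (simp add: ex_def cnj_chi[OF d])
    also have "\<dots> = (\<Prod>w\<in>v ` A. \<Prod>i\<in>{i\<in>A. v i = w}. chi (x + v i) ^ ex i)"
      by (rule prod.image_gen[OF fin])
    also have "\<dots> = (\<Prod>w\<in>v ` A. chi (x + w) ^ E w)"
      unfolding E_def power_sum by (intro prod.cong refl) auto
    finally show ?thesis .
  qed
  have "norm (\<Sum>x\<in>{0..<int p}. \<Prod>w\<in>v ` A. chi (x + w) ^ E w) \<le> real (card (v ` A)) * sqrt (real p) + 1"
  proof (rule complete_sum_bound[of "v ` A" "v i0" E r, OF d])
    show "v ` A \<subseteq> {0..<int p}" using v by (auto simp: A_def)
    show "v i0 \<in> v ` A" using i0 by (auto simp: A_def)
    show "E w > 0" if "w \<in> v ` A" for w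
    proof -
      from that obtain i where "i \<in> {i\<in>A. v i = w}" by auto
      then show ?thesis unfolding E_def using fin ex by (intro sum_pos) auto
    qed
    have "{i\<in>A. v i = v i0} = {i0}" using i0 by (auto simp: A_def)
    then have "E (v i0) = ex i0" by (simp add: E_def)
    then show "E (v i0) = 1 \<or> E (v i0) = d - 1" by (simp add: ex_def)
    have "(\<Sum>w\<in>v ` A. E w) = (\<Sum>i\<in>A. ex i)" unfolding E_def by (rule sum.image_gen[OF fin, symmetric])
    also have "\<dots> = (\<Sum>i<r + r. ex i)" by (simp add: A_def mult_2)
    also have "\<dots> = (\<Sum>i<r. ex i) + (\<Sum>i<r. ex (r + i))" by (rule sum_lessThan_add)
    also have "\<dots> = r * d" using d by (simp add: ex_def algebra_simps)
    finally show "(\<Sum>w\<in>v ` A. E w) = r * d" .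
  qed
  also have "\<dots> \<le> real (2 * r) * sqrt (real p) + 1"
    using card_image_le[OF fin, of v] by (intro add_right_mono mult_right_mono) (auto simp: A_def)
  finally show ?thesis by (simp only: prod_eq)
qed

text \<open>The \<open>2r\<close>-th power is expanded over tuples. If no entry of a tuple is
  unique, it has at most \<open>r\<close> different entries; such tuples are few and are estimated
  trivially. All other tuples lead to complete sums with square-root cancellation.\<close>

lemma moment_bound:
  assumes d: "d > 1" and r: "r \<ge> 1" and V: "V < p"
  shows "(\<Sum>x\<in>{0..<int p}. norm (\<Sum>v\<in>{1..int V}. chi (x + v)) ^ (2 * r))
     \<le> real (r ^ (2 * r) * V ^ r * p) + real V ^ (2 * r) * (real (2 * r) * sqrt (real p) + 1)"
proof -
  define A where "A = {..<2 * r}"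
  define P where "P = A \<rightarrow>\<^sub>E {1..int V}"
  define f where "f = (\<lambda>i x v. if i < r then chi (x + v) else cnj (chi (x + v)))"
  define T where "T = (\<lambda>v. \<Sum>x\<in>{0..<int p}. \<Prod>i\<in>A. f i x (v i))"
  define bad where "bad = {v\<in>P. card (v ` A) \<le> r}"
  have finP: "finite P" by (simp add: P_def A_def finite_PiE)
  have cardP: "card P = V ^ (2 * r)" by (simp add: P_def A_def card_PiE)
  have expand: "of_real (norm (\<Sum>v\<in>{1..int V}. chi (x + v)) ^ (2 * r)) = (\<Sum>v\<in>P. \<Prod>i\<in>A. f i x (v i))" for x
  proof -
    define S where "S = (\<Sum>v\<in>{1..int V}. chi (x + v))"
    have "(\<Sum>v\<in>P. \<Prod>i\<in>A. f i x (v i)) = (\<Prod>i\<in>A. \<Sum>v\<in>{1..int V}. f i x v)"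
      unfolding P_def by (rule prod_sum_PiE[symmetric]) (simp_all add: A_def)
    also have "\<dots> = (\<Prod>i<r + r. if i < r then S else cnj S)"
      by (intro prod.cong) (auto simp: A_def f_def S_def)
    also have "\<dots> = (S * cnj S) ^ r"
      unfolding prod_lessThan_add by (simp add: power_mult_distrib)
    also have "\<dots> = of_real (norm S ^ (2 * r))"
      by (simp add: complex_norm_square[symmetric] power_mult)
    finally show ?thesis by (simp add: S_def)
  qed
  have norm_f: "norm (f i x v) \<le> 1" for i x v using norm_chi_le_1 by (simp add: f_def)
  have T_triv: "norm (T v) \<le> real p" for v
  proof -
    have "norm (T v) \<le> (\<Sum>x\<in>{0..<int p}. norm (\<Prod>i\<in>A. f i x (v i)))" unfolding T_def by (rule norm_sum)
    also have "\<dots> \<le> (\<Sum>x\<in>{0..<int p}. 1)"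
      unfolding prod_norm[symmetric] by (intro sum_mono prod_le_1) (simp add: norm_f)
    finally show ?thesis by simp
  qed
  have T_good: "norm (T v) \<le> real (2 * r) * sqrt (real p) + 1" if v: "v \<in> P - bad" for v
  proof -
    have vP: "v i \<in> {0..<int p}" if "i < 2 * r" for i
    proof -
      have "v \<in> P" using v by (rule DiffD1)
      then have "v i \<in> {1..int V}" unfolding P_def by (rule PiE_mem) (use that in \<open>simp add: A_def\<close>)
      then show ?thesis using V by auto
    qed
    have "\<exists>i0<2*r. \<forall>j<2*r. j \<noteq> i0 \<longrightarrow> v j \<noteq> v i0"
    proof (rule ccontr)
      assume "\<not> ?thesis"
      then have rep: "\<exists>j<2*r. j \<noteq> i \<and> v j = v i" if "i < 2*r" for i using that by blast
      have ge2: "2 \<le> card {i\<in>A. v i = w}" if "w \<in> v ` A" for w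
      proof -
        from that obtain i where i: "i < 2 * r" "v i = w" by (auto simp: A_def)
        then obtain j where j: "j < 2 * r" "j \<noteq> i" "v j = w" using rep by blast
        have "card {i, j} \<le> card {i\<in>A. v i = w}" using i j by (intro card_mono) (auto simp: A_def)
        then show ?thesis using j by simp
      qed
      have "2 * card (v ` A) = (\<Sum>w\<in>v ` A. 2)" by simp
      also have "\<dots> \<le> (\<Sum>w\<in>v ` A. card {i\<in>A. v i = w})" by (intro sum_mono ge2)
      also have "\<dots> = card A" using sum.image_gen[of A "\<lambda>_. 1::nat" v] by (simp add: A_def)
      finally have "card (v ` A) \<le> r" by (simp add: A_def)
      with v show False by (simp add: bad_def)
    qed
    then obtain i0 where i0: "i0 < 2 * r" "\<And>j. j < 2 * r \<Longrightarrow> j \<noteq> i0 \<Longrightarrow> v j \<noteq> v i0" by blast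
    from tuple_sum_bound[of r v i0, OF d vP i0] show ?thesis by (simp add: T_def f_def A_def)
  qed
  have card_bad: "card bad \<le> r ^ (2 * r) * V ^ r"
    using card_small_image_functions[of A "{1..int V}" r] r by (simp add: bad_def P_def A_def mult.commute lessThan_empty_iff)
  define M where "M = (\<Sum>x\<in>{0..<int p}. norm (\<Sum>v\<in>{1..int V}. chi (x + v)) ^ (2 * r))"
  have "M \<ge> 0" by (simp add: M_def sum_nonneg)
  have "complex_of_real M = (\<Sum>v\<in>P. T v)"
    unfolding M_def T_def of_real_sum expand by (rule sum.swap)
  then have "M = norm (\<Sum>v\<in>P. T v)"
    using \<open>M \<ge> 0\<close> norm_of_real[of M, where 'a = complex] by simp
  also have "\<dots> \<le> (\<Sum>v\<in>P. norm (T v))" by (rule norm_sum)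
  also have "\<dots> = (\<Sum>v\<in>bad. norm (T v)) + (\<Sum>v\<in>P - bad. norm (T v))"
    using finP by (subst add.commute) (rule sum.subset_diff, auto simp: bad_def)
  also have "\<dots> \<le> (\<Sum>v\<in>bad. real p) + (\<Sum>v\<in>P - bad. real (2 * r) * sqrt (real p) + 1)"
    by (intro add_mono sum_mono T_triv T_good)
  also have "\<dots> = real (card bad) * real p + real (card (P - bad)) * (real (2 * r) * sqrt (real p) + 1)" by simp
  also have "\<dots> \<le> real (r ^ (2 * r) * V ^ r) * real p + real (V ^ (2 * r)) * (real (2 * r) * sqrt (real p) + 1)"
    using card_bad card_mono[OF finP, of "P - bad"] cardP
    by (intro add_mono mult_right_mono of_nat_mono) auto
  finally show ?thesis by (simp add: M_def)
qed

text \<open>Each shift by one changes two boundary terms only.\<close>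

lemma shifted_sum_bound:
  "norm ((\<Sum>n=1..H. chi (int n)) - (\<Sum>n=1..H. chi (int n + int k))) \<le> 2 * real k"
proof (induction k)
  case (Suc k)
  have tel: "(\<Sum>n=1..H. chi (int n + int k)) - (\<Sum>n=1..H. chi (int n + int (Suc k))) = chi (1 + int k) - chi (int H + 1 + int k)"
    by (induction H) (simp_all add: algebra_simps)
  have "(\<Sum>n=1..H. chi (int n)) - (\<Sum>n=1..H. chi (int n + int (Suc k))) =
    ((\<Sum>n=1..H. chi (int n)) - (\<Sum>n=1..H. chi (int n + int k))) + (chi (1 + int k) - chi (int H + 1 + int k))"
    using tel by (simp add: algebra_simps)
  also have "norm \<dots> \<le> 2 * real k + (norm (chi (1 + int k)) + norm (chi (int H + 1 + int k)))"
    by (rule order.trans[OF norm_triangle_ineq]) (intro add_mono Suc norm_triangle_ineq4)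
  also have "\<dots> \<le> 2 * real (Suc k)" using norm_chi_le_1[of "1 + int k"] norm_chi_le_1[of "int H + 1 + int k"] by simp
  finally show ?case .
qed simp

text \<open>The sum over \<open>1..H\<close> is compared with its shifts by \<open>u v\<close>, where \<open>u \<le> U\<close> and \<open>v \<le> V\<close>. Since
  \<open>chi (n + u v) = chi u chi (n/u + v)\<close>, Hoelder's inequality over the residues \<open>n/u\<close> leads to \<open>moment_bound\<close>.\<close>

lemma burgess_inequality:
  assumes d: "d > 1" and r: "r \<ge> 1" and pos: "U \<ge> 1" "V \<ge> 1" "H \<ge> 1" and V: "V < p" and UH: "U * H < p"
    and Dm: "\<And>m. 1 \<le> m \<Longrightarrow> m \<le> U * H \<Longrightarrow> card {k. k dvd m} \<le> Dm"
  obtains B where "B \<ge> 0" "norm (\<Sum>n=1..H. chi (int n)) \<le> 2 * real (U * V) + B / real (U * V)"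
    "B ^ (2 * r) \<le> real (U * H) ^ (2 * r - 1) * real Dm *
       (real (r ^ (2 * r) * V ^ r * p) + real V ^ (2 * r) * (real (2 * r) * sqrt (real p) + 1))"
proof -
  have inv_ex: "\<exists>b. [int u * b = 1] (mod int p)" if "u \<in> {1..U}" for u
  proof -
    have "u * 1 \<le> U * H" using that pos by (intro mult_le_mono) auto
    then have "u < p" using UH by simp
    then have "\<not> int p dvd int u" using that by (auto dest: dvd_imp_le)
    then show ?thesis using obtain_inverse_mod[OF prime_p] by metis
  qed
  define iv where "iv = (\<lambda>u. SOME b. [int u * b = 1] (mod int p))"
  have iv: "[int u * iv u = 1] (mod int p)" if "u \<in> {1..U}" for u
    using someI_ex[OF inv_ex[OF that]] by (simp add: iv_def)
  define P where "P = {1..U} \<times> {1..H}"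
  define \<xi> where "\<xi> = (\<lambda>(u, n). (int n * iv u) mod int p)"
  define w where "w = (\<lambda>x. norm (\<Sum>v\<in>{1..int V}. chi (x + v)))"
  define B where "B = (\<Sum>q\<in>P. w (\<xi> q))"
  have w0: "w x \<ge> 0" for x by (simp add: w_def)
  have w_pair: "norm (\<Sum>v\<in>{1..int V}. chi (int n + int u * v)) \<le> w (\<xi> (u, n))" if u: "u \<in> {1..U}" for u n
  proof -
    have "chi (int n + int u * v) = chi (int u) * chi (\<xi> (u, n) + v)" for v
    proof -
      have "[int u * (\<xi> (u, n) + v) = int u * (int n * iv u + v)] (mod int p)"
        by (intro cong_mult cong_add cong_refl) (simp add: \<xi>_def Cong.cong_def)
      also have "int u * (int n * iv u + v) = int n * (int u * iv u) + int u * v" by (simp add: algebra_simps)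
      also have "[\<dots> = int n * 1 + int u * v] (mod int p)" by (intro cong_add cong_mult cong_refl iv[OF u])
      finally have "[int n + int u * v = int u * (\<xi> (u, n) + v)] (mod int p)" by (simp add: cong_sym)
      then show ?thesis using chi_cong chi_mult by metis
    qed
    then have "(\<Sum>v\<in>{1..int V}. chi (int n + int u * v)) = chi (int u) * (\<Sum>v\<in>{1..int V}. chi (\<xi> (u, n) + v))"
      by (simp add: sum_distrib_left)
    then show ?thesis using norm_chi_le_1[of "int u"] by (simp add: norm_mult w_def mult_left_le_one_le)
  qed
  define S where "S = (\<Sum>n=1..H. chi (int n))"
  have "real (U * V) * norm S = norm (\<Sum>u=1..U. \<Sum>v=1..V. S)" by (simp add: norm_mult)
  also have "(\<Sum>u=1..U. \<Sum>v=1..V. S) = (\<Sum>u=1..U. \<Sum>v=1..V. S - (\<Sum>n=1..H. chi (int n + int (u * v))))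
      + (\<Sum>u=1..U. \<Sum>v=1..V. \<Sum>n=1..H. chi (int n + int (u * v)))"
    by (simp add: sum_subtractf)
  also have "norm \<dots> \<le> real (U * V) * (2 * real (U * V)) + B"
  proof (rule order.trans[OF norm_triangle_ineq add_mono])
    have "norm (\<Sum>u=1..U. \<Sum>v=1..V. S - (\<Sum>n=1..H. chi (int n + int (u * v)))) \<le> (\<Sum>u=1..U. \<Sum>v=1..V. 2 * real (U * V))"
    proof (intro sum_norm_le)
      fix u v assume "u \<in> {1..U}" "v \<in> {1..V}"
      then have "real (u * v) \<le> real (U * V)" by (intro of_nat_mono mult_le_mono) auto
      then show "norm (S - (\<Sum>n=1..H. chi (int n + int (u * v)))) \<le> 2 * real (U * V)"
        using shifted_sum_bound[of H "u * v"] unfolding S_def by linarith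
    qed
    then show "norm (\<Sum>u=1..U. \<Sum>v=1..V. S - (\<Sum>n=1..H. chi (int n + int (u * v)))) \<le> real (U * V) * (2 * real (U * V))"
      by simp
    have "(\<Sum>u=1..U. \<Sum>v=1..V. \<Sum>n=1..H. chi (int n + int (u * v))) = (\<Sum>u=1..U. \<Sum>n=1..H. \<Sum>v=1..V. chi (int n + int u * int v))"
    proof (rule sum.cong[OF refl])
      fix u show "(\<Sum>v=1..V. \<Sum>n=1..H. chi (int n + int (u * v))) = (\<Sum>n=1..H. \<Sum>v=1..V. chi (int n + int u * int v))"
        by (subst sum.swap) simp
    qed
    also have "\<dots> = (\<Sum>u=1..U. \<Sum>n=1..H. \<Sum>v\<in>{1..int V}. chi (int n + int u * v))"
    proof -
      have "{1..int V} = int ` {1..V}" by (simp add: image_int_atLeastAtMost)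
      then show ?thesis by (simp add: sum.reindex)
    qed
    also have "norm \<dots> \<le> (\<Sum>u=1..U. \<Sum>n=1..H. w (\<xi> (u, n)))"
      by (intro sum_norm_le w_pair)
    also have "\<dots> = B" by (simp add: B_def P_def sum.cartesian_product)
    finally show "norm (\<Sum>u=1..U. \<Sum>v=1..V. \<Sum>n=1..H. chi (int n + int (u * v))) \<le> B" .
  qed
  finally have main: "real (U * V) * norm S \<le> real (U * V) * (2 * real (U * V)) + B" .
  have "s \<le> 2 * Y + B / Y" if "Y > 0" "Y * s \<le> Y * (2 * Y) + B" for Y s :: real
  proof -
    have "s \<le> (Y * (2 * Y) + B) / Y" using that by (simp only: pos_le_divide_eq mult.commute[of s Y])
    also have "\<dots> = 2 * Y + B / Y" using that(1) by (simp add: add_divide_distrib)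
    finally show ?thesis .
  qed
  from this[OF _ main] have S: "norm S \<le> 2 * real (U * V) + B / real (U * V)" using pos by simp
  define coll where "coll = {(q, q'). q \<in> P \<and> q' \<in> P \<and> \<xi> q = \<xi> q'}"
  \<comment> \<open>Since \<open>U * H < p\<close>, a collision is an equation
    \<open>n * u' = n' * u\<close> between integers. Given \<open>u\<close> and \<open>n'\<close>,
    it is determined by the divisor \<open>u'\<close> of \<open>u * n'\<close>.\<close>
  have card_coll: "card coll \<le> U * H * Dm"
  proof -
    have sub: "coll \<subseteq> (\<Union>(u, n')\<in>P. (\<lambda>k. ((u, u * n' div k), (k, n'))) ` {k. k dvd u * n'})"
    proof
      fix z assume "z \<in> coll"
      then obtain u n u' n' where z: "z = ((u, n), (u', n'))" "(u, n) \<in> P" "(u', n') \<in> P" "\<xi> (u, n) = \<xi> (u', n')"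
        by (auto simp: coll_def)
      have uu: "u \<in> {1..U}" "u' \<in> {1..U}" "n \<in> {1..H}" "n' \<in> {1..H}" using z by (auto simp: P_def)
      have "[int n * iv u = int n' * iv u'] (mod int p)" using z(4) by (simp add: \<xi>_def Cong.cong_def)
      then have "[(int n * iv u) * (int u * int u') = (int n' * iv u') * (int u * int u')] (mod int p)" by (rule cong_scalar_right)
      moreover have "(int n * iv u) * (int u * int u') = (int n * int u') * (int u * iv u)"
        "(int n' * iv u') * (int u * int u') = (int n' * int u) * (int u' * iv u')" by (simp_all add: algebra_simps)
      moreover have "[(int n * int u') * (int u * iv u) = (int n * int u') * 1] (mod int p)"
        "[(int n' * int u) * (int u' * iv u') = (int n' * int u) * 1] (mod int p)"
        by (rule cong_scalar_left, rule iv[OF uu(1)], rule cong_scalar_left, rule iv[OF uu(2)])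
      ultimately have "[int n * int u' = int n' * int u] (mod int p)" by (metis cong_sym cong_trans mult_1_right)
      then have "[n * u' = n' * u] (mod p)" by (simp flip: of_nat_mult add: cong_int_iff)
      moreover have "n * u' \<le> H * U" "n' * u \<le> H * U" using uu by (auto intro!: mult_le_mono)
      then have "n * u' < p" "n' * u < p" using UH by (simp_all add: mult.commute)
      ultimately have eq: "n * u' = n' * u" by (simp add: Cong.cong_def)
      then have "u * n' = u' * n" by (simp add: mult.commute)
      moreover from this have "u * n' div u' = n" using uu by simp
      ultimately have "z = (\<lambda>k. ((u, u * n' div k), (k, n'))) u'" "u' dvd u * n'" using z(1) by auto
      moreover have "(u, n') \<in> P" using uu by (simp add: P_def)
      ultimately show "z \<in> (\<Union>(u, n')\<in>P. (\<lambda>k. ((u, u * n' div k), (k, n'))) ` {k. k dvd u * n'})" by blast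
    qed
    have finDiv: "finite {k. k dvd u * n'}" if "(u, n') \<in> P" for u n'
      using that by (intro finite_divisors_nat) (auto simp: P_def)
    have "card coll \<le> card (\<Union>(u, n')\<in>P. (\<lambda>k. ((u, u * n' div k), (k, n'))) ` {k. k dvd u * n'})"
      by (rule card_mono[OF _ sub]) (use finDiv in \<open>auto simp: P_def\<close>)
    also have "\<dots> \<le> (\<Sum>(u, n')\<in>P. card ((\<lambda>k. ((u, u * n' div k), (k, n'))) ` {k. k dvd u * n'}))"
      using card_UN_le[of P "\<lambda>(u, n'). (\<lambda>k. ((u, u * n' div k), (k, n'))) ` {k. k dvd u * n'}"]
      by (simp add: P_def case_prod_beta)
    also have "\<dots> \<le> (\<Sum>(u, n')\<in>P. Dm)"
    proof (intro sum_mono)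
      fix q assume q: "q \<in> P"
      obtain u n' where qe: "q = (u, n')" by (cases q)
      have un: "1 \<le> u * n'" "u * n' \<le> U * H" using q by (auto simp: qe P_def intro: mult_le_mono)
      have "card ((\<lambda>k. ((u, u * n' div k), (k, n'))) ` {k. k dvd u * n'}) \<le> card {k. k dvd u * n'}"
        using q qe finDiv by (intro card_image_le) auto
      also have "\<dots> \<le> Dm" using Dm[OF un] .
      finally show "(case q of (u, n') \<Rightarrow> card ((\<lambda>k. ((u, u * n' div k), (k, n'))) ` {k. k dvd u * n'})) \<le> (case q of (u, n') \<Rightarrow> Dm)"
        by (simp add: qe)
    qed
    also have "\<dots> = U * H * Dm" by (simp add: P_def case_prod_beta card_cartesian_product)
    finally show ?thesis .
  qed
  let ?M = "real (r ^ (2 * r) * V ^ r * p) + real V ^ (2 * r) * (real (2 * r) * sqrt (real p) + 1)"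
  have "B ^ (2 * r) \<le> real (card P) ^ (2 * r - 2) * real (card coll) * (\<Sum>x\<in>{0..<int p}. w x ^ (2 * r))"
    unfolding B_def coll_def
    by (rule sum_power_fibre_bound) (use p_gt_1 r w0 in \<open>auto simp: P_def \<xi>_def\<close>)
  also have "\<dots> \<le> real (U * H) ^ (2 * r - 2) * real (U * H * Dm) * ?M"
  proof (intro mult_mono)
    show "real (card P) ^ (2 * r - 2) \<le> real (U * H) ^ (2 * r - 2)" by (simp add: P_def card_cartesian_product)
    show "real (card coll) \<le> real (U * H * Dm)" using card_coll by (rule of_nat_mono)
    show "(\<Sum>x\<in>{0..<int p}. w x ^ (2 * r)) \<le> ?M" unfolding w_def by (rule moment_bound[OF d r V])
  qed (auto intro!: sum_nonneg simp: w0)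
  also have "real (U * H) ^ (2 * r - 2) * real (U * H * Dm) = real (U * H) ^ (2 * r - 1) * real Dm"
  proof -
    have "2 * r - 1 = Suc (2 * r - 2)" using r by simp
    then show ?thesis by (simp add: mult_ac)
  qed
  finally have "B ^ (2 * r) \<le> real (U * H) ^ (2 * r - 1) * real Dm * ?M" .
  then show ?thesis using S w0 by (intro that[of B]) (auto simp: B_def S_def intro!: sum_nonneg)
qed

end

section \<open>The divisor bound and short character sums\<close>

lemma card_divisors_mult_le:
  fixes a b :: nat
  assumes "a > 0" "b > 0"
  shows "card {d. d dvd a * b} \<le> card {d. d dvd a} * card {d. d dvd b}"
proof -
  have "{d. d dvd a * b} \<subseteq> (\<lambda>(x, y). x * y) ` ({d. d dvd a} \<times> {d. d dvd b})"
    by (auto dest!: division_decomp)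
  then have "card {d. d dvd a * b} \<le> card ({d. d dvd a} \<times> {d. d dvd b})"
    using assms by (intro surj_card_le) auto
  then show ?thesis by (simp add: card_cartesian_product)
qed

lemma card_divisors_prime_power_le:
  assumes "prime (q::nat)"
  shows "card {d. d dvd q ^ a} \<le> a + 1"
proof -
  have "{d. d dvd q ^ a} \<subseteq> (\<lambda>i. q ^ i) ` {..a}"
    using divides_primepow_nat[OF assms] by auto
  then have "card {d. d dvd q ^ a} \<le> card {..a}" by (intro surj_card_le) auto
  then show ?thesis by simp
qed

text \<open>Prime powers are split off one at a time. A prime with \<open>q^\<eta> \<ge> 2\<close>
  satisfies \<open>a + 1 \<le> 2^a \<le> q^(\<eta> a)\<close> and causes no loss; each of the
  finitely many other primes costs a factor \<open>K\<close>.\<close>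

lemma divisor_bound:
  fixes \<eta> :: real
  assumes \<eta>: "\<eta> > 0"
  obtains C :: real where "C \<ge> 1" "\<And>n::nat. n > 0 \<Longrightarrow> real (card {d. d dvd n}) \<le> C * real n powr \<eta>"
proof -
  \<comment> \<open>Chosen so that \<open>a + 1 \<le> K (1 + a \<eta> ln 2)\<close>, where the
    bracket is at most \<open>2^(\<eta> a)\<close>.\<close>
  define K where "K = 1 + 1 / (\<eta> * ln 2)"
  have K1: "K \<ge> 1" using \<eta> by (simp add: K_def)
  define small where "small = {q::nat. prime q \<and> real q powr \<eta> < 2}"
  have "small \<subseteq> {..nat \<lceil>2 powr (1/\<eta>)\<rceil>}"
  proof
    fix q assume "q \<in> small"
    then have "real q powr \<eta> < 2" by (simp add: small_def)
    then have "(real q powr \<eta>) powr (1/\<eta>) \<le> 2 powr (1/\<eta>)" using \<eta> by (intro powr_mono2) auto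
    then have "real q \<le> 2 powr (1/\<eta>)" using \<eta> by (simp add: powr_powr)
    then show "q \<in> {..nat \<lceil>2 powr (1/\<eta>)\<rceil>}" by (simp add: le_nat_iff) linarith
  qed
  then have fin: "finite small" using finite_subset by blast
  have small_pow: "real (a + 1) \<le> K * real q powr (\<eta> * real a)" if "q \<ge> 2" for a q :: nat
  proof -
    have "real a * \<eta> * ln 2 + 1 \<le> exp (real a * \<eta> * ln 2)" using exp_ge_add_one_self[of "real a * \<eta> * ln 2"] by linarith
    then have "1 + real a * \<eta> * ln 2 \<le> 2 powr (\<eta> * real a)" by (simp add: powr_def mult_ac)
    also have "\<dots> \<le> real q powr (\<eta> * real a)" using that \<eta> by (intro powr_mono2) auto
    finally have 1: "1 + real a * \<eta> * ln 2 \<le> real q powr (\<eta> * real a)" .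
    have e: "\<eta> * ln 2 > 0" using \<eta> by simp
    have "real (a + 1) \<le> K * (1 + real a * (\<eta> * ln 2))"
    proof -
      have "(1 / z) * (1 + real a * z) = 1 / z + real a" if "z > 0" for z :: real
        using that by (simp add: distrib_left)
      from this[OF e] have "(1 / (\<eta> * ln 2)) * (1 + real a * (\<eta> * ln 2)) = 1 / (\<eta> * ln 2) + real a" .
      moreover have "1 / (\<eta> * ln 2) > 0" "real a * (\<eta> * ln 2) \<ge> 0" using e by auto
      ultimately show ?thesis unfolding K_def distrib_right by simp
    qed
    also have "\<dots> \<le> K * real q powr (\<eta> * real a)" using 1 K1 by (intro mult_left_mono) (auto simp: mult.assoc)
    finally show ?thesis .
  qed
  have large_pow: "real (a + 1) \<le> real q powr (\<eta> * real a)" if "prime q" "q \<notin> small" for a q :: nat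
  proof -
    have "2 \<le> real q powr \<eta>" using that by (simp add: small_def)
    have "a + 1 \<le> 2 ^ a" by (induction a) auto
    then have "real (a + 1) \<le> real (2 ^ a)" by (rule of_nat_mono)
    then have "real (a + 1) \<le> 2 ^ a" by simp
    also have "\<dots> \<le> (real q powr \<eta>) ^ a" using \<open>2 \<le> real q powr \<eta>\<close> by (intro power_mono) auto
    also have "\<dots> = real q powr (\<eta> * real a)" using prime_gt_0_nat[OF that(1)]
      by (simp add: powr_powr[symmetric] powr_realpow)
    finally show ?thesis .
  qed
  have main: "real (card {d. d dvd n}) \<le> K ^ card {q\<in>small. q dvd n} * real n powr \<eta>" if "n > 0" for n :: nat
    using that
  proof (induction n rule: less_induct)
    case (less n)
    show ?case
    proof (cases "n = 1")
      case True
      have "K ^ card {q\<in>small. q dvd n} \<ge> 1" using K1 by (rule one_le_power)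
      with True show ?thesis by simp
    next
      case False
      then obtain q where q: "prime q" "q dvd n" using prime_factor_nat by blast
      define a where "a = multiplicity q n"
      obtain m where m: "n = q ^ a * m" "\<not> q dvd m"
        using multiplicity_decompose'[of n q] less.prems q(1) not_prime_unit[of q] unfolding a_def by blast
      have a: "a > 0" using q less.prems by (simp add: a_def prime_multiplicity_gt_zero_iff)
      have m0: "m > 0" using m less.prems by (cases m) auto
      have qa: "q ^ a > 1" using q a by (metis one_less_power prime_gt_1_nat)
      then have "m < n" using m m0 by simp
      from less.IH[OF this m0] have IH: "real (card {d. d dvd m}) \<le> K ^ card {q\<in>small. q dvd m} * real m powr \<eta>" .
      have pw: "real n powr \<eta> = real q powr (\<eta> * real a) * real m powr \<eta>"
      proof -
        have "real n = real q powr real a * real m"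
          using m prime_gt_0_nat[OF q(1)] by (simp add: powr_realpow)
        then show ?thesis by (simp add: powr_mult powr_powr mult.commute)
      qed
      have "card {d. d dvd n} \<le> card {d. d dvd q ^ a} * card {d. d dvd m}"
        unfolding m(1) using m0 qa by (intro card_divisors_mult_le) linarith+
      also have "\<dots> \<le> (a + 1) * card {d. d dvd m}"
        using card_divisors_prime_power_le[OF q(1)] by (intro mult_right_mono) auto
      finally have "real (card {d. d dvd n}) \<le> real ((a + 1) * card {d. d dvd m})"
        by (rule of_nat_mono)
      then have "real (card {d. d dvd n}) \<le> real (a + 1) * real (card {d. d dvd m})"
        by (simp only: of_nat_mult)
      also have "\<dots> \<le> real (a + 1) * (K ^ card {q\<in>small. q dvd m} * real m powr \<eta>)"
        by (intro mult_left_mono IH) auto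
      finally have 1: "real (card {d. d dvd n}) \<le> real (a + 1) * (K ^ card {q\<in>small. q dvd m} * real m powr \<eta>)" .
      have sub: "{q\<in>small. q dvd m} \<subseteq> {q\<in>small. q dvd n}" unfolding m(1) by auto
      show ?thesis
      proof (cases "q \<in> small")
        case True
        have "insert q {q\<in>small. q dvd m} \<subseteq> {q\<in>small. q dvd n}" using sub True q by auto
        then have "card (insert q {q\<in>small. q dvd m}) \<le> card {q\<in>small. q dvd n}"
          using fin by (intro card_mono) auto
        then have c: "Suc (card {q\<in>small. q dvd m}) \<le> card {q\<in>small. q dvd n}" using m(2) fin by simp
        have "real (a + 1) * (K ^ card {q\<in>small. q dvd m} * real m powr \<eta>)
          \<le> (K * real q powr (\<eta> * real a)) * (K ^ card {q\<in>small. q dvd m} * real m powr \<eta>)"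
          using small_pow[of q a] prime_ge_2_nat[OF q(1)] K1 by (intro mult_right_mono) auto
        also have "\<dots> = K ^ Suc (card {q\<in>small. q dvd m}) * real n powr \<eta>" by (simp add: pw mult_ac)
        also have "\<dots> \<le> K ^ card {q\<in>small. q dvd n} * real n powr \<eta>"
          using c K1 by (intro mult_right_mono power_increasing) auto
        finally show ?thesis using 1 by linarith
      next
        case False
        have "real (a + 1) * (K ^ card {q\<in>small. q dvd m} * real m powr \<eta>)
          \<le> real q powr (\<eta> * real a) * (K ^ card {q\<in>small. q dvd m} * real m powr \<eta>)"
          using large_pow[OF q(1) False, of a] K1 by (intro mult_right_mono) auto
        also have "\<dots> = K ^ card {q\<in>small. q dvd m} * real n powr \<eta>" by (simp add: pw mult_ac)
        also have "\<dots> \<le> K ^ card {q\<in>small. q dvd n} * real n powr \<eta>"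
          using K1 fin sub by (intro mult_right_mono power_increasing card_mono) auto
        finally show ?thesis using 1 by linarith
      qed
    qed
  qed
  show ?thesis
  proof (rule that[of "K ^ card small"])
    show "K ^ card small \<ge> 1" using K1 by (rule one_le_power)
    fix n :: nat assume n: "n > 0"
    have "K ^ card {q\<in>small. q dvd n} * real n powr \<eta> \<le> K ^ card small * real n powr \<eta>"
      using K1 fin by (intro mult_right_mono power_increasing card_mono) auto
    with main[OF n] show "real (card {d. d dvd n}) \<le> K ^ card small * real n powr \<eta>" by linarith
  qed
qed

section \<open>Character sums of length \<open>p^(1/4 + \<epsilon>)\<close>\<close>

lemma eventually_le_powr:
  assumes "a > 0"
  shows "eventually (\<lambda>p::nat. C \<le> real p powr a) sequentially"
proof -
  have "filterlim (\<lambda>p::nat. real p powr a) at_top sequentially" using assms by real_asymp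
  then show ?thesis by (simp add: filterlim_at_top)
qed

definition short_length :: "real \<Rightarrow> nat \<Rightarrow> nat" where
  "short_length a p = nat \<lfloor>real p powr a\<rfloor>"

lemma short_length_le: "real (short_length a p) \<le> real p powr a"
  by (simp add: short_length_def)

lemma short_length_ge:
  assumes "p \<ge> 1" "a \<ge> 0"
  shows "real p powr a / 2 \<le> real (short_length a p)" "short_length a p \<ge> 1"
proof -
  have "1 \<le> real p powr a" using assms by (simp add: ge_one_powr_ge_zero)
  then have "\<lfloor>real p powr a\<rfloor> \<ge> 1" by simp
  then show "short_length a p \<ge> 1" unfolding short_length_def by linarith
  have "real (short_length a p) = of_int \<lfloor>real p powr a\<rfloor>" using \<open>\<lfloor>real p powr a\<rfloor> \<ge> 1\<close> by (simp add: short_length_def)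
  moreover have "real p powr a < of_int \<lfloor>real p powr a\<rfloor> + 1" by linarith
  moreover have "1 \<le> real_of_int \<lfloor>real p powr a\<rfloor>" using \<open>\<lfloor>real p powr a\<rfloor> \<ge> 1\<close> by simp
  ultimately show "real p powr a / 2 \<le> real (short_length a p)" by linarith
qed

text \<open>\<open>V\<close> is about \<open>p^(1/(2r))\<close>, where both terms of the moment
  bound have the same size, and \<open>U\<close> makes \<open>U V\<close> smaller than
  \<open>H\<close> by a factor \<open>p^(\<epsilon>/2)\<close>. Then \<open>U H\<close> exceeds
  \<open>p^(1/2)\<close> by a factor \<open>p^\<epsilon>\<close> up to a constant, and half of this
  gain survives the divisor bound.\<close>

theorem burgess_bound:
  fixes \<epsilon> :: real
  assumes \<epsilon>: "0 < \<epsilon>" "\<epsilon> \<le> 1/8"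
  obtains \<delta> where "\<delta> > 0"
    "eventually (\<lambda>p. \<forall>chi. prime p \<longrightarrow> dirichlet_char p chi \<longrightarrow> char_order p chi > 1 \<longrightarrow>
       norm (\<Sum>n=1..short_length (1/4 + \<epsilon>) p. chi (int n)) \<le> real (short_length (1/4 + \<epsilon>) p) * real p powr (-\<delta>)) sequentially"
proof -
  \<comment> \<open>With \<open>r \<ge> 1/\<epsilon>\<close> the length \<open>V\<close> is at most
    \<open>2 p^(\<epsilon>/2)\<close>.\<close>
  define r where "r = nat \<lceil>1 / \<epsilon>\<rceil>"
  have r_ge: "real r \<ge> 1 / \<epsilon>" unfolding r_def by (rule real_nat_ceiling_ge)
  have "1 / \<epsilon> > 0" using \<epsilon> by simp
  then have r1: "r \<ge> 1" using r_ge by (cases r) auto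
  have r_eps: "1 / real (2 * r) \<le> \<epsilon> / 2"
    using r_ge \<epsilon> r1 by (simp add: field_simps)
  obtain C2 :: real where C2: "C2 \<ge> 1" "\<And>n::nat. n > 0 \<Longrightarrow> real (card {d. d dvd n}) \<le> C2 * real n powr (\<epsilon>/2)"
    using divisor_bound[of "\<epsilon>/2"] \<epsilon> by auto
  define C1 where "C1 = real (r ^ (2 * r)) + 2 * real r + 1"
  \<comment> \<open>A saving of \<open>p^(-\<epsilon>/4)\<close> in the \<open>2r\<close>-th power
    is one of \<open>p^(-2\<delta>)\<close> in the sum itself; a factor \<open>p^\<delta>\<close> of
    it is given away for the constant 3.\<close>
  define \<delta> where "\<delta> = \<epsilon> / (16 * real r)"
  have C1: "C1 > 0" by (simp add: C1_def add_nonneg_pos)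
  have \<delta>: "\<delta> > 0" using \<epsilon> r1 by (simp add: \<delta>_def)
  have ev: "eventually (\<lambda>p. 4 \<le> real p powr (1/4)) sequentially"
    "eventually (\<lambda>p. 16 * C1 * C2 \<le> real p powr (\<epsilon>/4)) sequentially"
    "eventually (\<lambda>p. 3 \<le> real p powr \<delta>) sequentially"
    using \<epsilon> \<delta> by (auto intro!: eventually_le_powr)
  have "eventually (\<lambda>p. \<forall>chi. prime p \<longrightarrow> dirichlet_char p chi \<longrightarrow> char_order p chi > 1 \<longrightarrow>
       norm (\<Sum>n=1..short_length (1/4 + \<epsilon>) p. chi (int n)) \<le> real (short_length (1/4 + \<epsilon>) p) * real p powr (-\<delta>)) sequentially"
    using ev
  proof eventually_elim
    case (elim p)
    show ?case
    proof (intro allI impI)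
      fix chi assume p: "prime p" and chi: "dirichlet_char p chi" and ord: "char_order p chi > 1"
      interpret dirichlet p chi "char_order p chi" by unfold_locales (use p chi in auto)
      define P where "P = real p"
      have P1: "P > 1" using p_gt_1 by (simp add: P_def)
      define H where "H = short_length (1/4 + \<epsilon>) p"
      define V where "V = nat \<lceil>P powr (1 / real (2 * r))\<rceil>"
      have H_le: "real H \<le> P powr (1/4 + \<epsilon>)" using short_length_le by (simp add: H_def P_def)
      have H_ge: "P powr (1/4 + \<epsilon>) / 2 \<le> real H" "H \<ge> 1"
        using short_length_ge[of p "1/4 + \<epsilon>"] p_gt_1 \<epsilon> by (simp_all add: H_def P_def)
      have V_ge: "real V \<ge> P powr (1 / real (2 * r))" by (simp add: V_def)
      have Vpow1: "P powr (1 / real (2 * r)) \<ge> 1" using P1 by (simp add: ge_one_powr_ge_zero)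
      have V1: "V \<ge> 1" using V_ge Vpow1 by (cases V) auto
      have V_le: "real V \<le> 2 * P powr (1 / real (2 * r))"
        using Vpow1 by (simp add: V_def) linarith
      have "P powr (1 / real (2 * r)) \<le> P powr (\<epsilon>/2)" using P1 r_eps by (intro powr_mono) auto
      then have V_le2: "real V \<le> 2 * P powr (\<epsilon>/2)" using V_le by linarith
      define Y where "Y = real H * P powr (-\<epsilon>/2) / real V"
      define U where "U = nat \<lfloor>Y\<rfloor>"
      have Y_ge: "Y \<ge> P powr (1/4) / 4"
      proof -
        have "P powr (1/4) = P powr (1/4 + \<epsilon>) * P powr (-\<epsilon>/2) / P powr (\<epsilon>/2)"
          by (simp add: powr_add[symmetric] powr_diff[symmetric])
        then have "P powr (1/4) / 4 = (P powr (1/4 + \<epsilon>) / 2) * P powr (-\<epsilon>/2) / (2 * P powr (\<epsilon>/2))" by simp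
        also have "\<dots> \<le> Y" unfolding Y_def using H_ge V_le2 V1 by (intro frac_le mult_right_mono) auto
        finally show ?thesis .
      qed
      then have Y1: "Y \<ge> 1" using elim(1) by (simp add: P_def)
      have U1: "U \<ge> 1" using Y1 by (simp add: U_def le_nat_iff)
      have U_le: "real U \<le> Y" using Y1 by (simp add: U_def)
      have U_ge: "Y / 2 \<le> real U"
      proof -
        have "real U = of_int \<lfloor>Y\<rfloor>" "1 \<le> real_of_int \<lfloor>Y\<rfloor>" using Y1 by (simp_all add: U_def)
        moreover have "Y < of_int \<lfloor>Y\<rfloor> + 1" by linarith
        ultimately show ?thesis by linarith
      qed
      have UV_le: "real (U * V) \<le> real H * P powr (-\<epsilon>/2)"
        using U_le V1 by (simp add: Y_def field_simps)
      have UH_le: "real (U * H) < P"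
      proof -
        have "real (U * H) \<le> Y * real H" using U_le by (simp add: mult_right_mono)
        also have "\<dots> \<le> real H * real H"
        proof -
          have "P powr (-\<epsilon>/2) \<le> 1" using P1 \<epsilon> powr_mono[of "-\<epsilon>/2" 0 P] by simp
          then have "real H * P powr (-\<epsilon>/2) \<le> real H * 1" by (intro mult_left_mono) auto
          moreover have "Y \<le> real H * P powr (-\<epsilon>/2) / 1" unfolding Y_def using V1 by (intro divide_left_mono) auto
          ultimately have "Y \<le> real H" by simp
          then show ?thesis by (intro mult_right_mono) auto
        qed
        also have "\<dots> \<le> P powr (1/4 + \<epsilon>) * P powr (1/4 + \<epsilon>)" using H_le by (intro mult_mono) auto
        also have "\<dots> = P powr (1/2 + 2 * \<epsilon>)" by (simp add: powr_add[symmetric])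
        also have "\<dots> < P powr 1" using P1 \<epsilon> by (intro powr_less_mono) auto
        finally show ?thesis using P1 by simp
      qed
      have UH_ge: "real (U * H) \<ge> P powr (1/2 + \<epsilon>) / 16"
      proof -
        have "P powr (1/2 + \<epsilon>) = P powr (1/4 + \<epsilon>) * (P powr (1/4 + \<epsilon>) * P powr (-\<epsilon>/2) / P powr (\<epsilon>/2))"
          by (simp add: powr_add[symmetric] powr_diff[symmetric])
        then have "P powr (1/2 + \<epsilon>) / 16 = (P powr (1/4 + \<epsilon>) / 2) * ((P powr (1/4 + \<epsilon>) / 2) * P powr (-\<epsilon>/2) / (2 * P powr (\<epsilon>/2)) / 2)" by simp
        also have "\<dots> \<le> real H * (Y / 2)" unfolding Y_def using H_ge V_le2 V1
          by (intro mult_mono divide_right_mono frac_le) auto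
        also have "\<dots> \<le> real H * real U" using U_ge by (intro mult_left_mono) auto
        finally show ?thesis by (simp add: mult.commute)
      qed
      have UHp: "U * H < p" using UH_le by (simp add: P_def flip: of_nat_mult)
      have Vp: "V < p"
      proof -
        have "real V \<le> 2 * P powr (1/16)" using V_le2 \<epsilon> P1 powr_mono[of "\<epsilon>/2" "1/16" P] by linarith
        also have "\<dots> < P powr (1/4) * P powr (1/16)" using elim(1) P1 by (intro mult_strict_right_mono) (auto simp: P_def)
        also have "\<dots> = P powr (5/16)" by (simp add: powr_add[symmetric])
        also have "\<dots> \<le> P powr 1" using P1 by (intro powr_mono) auto
        finally show ?thesis using P1 by (simp add: P_def)
      qed
      define Dm where "Dm = nat \<lfloor>C2 * P powr (\<epsilon>/2)\<rfloor>"
      have Dm: "card {k. k dvd m} \<le> Dm" if m: "1 \<le> m" "m \<le> U * H" for m :: nat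
      proof -
        have "real m \<le> P" using m UHp by (simp add: P_def)
        then have "real m powr (\<epsilon>/2) \<le> P powr (\<epsilon>/2)" using \<epsilon> by (intro powr_mono2) auto
        then have "C2 * real m powr (\<epsilon>/2) \<le> C2 * P powr (\<epsilon>/2)" using C2(1) by (intro mult_left_mono) auto
        moreover have "real (card {k. k dvd m}) \<le> C2 * real m powr (\<epsilon>/2)" using C2(2) m by simp
        ultimately have "real (card {k. k dvd m}) \<le> C2 * P powr (\<epsilon>/2)" by linarith
        then show ?thesis by (simp add: Dm_def le_nat_iff le_floor_iff)
      qed
      have Dm_le: "real Dm \<le> C2 * P powr (\<epsilon>/2)" using C2(1) by (simp add: Dm_def)
      obtain B where B: "B \<ge> 0" "norm (\<Sum>n=1..H. chi (int n)) \<le> 2 * real (U * V) + B / real (U * V)"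
        "B ^ (2 * r) \<le> real (U * H) ^ (2 * r - 1) * real Dm *
          (real (r ^ (2 * r) * V ^ r * p) + real V ^ (2 * r) * (real (2 * r) * sqrt (real p) + 1))"
        using burgess_inequality[OF ord r1 U1 V1 H_ge(2) Vp UHp Dm] by blast
      define M where "M = real (r ^ (2 * r) * V ^ r * p) + real V ^ (2 * r) * (real (2 * r) * sqrt (real p) + 1)"
      \<comment> \<open>Because \<open>sqrt P \<le> V^r\<close>, the term with \<open>V^r p\<close>
        is absorbed by the one with \<open>V^(2r) sqrt p\<close>.\<close>
      have M_le: "M \<le> C1 * real V ^ (2 * r) * sqrt P"
      proof -
        have "sqrt P = P powr (1/2)" using P1 by (simp add: powr_half_sqrt)
        also have "\<dots> = (P powr (1 / real (2 * r))) ^ r" using r1 P1 by (simp add: powr_power)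
        also have "\<dots> \<le> real V ^ r" using V_ge by (intro power_mono) auto
        finally have sV: "sqrt P \<le> real V ^ r" .
        have "real V ^ r * P = real V ^ r * (sqrt P * sqrt P)" using P1 by simp
        also have "\<dots> \<le> real V ^ r * (real V ^ r * sqrt P)" using sV P1 by (intro mult_left_mono mult_right_mono) auto
        also have "\<dots> = real V ^ (2 * r) * sqrt P" by (simp add: power_add[symmetric] mult_2 mult.assoc[symmetric])
        finally have "real (r ^ (2 * r)) * (real V ^ r * P) \<le> real (r ^ (2 * r)) * (real V ^ (2 * r) * sqrt P)"
          by (rule mult_left_mono) simp
        moreover have "real V ^ (2 * r) * (2 * real r * sqrt P + 1) \<le> real V ^ (2 * r) * ((2 * real r + 1) * sqrt P)"
          using P1 by (intro mult_left_mono) (auto simp: algebra_simps)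
        ultimately show ?thesis by (simp add: M_def C1_def P_def algebra_simps)
      qed
      have UV0: "real (U * V) > 0" using U1 V1 by simp
      have UH0: "real (U * H) > 0" using U1 H_ge(2) by simp
      have "(B / real (U * V)) ^ (2 * r) = B ^ (2 * r) / real (U * V) ^ (2 * r)" by (rule power_divide)
      also have "\<dots> \<le> (real (U * H) ^ (2 * r - 1) * real Dm * M) / real (U * V) ^ (2 * r)"
        using B(3) UV0 by (intro divide_right_mono) (auto simp: M_def)
      also have "\<dots> \<le> (real (U * H) ^ (2 * r - 1) * (C2 * P powr (\<epsilon>/2)) * (C1 * real V ^ (2 * r) * sqrt P)) / real (U * V) ^ (2 * r)"
        using Dm_le M_le C2(1) by (intro divide_right_mono mult_mono mult_left_mono) (auto simp: M_def)
      also have "\<dots> = real H ^ (2 * r) * (C1 * C2 * P powr (\<epsilon>/2) * sqrt P / real (U * H))"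
      proof -
        have e: "real (U * H) ^ (2 * r) = real (U * H) ^ (2 * r - 1) * real (U * H)"
          by (rule power_minus_mult[symmetric]) (use r1 in simp)
        have "real (U * H) ^ (2 * r - 1) = real (U * H) ^ (2 * r) / real (U * H)" using e UH0 by (simp del: of_nat_mult)
        then show ?thesis using U1 V1 by (simp add: power_mult_distrib field_simps)
      qed
      also have "\<dots> \<le> real H ^ (2 * r) * (C1 * C2 * P powr (\<epsilon>/2) * sqrt P / (P powr (1/2 + \<epsilon>) / 16))"
        using UH_ge UH0 P1 C1 C2(1) by (intro mult_left_mono divide_left_mono) (auto simp del: of_nat_mult)
      also have "\<dots> = real H ^ (2 * r) * ((16 * C1 * C2) * P powr (-\<epsilon>/2))"
      proof -
        have "P powr (\<epsilon>/2) * sqrt P / P powr (1/2 + \<epsilon>) = P powr (-\<epsilon>/2)"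
          using P1 by (simp add: powr_half_sqrt[symmetric] powr_add[symmetric] powr_diff[symmetric])
        moreover have "C1 * C2 * P powr (\<epsilon>/2) * sqrt P / (P powr (1/2 + \<epsilon>) / 16)
          = 16 * C1 * C2 * (P powr (\<epsilon>/2) * sqrt P / P powr (1/2 + \<epsilon>))" by simp
        ultimately show ?thesis by (simp only:)
      qed
      also have "\<dots> \<le> real H ^ (2 * r) * (P powr (\<epsilon>/4) * P powr (-\<epsilon>/2))"
        using elim(2) by (intro mult_left_mono mult_right_mono) (auto simp: P_def)
      also have "P powr (\<epsilon>/4) * P powr (-\<epsilon>/2) = (P powr (- 2 * \<delta>)) ^ (2 * r)"
        using r1 P1 by (simp add: powr_add[symmetric] powr_power \<delta>_def)
      also have "real H ^ (2 * r) * (P powr (- 2 * \<delta>)) ^ (2 * r) = (real H * P powr (- 2 * \<delta>)) ^ (2 * r)"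
        by (simp add: power_mult_distrib)
      finally have "(B / real (U * V)) ^ (2 * r) \<le> (real H * P powr (- 2 * \<delta>)) ^ (2 * r)" .
      then have "B / real (U * V) \<le> real H * P powr (- 2 * \<delta>)"
        using r1 B(1) power_mono_iff[of "B / real (U * V)" "real H * P powr (- 2 * \<delta>)" "2 * r"] by simp
      moreover have "2 * real (U * V) \<le> 2 * (real H * P powr (- 2 * \<delta>))"
      proof -
        have "\<epsilon> / (16 * real r) \<le> \<epsilon> / 16" using \<epsilon> r1 by (simp add: field_simps)
        then have "P powr (-\<epsilon>/2) \<le> P powr (- 2 * \<delta>)" using P1 \<epsilon> by (intro powr_mono) (auto simp: \<delta>_def)
        then have "real H * P powr (-\<epsilon>/2) \<le> real H * P powr (- 2 * \<delta>)" by (intro mult_left_mono) auto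
        then show ?thesis using UV_le by linarith
      qed
      ultimately have "norm (\<Sum>n=1..H. chi (int n)) \<le> 3 * (real H * P powr (- 2 * \<delta>))" using B(2) by linarith
      also have "\<dots> = real H * (3 * P powr (- 2 * \<delta>))" by simp
      also have "\<dots> \<le> real H * (P powr \<delta> * P powr (- 2 * \<delta>))"
        using elim(3) by (intro mult_left_mono mult_right_mono) (auto simp: P_def)
      also have "P powr \<delta> * P powr (- 2 * \<delta>) = P powr (- \<delta>)" by (simp add: powr_add[symmetric])
      finally show "norm (\<Sum>n=1..short_length (1/4 + \<epsilon>) p. chi (int n)) \<le> real (short_length (1/4 + \<epsilon>) p) * real p powr (-\<delta>)"
        by (simp add: H_def P_def)
    qed
  qed
  with \<delta> show ?thesis by (rule that)
qed

section \<open>Fractions representing powers modulo p\<close>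

definition ratio_pairs :: "nat \<Rightarrow> int \<Rightarrow> nat \<Rightarrow> (nat \<times> nat) set" where
  "ratio_pairs p z M = {(u, v). u \<in> {1..M} \<and> v \<in> {1..M} \<and> [int u = int v * z] (mod int p)}"

text \<open>Pigeonhole among the \<open>(K + 1)^2 > p\<close> pairs \<open>x, y \<le> K\<close>: two
  of them have the same residue \<open>x - y z\<close>.\<close>

lemma thue:
  assumes p: "p > 1"
  obtains a b :: int where "(a, b) \<noteq> (0, 0)" "[a = b * z] (mod int p)" "a\<^sup>2 \<le> int p" "b\<^sup>2 \<le> int p"
proof -
  define K where "K = floor_sqrt p"
  have K: "K\<^sup>2 \<le> p" "p < (Suc K)\<^sup>2" by (simp_all add: K_def Suc_floor_sqrt_power2_gt)
  define f where "f = (\<lambda>(x::int, y::int). (x - y * z) mod int p)"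
  let ?A = "{0..int K} \<times> {0..int K}"
  have "f ` ?A \<subseteq> {0..<int p}" using p by (auto simp: f_def)
  then have "card (f ` ?A) \<le> p" using card_mono[of "{0..<int p}" "f ` ?A"] by simp
  moreover have "card ?A = (Suc K)\<^sup>2" by (simp add: card_cartesian_product power2_eq_square nat_add_distrib)
  ultimately have "card (f ` ?A) < card ?A" using K by simp
  then have "\<not> inj_on f ?A" using pigeonhole by blast
  then obtain x y x' y' where xy: "(x, y) \<in> ?A" "(x', y') \<in> ?A" "(x, y) \<noteq> (x', y')" "f (x, y) = f (x', y')"
    by (auto simp: inj_on_def)
  show ?thesis
  proof (rule that[of "x - x'" "y - y'"])
    show "(x - x', y - y') \<noteq> (0, 0)" using xy by auto
    have "[x - y * z = x' - y' * z] (mod int p)" using xy by (simp add: f_def Cong.cong_def)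
    then show "[x - x' = (y - y') * z] (mod int p)" by (simp add: cong_iff_dvd_diff algebra_simps)
    have "\<bar>x - x'\<bar> \<le> int K" "\<bar>y - y'\<bar> \<le> int K" using xy by auto
    then have "(x - x')\<^sup>2 \<le> (int K)\<^sup>2" "(y - y')\<^sup>2 \<le> (int K)\<^sup>2" by (auto simp: abs_le_square_iff[symmetric])
    moreover have "(int K)\<^sup>2 \<le> int p" using K(1) by (metis of_nat_le_iff of_nat_power)
    ultimately show "(x - x')\<^sup>2 \<le> int p" "(y - y')\<^sup>2 \<le> int p" by linarith+
  qed
qed

lemma card_fibres_le:
  assumes "finite S" "finite K" "f ` S \<subseteq> K" "\<And>k. k \<in> K \<Longrightarrow> card {x\<in>S. f x = k} \<le> F"
  shows "card S \<le> card K * F"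
proof -
  have "card S = (\<Sum>k\<in>K. card {x\<in>S. f x = k})"
    using sum.group[OF assms(1-3), of "\<lambda>_. 1::nat"] by simp
  also have "\<dots> \<le> (\<Sum>k\<in>K. F)" using assms(4) by (rule sum_mono)
  finally show ?thesis by simp
qed

text \<open>The congruence defines a lattice of determinant \<open>p\<close>. Its points in the box lie on few
  lines parallel to a shortest vector \<open>(\<plusminus> a, b)\<close>.\<close>

lemma ratio_pairs_bound:
  assumes p: "prime p" and z: "\<not> int p dvd z" and M: "p \<le> M\<^sup>2"
  obtains a b :: nat and \<sigma> :: int where "a \<ge> 1" "b \<ge> 1" "coprime a b" "\<sigma> = 1 \<or> \<sigma> = -1"
    "[int a = \<sigma> * int b * z] (mod int p)" "(max a b)\<^sup>2 \<le> p"
    "real (card (ratio_pairs p z M)) \<le> 8 * real M ^ 2 / real p + 7 * real M / real (max a b)"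
proof -
  have p1: "p > 1" using p by (rule prime_gt_1_nat)
  define L where "L = (\<lambda>s::nat. \<exists>a b :: int. (a, b) \<noteq> (0, 0) \<and> [a = b * z] (mod int p) \<and> \<bar>a\<bar> \<le> int s \<and> \<bar>b\<bar> \<le> int s)"
  obtain a1 b1 :: int where ab1: "(a1, b1) \<noteq> (0, 0)" "[a1 = b1 * z] (mod int p)" "a1\<^sup>2 \<le> int p" "b1\<^sup>2 \<le> int p"
    using thue[OF p1] by blast
  define s1 where "s1 = max (nat \<bar>a1\<bar>) (nat \<bar>b1\<bar>)"
  have Ls1: "L s1" unfolding L_def by (intro exI[of _ a1] exI[of _ b1]) (use ab1 in \<open>auto simp: s1_def\<close>)
  have s1: "s1\<^sup>2 \<le> p"
  proof -
    have "(int s1)\<^sup>2 = a1\<^sup>2 \<or> (int s1)\<^sup>2 = b1\<^sup>2" by (auto simp: s1_def max_def)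
    then have "(int s1)\<^sup>2 \<le> int p" using ab1(3,4) by metis
    then show ?thesis by (simp only: of_nat_power[symmetric] of_nat_le_iff)
  qed
  \<comment> \<open>\<open>s\<close> is the sup norm of a shortest nonzero lattice vector
    \<open>(a, b)\<close>; by minimality this vector is primitive.\<close>
  define s where "s = (LEAST s. L s)"
  have Ls: "L s" unfolding s_def using Ls1 by (rule LeastI)
  have s_min: "L s' \<Longrightarrow> s \<le> s'" for s' unfolding s_def by (rule Least_le)
  have "s \<le> s1" by (rule s_min[OF Ls1])
  then have s2: "s\<^sup>2 \<le> p" using s1 by (meson le_trans power_mono zero_le)
  obtain a b :: int where ab: "(a, b) \<noteq> (0, 0)" "[a = b * z] (mod int p)" "\<bar>a\<bar> \<le> int s" "\<bar>b\<bar> \<le> int s"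
    using Ls unfolding L_def by blast
  have s_max: "s = max (nat \<bar>a\<bar>) (nat \<bar>b\<bar>)"
  proof (rule antisym)
    have "L (max (nat \<bar>a\<bar>) (nat \<bar>b\<bar>))" using ab unfolding L_def by (intro exI[of _ a] exI[of _ b]) auto
    then show "s \<le> max (nat \<bar>a\<bar>) (nat \<bar>b\<bar>)" by (rule s_min)
    show "max (nat \<bar>a\<bar>) (nat \<bar>b\<bar>) \<le> s" using ab by auto
  qed
  have s_lt_p: "s < p"
  proof (rule ccontr)
    assume "\<not> s < p"
    then have "p * p \<le> s * s" by (intro mult_le_mono) auto
    then have "p * p \<le> p" using s2 unfolding power2_eq_square by (rule le_trans)
    moreover have "p * 1 < p * p" using p1 by (intro mult_strict_left_mono) auto
    ultimately show False by simp
  qed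
  have small: "x = 0" if "int p dvd x" "\<bar>x\<bar> \<le> int s" for x
    using that s_lt_p by (metis abs_ge_zero dvd_imp_le_int le_less_trans not_le of_nat_less_iff abs_of_nonneg of_nat_0_le_iff)
  have pz: "prime (int p)" using p by simp
  have a0: "a \<noteq> 0"
  proof
    assume a: "a = 0"
    then have "int p dvd b * z" using ab(2) by (metis cong_0_iff cong_sym)
    then have "int p dvd b" using z pz by (simp add: prime_dvd_mult_iff)
    then have "b = 0" using small ab by blast
    with a ab show False by simp
  qed
  have b0: "b \<noteq> 0"
  proof
    assume b: "b = 0"
    then have "int p dvd a" using ab(2) by (simp add: cong_0_iff)
    then have "a = 0" using small ab by blast
    with a0 show False by simp
  qed
  have s0: "s > 0" using ab(3) a0 by auto
  have cop: "coprime a b"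
  proof -
    define g where "g = gcd a b"
    obtain a' b' where g: "a = g * a'" "b = g * b'" unfolding g_def by (meson dvdE gcd_dvd1 gcd_dvd2)
    have g0: "g > 0" using a0 by (simp add: g_def)
    have gs: "\<bar>g\<bar> \<le> int s"
    proof -
      have "\<bar>g\<bar> \<le> \<bar>a\<bar>" unfolding g_def using a0 by (metis abs_ge_zero dvd_imp_le_int gcd_dvd1 abs_of_nonneg gcd_ge_0_int)
      then show ?thesis using ab by linarith
    qed
    have "\<not> int p dvd g" using small[OF _ gs] g0 by auto
    moreover have "int p dvd g * (a' - b' * z)"
      using ab(2) by (simp add: g cong_iff_dvd_diff algebra_simps)
    ultimately have "int p dvd a' - b' * z" using pz by (simp add: prime_dvd_mult_iff)
    then have c: "[a' = b' * z] (mod int p)" by (simp add: cong_iff_dvd_diff)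
    have "a' \<noteq> 0" using a0 g by auto
    then have "L (max (nat \<bar>a'\<bar>) (nat \<bar>b'\<bar>))" using c unfolding L_def by (intro exI[of _ a'] exI[of _ b']) auto
    then have "s \<le> max (nat \<bar>a'\<bar>) (nat \<bar>b'\<bar>)" by (rule s_min)
    moreover have "s = nat g * max (nat \<bar>a'\<bar>) (nat \<bar>b'\<bar>)"
      unfolding s_max using g0 by (simp add: g abs_mult nat_mult_distrib nat_mult_max_right)
    ultimately have "nat g * s \<le> s * 1" using s0 by (metis mult.commute mult.right_neutral mult_le_mono2)
    then have "g = 1" using g0 s0 by (simp add: mult.commute)
    then show ?thesis unfolding g_def by (rule gcd_eq_1_imp_coprime)
  qed
  define A B where "A = nat \<bar>a\<bar>" and "B = nat \<bar>b\<bar>"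
  define \<sigma> where "\<sigma> = sgn a * sgn b"
  have sM: "s \<le> M"
  proof -
    have "s\<^sup>2 \<le> M\<^sup>2" using s2 M by (rule le_trans)
    then show ?thesis by (rule power2_le_imp_le) simp
  qed
  have count: "card (ratio_pairs p z M) \<le> (2 * (2 * M * s div p) + 1) * (2 * (M div s) + 1)"
  proof -
    define m where "m = 2 * M * s div p"
    \<comment> \<open>The determinant of a lattice point with \<open>(a, b)\<close> is a multiple of
      \<open>p\<close>; the quotient numbers the line parallel to \<open>(a, b)\<close> on which the
      point lies.\<close>
    define f where "f = (\<lambda>(u::nat, v::nat). (int u * b - int v * a) div int p)"
    have fin: "finite (ratio_pairs p z M)"
      by (rule finite_subset[of _ "{1..M} \<times> {1..M}"]) (auto simp: ratio_pairs_def)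
    have dvd: "int p dvd int u * b - int v * a" if "(u, v) \<in> ratio_pairs p z M" for u v
    proof -
      have "[int u * b = (int v * z) * b] (mod int p)" using that by (intro cong_scalar_right) (simp add: ratio_pairs_def)
      moreover have "[int v * a = int v * (b * z)] (mod int p)" by (rule cong_scalar_left[OF ab(2)])
      ultimately have "[int u * b - int v * a = (int v * z) * b - int v * (b * z)] (mod int p)" by (rule cong_diff)
      then have "[int u * b - int v * a = 0] (mod int p)" by (simp add: algebra_simps)
      then show ?thesis by (simp add: cong_0_iff)
    qed
    have img: "f ` ratio_pairs p z M \<subseteq> {- int m..int m}"
    proof
      fix k assume "k \<in> f ` ratio_pairs p z M"
      then obtain u v where uv: "(u, v) \<in> ratio_pairs p z M" "k = (int u * b - int v * a) div int p" by (auto simp: f_def)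
      have "k * int p = int u * b - int v * a" using dvd[OF uv(1)] uv(2) by simp
      also have "\<bar>\<dots>\<bar> \<le> int u * \<bar>b\<bar> + int v * \<bar>a\<bar>"
        using abs_triangle_ineq4[of "int u * b" "int v * a"] by (simp add: abs_mult)
      also have "\<dots> \<le> int M * int s + int M * int s"
        using uv(1) ab by (intro add_mono mult_mono) (auto simp: ratio_pairs_def)
      finally have "\<bar>k\<bar> * int p \<le> int (2 * M * s)" by (simp add: abs_mult)
      then have "int (nat \<bar>k\<bar> * p) \<le> int (2 * M * s)" by simp
      then have "nat \<bar>k\<bar> * p \<le> 2 * M * s" by (simp only: of_nat_le_iff)
      then have "nat \<bar>k\<bar> \<le> m" unfolding m_def using p1 by (simp add: less_eq_div_iff_mult_less_eq)
      then show "k \<in> {- int m..int m}" by auto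
    qed
    \<comment> \<open>Two points on one line differ by an integral multiple of
      \<open>(a, b)\<close>, because \<open>a\<close> and \<open>b\<close> are coprime.\<close>
    have fib: "card {x \<in> ratio_pairs p z M. f x = k} \<le> 2 * (M div s) + 1" for k
    proof (cases "{x \<in> ratio_pairs p z M. f x = k} = {}")
      case False
      then obtain u0 v0 where uv0: "(u0, v0) \<in> ratio_pairs p z M" "f (u0, v0) = k" by auto
      let ?g = "\<lambda>c::int. (nat (int u0 + c * a), nat (int v0 + c * b))"
      have "{x \<in> ratio_pairs p z M. f x = k} \<subseteq> ?g ` {- int (M div s)..int (M div s)}"
      proof
        fix x assume "x \<in> {x \<in> ratio_pairs p z M. f x = k}"
        then obtain u v where x: "x = (u, v)" "(u, v) \<in> ratio_pairs p z M" "f (u, v) = k" by (cases x) auto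
        have "int u * b - int v * a = int u0 * b - int v0 * a"
          using dvd[OF x(2)] dvd[OF uv0(1)] x(3) uv0(2) unfolding f_def by (metis case_prod_conv dvd_div_mult_self)
        then have eq: "(int u - int u0) * b = (int v - int v0) * a" by (simp add: algebra_simps)
        then have "a dvd (int u - int u0) * b" by simp
        then have "a dvd int u - int u0" using cop by (simp add: coprime_dvd_mult_left_iff)
        then obtain c where c: "int u - int u0 = a * c" by (rule dvdE)
        then have c': "int v - int v0 = c * b" using eq a0 by (simp add: mult.assoc mult.left_commute)
        have bnd: "\<bar>int u - int u0\<bar> \<le> int M" "\<bar>int v - int v0\<bar> \<le> int M"
          using x(2) uv0(1) by (auto simp: ratio_pairs_def)
        have "\<bar>c\<bar> * int s \<le> int M"
        proof (cases "s = nat \<bar>a\<bar>")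
          case True
          then show ?thesis using bnd(1) by (simp add: c abs_mult mult.commute)
        next
          case False
          then have "s = nat \<bar>b\<bar>" using s_max by (simp add: max_def split: if_splits)
          then show ?thesis using bnd(2) by (simp add: c' abs_mult)
        qed
        then have "int (nat \<bar>c\<bar> * s) \<le> int M" by simp
        then have "nat \<bar>c\<bar> * s \<le> M" by (simp only: of_nat_le_iff)
        then have "nat \<bar>c\<bar> \<le> M div s" using s0 by (simp add: less_eq_div_iff_mult_less_eq)
        then have "c \<in> {- int (M div s)..int (M div s)}" by auto
        moreover have "x = ?g c" using c c' x(1) by (auto simp: mult.commute[of c a] eq_diff_eq algebra_simps)
        ultimately show "x \<in> ?g ` {- int (M div s)..int (M div s)}" by (rule rev_image_eqI)
      qed
      then have "card {x \<in> ratio_pairs p z M. f x = k} \<le> card {- int (M div s)..int (M div s)}"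
        by (intro surj_card_le) auto
      then show ?thesis by simp
    next
      case True
      then show ?thesis by (simp only: card.empty)
    qed
    have "card (ratio_pairs p z M) \<le> card {- int m..int m} * (2 * (M div s) + 1)"
      by (rule card_fibres_le[OF fin _ img fib]) simp
    also have "card {- int m..int m} = 2 * m + 1" by simp
    finally show ?thesis by (simp add: m_def)
  qed
  have div_le: "real (m div n) \<le> real m / real n" for m n :: nat
    using of_int_floor_le[of "real m / real n"] unfolding floor_divide_of_nat_eq by simp
  have "real (card (ratio_pairs p z M)) \<le> 8 * real M ^ 2 / real p + 7 * real M / real s"
  proof -
    have "real (card (ratio_pairs p z M)) \<le> real ((2 * (2 * M * s div p) + 1) * (2 * (M div s) + 1))"
      using count by (rule of_nat_mono)
    also have "\<dots> = (2 * real (2 * M * s div p) + 1) * (2 * real (M div s) + 1)"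
      by (simp only: of_nat_mult of_nat_add of_nat_1 of_nat_numeral)
    also have "\<dots> \<le> (2 * (real (2 * M * s) / real p) + 1) * (2 * (real M / real s) + 1)"
      by (intro mult_mono add_mono order.refl mult_left_mono div_le) auto
    also have "\<dots> = 8 * real M ^ 2 / real p + 4 * (real M * real s / real p) + 2 * (real M / real s) + 1"
    proof -
      define x y where "x = real (2 * M * s) / real p" and "y = real M / real s"
      have "(2 * x + 1) * (2 * y + 1) = 4 * (x * y) + 2 * x + 2 * y + 1" by (simp add: algebra_simps)
      moreover have "x * y = 2 * real M ^ 2 / real p" using s0 by (simp add: x_def y_def power2_eq_square)
      moreover have "x = 2 * (real M * real s / real p)" by (simp add: x_def)
      ultimately show ?thesis by (simp add: y_def flip: x_def)
    qed
    \<comment> \<open>As \<open>s^2 \<le> p\<close> and \<open>s \<le> M\<close>, the term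
      \<open>M s / p\<close> and the 1 are both at most \<open>M / s\<close>; this gives the
      constant \<open>7 = 4 + 2 + 1\<close>.\<close>
    also have "\<dots> \<le> 8 * real M ^ 2 / real p + 4 * (real M / real s) + 2 * (real M / real s) + real M / real s"
    proof -
      have "real s * real s \<le> real p" using s2 by (simp add: power2_eq_square flip: of_nat_mult)
      then have "real M * (real s * real s) \<le> real M * real p" by (intro mult_left_mono) auto
      then have "real M * real s / real p \<le> real M / real s" using s0 p1 by (simp add: divide_simps mult_ac)
      moreover have "1 \<le> real M / real s" using sM s0 by simp
      ultimately show ?thesis by linarith
    qed
    finally show ?thesis by simp
  qed
  moreover have "s = max A B" using s_max by (simp add: A_def B_def)
  moreover have "A \<ge> 1" "B \<ge> 1" using a0 b0 by (auto simp: A_def B_def)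
  moreover have "coprime A B" using cop by (simp add: A_def B_def coprime_nat_abs_left_iff coprime_nat_abs_right_iff flip: coprime_int_iff)
  moreover have "[int A = \<sigma> * int B * z] (mod int p)"
  proof -
    have "[sgn a * a = sgn a * (b * z)] (mod int p)" by (rule cong_scalar_left[OF ab(2)])
    moreover have "sgn a * a = int A" by (cases "a \<ge> 0") (auto simp: A_def sgn_if)
    moreover have "sgn a * (b * z) = \<sigma> * int B * z"
    proof -
      have "sgn b * \<bar>b\<bar> = b" by (simp add: sgn_mult_abs)
      then show ?thesis by (simp add: \<sigma>_def B_def mult.assoc)
    qed
    ultimately show ?thesis by simp
  qed
  moreover have "\<sigma> = 1 \<or> \<sigma> = -1" using a0 b0 by (auto simp: \<sigma>_def sgn_if)
  ultimately show ?thesis using s2 by (intro that[of A B \<sigma>]) auto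
qed

section \<open>Few small fractions are powers of one residue\<close>

lemma power_2_card_prime_factors_le:
  assumes "n > (0::nat)"
  shows "2 ^ card (prime_factors n) \<le> card {d. d dvd n}"
proof -
  have prod_dvd: "\<Prod>Y dvd n" if "Y \<subseteq> prime_factors n" for Y
  proof -
    have "finite Y" using that finite_subset by auto
    then show ?thesis using that
    proof (induction Y rule: finite_induct)
      case (insert q Y)
      then have q: "prime q" "q dvd n" by (auto simp: in_prime_factors_iff)
      have "coprime q (\<Prod>Y)"
      proof (rule prod_coprime_right)
        fix y assume "y \<in> Y"
        then have "prime y" "y \<noteq> q" using insert by (auto simp: in_prime_factors_iff)
        then show "coprime q y" using q by (simp add: primes_coprime)
      qed
      then show ?case using insert q by (simp add: divides_mult)
    qed auto
  qed
  have dvd_iff: "q \<in> Y \<longleftrightarrow> q dvd \<Prod>Y" if Y: "Y \<subseteq> prime_factors n" and q: "prime q" for q Y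
  proof -
    have "finite Y" using Y finite_subset by auto
    show ?thesis
    proof
      assume "q \<in> Y"
      then show "q dvd \<Prod>Y" using \<open>finite Y\<close> by (intro dvd_prodI)
    next
      assume "q dvd \<Prod>Y"
      then obtain y where y: "y \<in> Y" "q dvd y" using q \<open>finite Y\<close> by (auto simp: prime_dvd_prod_iff)
      then have "prime y" using Y by (auto simp: in_prime_factors_iff)
      then show "q \<in> Y" using y q primes_dvd_imp_eq by blast
    qed
  qed
  have "inj_on (\<lambda>Y. \<Prod>Y) (Pow (prime_factors n))"
  proof (rule inj_onI)
    fix Y Z assume YZ: "Y \<in> Pow (prime_factors n)" "Z \<in> Pow (prime_factors n)" "\<Prod>Y = \<Prod>Z"
    have "q \<in> Y \<longleftrightarrow> q \<in> Z" if "prime q" for q using dvd_iff[of Y q] dvd_iff[of Z q] YZ that by auto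
    moreover have "prime q" if "q \<in> Y \<union> Z" for q using that YZ by (auto simp: in_prime_factors_iff)
    ultimately show "Y = Z" by blast
  qed
  then have "card (Pow (prime_factors n)) \<le> card {d. d dvd n}"
    using prod_dvd assms by (intro card_inj_on_le[of "\<lambda>Y. \<Prod>Y"]) auto
  then show ?thesis by (simp add: card_Pow)
qed

text \<open>A uniformly random \<open>Q\<close> separates \<open>A t\<close> from \<open>B t\<close> with probability \<open>2\<^bsup>-|A t|-|B t|\<^esup>\<close>.\<close>

lemma separating_subset_exists:
  assumes "finite J" "finite R" "\<And>t. t \<in> J \<Longrightarrow> A t \<subseteq> R" "\<And>t. t \<in> J \<Longrightarrow> B t \<subseteq> R"
    and disj: "\<And>t. t \<in> J \<Longrightarrow> A t \<inter> B t = {}"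
    and w: "\<And>t. t \<in> J \<Longrightarrow> 2 ^ card (A t) * 2 ^ card (B t) \<le> w"
  shows "\<exists>Q\<subseteq>R. card J \<le> w * card {t\<in>J. A t \<subseteq> Q \<and> B t \<inter> Q = {}}"
proof (rule ccontr)
  assume "\<not> ?thesis"
  then have less: "w * card {t\<in>J. A t \<subseteq> Q \<and> B t \<inter> Q = {}} < card J" if "Q \<in> Pow R" for Q
    using that by (meson PowD not_le)
  have cnt: "2 ^ card R \<le> w * card {Q\<in>Pow R. A t \<subseteq> Q \<and> B t \<inter> Q = {}}" if t: "t \<in> J" for t
  proof -
    let ?D = "R - A t - B t"
    have "inj_on (\<lambda>Y. A t \<union> Y) (Pow ?D)" by (auto intro!: inj_onI)
    moreover have "(\<lambda>Y. A t \<union> Y) ` Pow ?D \<subseteq> {Q\<in>Pow R. A t \<subseteq> Q \<and> B t \<inter> Q = {}}"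
      using assms(3)[OF t] disj[OF t] by auto
    ultimately have "card (Pow ?D) \<le> card {Q\<in>Pow R. A t \<subseteq> Q \<and> B t \<inter> Q = {}}"
      using assms(2) by (intro card_inj_on_le) auto
    then have D: "2 ^ card ?D \<le> card {Q\<in>Pow R. A t \<subseteq> Q \<and> B t \<inter> Q = {}}"
      using assms(2) by (simp add: card_Pow)
    have "R = ?D \<union> (A t \<union> B t)" using assms(3,4) t by auto
    then have "card R \<le> card ?D + card (A t \<union> B t)" by (metis card_Un_le)
    also have "card (A t \<union> B t) \<le> card (A t) + card (B t)" by (rule card_Un_le)
    finally have "(2::nat) ^ card R \<le> 2 ^ (card ?D + (card (A t) + card (B t)))" by (intro power_increasing) auto
    also have "\<dots> = (2 ^ card (A t) * 2 ^ card (B t)) * 2 ^ card ?D" by (simp add: power_add)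
    also have "\<dots> \<le> w * card {Q\<in>Pow R. A t \<subseteq> Q \<and> B t \<inter> Q = {}}"
      by (intro mult_le_mono w[OF t] D)
    finally show ?thesis .
  qed
  have "card J * 2 ^ card R = (\<Sum>t\<in>J. 2 ^ card R)" by simp
  also have "\<dots> \<le> (\<Sum>t\<in>J. w * card {Q\<in>Pow R. A t \<subseteq> Q \<and> B t \<inter> Q = {}})" by (intro sum_mono cnt)
  also have "\<dots> = w * (\<Sum>t\<in>J. \<Sum>Q\<in>Pow R. if A t \<subseteq> Q \<and> B t \<inter> Q = {} then 1 else 0)"
    using assms(2) by (simp add: sum_distrib_left sum.inter_filter[symmetric])
  also have "(\<Sum>t\<in>J. \<Sum>Q\<in>Pow R. if A t \<subseteq> Q \<and> B t \<inter> Q = {} then 1 else (0::nat)) =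
      (\<Sum>Q\<in>Pow R. \<Sum>t\<in>J. if A t \<subseteq> Q \<and> B t \<inter> Q = {} then 1 else 0)" by (rule sum.swap)
  also have "w * \<dots> = (\<Sum>Q\<in>Pow R. w * card {t\<in>J. A t \<subseteq> Q \<and> B t \<inter> Q = {}})"
    using assms(1) by (simp add: sum_distrib_left sum.inter_filter[symmetric])
  also have "\<dots> < (\<Sum>Q\<in>Pow R. card J)" by (rule sum_strict_mono) (use assms(2) less in auto)
  also have "\<dots> = card J * 2 ^ card R" using assms(2) by (simp add: card_Pow)
  finally show False by simp
qed

text \<open>Restricting to those \<open>t\<close> whose \<open>a t\<close> has its primes in a fixed set \<open>Q\<close> and whose \<open>b t\<close> has
  them outside \<open>Q\<close>, a product of \<open>k\<close> fractions \<open>a t / b t\<close> is still reduced. It is a power of \<open>h\<close>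
  up to sign, so it takes few values modulo \<open>p\<close>, hence few values as a fraction, and a reduced
  fraction factors in few ways.\<close>

lemma few_small_ratios:
  fixes a b :: "nat \<Rightarrow> nat" and \<sigma> :: "nat \<Rightarrow> int" and h :: int
  assumes p: "prime p" and k: "k \<ge> 1" and N: "N \<ge> 1" and J: "J \<subseteq> {..<N}"
    and inj: "\<And>s t. s < N \<Longrightarrow> t < N \<Longrightarrow> [h ^ s = h ^ t] (mod int p) \<Longrightarrow> s = t"
    and ab: "\<And>t. t \<in> J \<Longrightarrow> a t \<ge> 1" "\<And>t. t \<in> J \<Longrightarrow> b t \<ge> 1" "\<And>t. t \<in> J \<Longrightarrow> coprime (a t) (b t)"
    and \<sigma>: "\<And>t. t \<in> J \<Longrightarrow> \<sigma> t = 1 \<or> \<sigma> t = -1"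
    and cong: "\<And>t. t \<in> J \<Longrightarrow> [int (a t) = \<sigma> t * int (b t) * h ^ t] (mod int p)"
    and S: "\<And>t. t \<in> J \<Longrightarrow> a t \<le> S" "\<And>t. t \<in> J \<Longrightarrow> b t \<le> S" "S ^ (2 * k) < p"
    and Dv: "\<And>n. 1 \<le> n \<Longrightarrow> n < p \<Longrightarrow> card {d. d dvd n} \<le> Dv"
  shows "card J ^ k \<le> 2 * (k * N) * (2 * Dv ^ 4) ^ k"
proof (cases "J = {}")
  case True
  with k show ?thesis by (simp add: zero_power)
next
  case False
  then obtain t0 where t0: "t0 \<in> J" by auto
  have S1: "S \<ge> 1" using ab(1)[OF t0] S(1)[OF t0] by linarith
  have Spow: "S ^ i < p" if "i \<le> 2 * k" for i
    using power_increasing[OF that, of S] S1 S(3) by linarith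
  have finJ: "finite J" using J finite_subset by auto
  have Sp: "S < p" using Spow[of 1] k by simp
  define A where "A = (\<lambda>t. prime_factors (a t))"
  define B where "B = (\<lambda>t. prime_factors (b t))"
  \<comment> \<open>Each numerator and denominator has at most \<open>log2 Dv\<close> prime
    divisors, so the separation loses at most the factor \<open>Dv * Dv\<close>.\<close>
  have "\<exists>Q\<subseteq>{q. prime q \<and> q \<le> S}. card J \<le> (Dv * Dv) * card {t\<in>J. A t \<subseteq> Q \<and> B t \<inter> Q = {}}"
  proof (rule separating_subset_exists[OF finJ])
    show "finite {q::nat. prime q \<and> q \<le> S}" by (rule finite_subset[of _ "{..S}"]) auto
    fix t assume t: "t \<in> J"
    have le: "q \<le> n" if "q dvd n" "n \<ge> 1" for q n :: nat using that by (intro dvd_imp_le) auto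
    show "A t \<subseteq> {q. prime q \<and> q \<le> S}"
    proof
      fix q assume "q \<in> A t"
      then have "prime q" "q dvd a t" by (auto simp: A_def in_prime_factors_iff)
      then show "q \<in> {q. prime q \<and> q \<le> S}" using le[of q "a t"] ab(1)[OF t] S(1)[OF t] by auto
    qed
    show "B t \<subseteq> {q. prime q \<and> q \<le> S}"
    proof
      fix q assume "q \<in> B t"
      then have "prime q" "q dvd b t" by (auto simp: B_def in_prime_factors_iff)
      then show "q \<in> {q. prime q \<and> q \<le> S}" using le[of q "b t"] ab(2)[OF t] S(2)[OF t] by auto
    qed
    show "A t \<inter> B t = {}"
    proof (rule equals0I)
      fix q assume "q \<in> A t \<inter> B t"
      then have "prime q" "q dvd a t" "q dvd b t" by (auto simp: A_def B_def in_prime_factors_iff)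
      then show False using ab(3)[OF t] by (metis coprime_common_divisor not_prime_unit)
    qed
    have "2 ^ card (A t) \<le> Dv"
      using power_2_card_prime_factors_le[of "a t"] Dv[of "a t"] ab(1)[OF t] S(1)[OF t] Sp by (simp add: A_def)
    moreover have "2 ^ card (B t) \<le> Dv"
      using power_2_card_prime_factors_le[of "b t"] Dv[of "b t"] ab(2)[OF t] S(2)[OF t] Sp by (simp add: B_def)
    ultimately show "2 ^ card (A t) * 2 ^ card (B t) \<le> Dv * Dv" by (rule mult_le_mono)
  qed
  then obtain Q where Q: "card J \<le> (Dv * Dv) * card {t\<in>J. A t \<subseteq> Q \<and> B t \<inter> Q = {}}" by blast
  define J' where "J' = {t\<in>J. A t \<subseteq> Q \<and> B t \<inter> Q = {}}"
  have J'J: "t \<in> J" if "t \<in> J'" for t using that by (simp add: J'_def)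
  have finJ': "finite J'" using finJ by (simp add: J'_def)
  define P where "P = {..<k} \<rightarrow>\<^sub>E J'"
  have finP: "finite P" unfolding P_def using finJ' by (intro finite_PiE) auto
  have PJ': "\<tau> i \<in> J'" if "\<tau> \<in> P" "i < k" for \<tau> i
    using that PiE_mem[of \<tau> "{..<k}" "\<lambda>_. J'" i] by (simp add: P_def)
  have PJ: "\<tau> i \<in> J" if "\<tau> \<in> P" "i < k" for \<tau> i
    using PJ'[OF that] by (rule J'J)
  define U where "U = (\<lambda>\<tau>. \<Prod>i<k. a (\<tau> i))"
  define V where "V = (\<lambda>\<tau>. \<Prod>i<k. b (\<tau> i))"
  define sg where "sg = (\<lambda>\<tau>. \<Prod>i<k. \<sigma> (\<tau> i))"
  define tt where "tt = (\<lambda>\<tau>::nat \<Rightarrow> nat. \<Sum>i<k. \<tau> i)"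
  have U: "1 \<le> U \<tau>" "U \<tau> \<le> S ^ k" "1 \<le> V \<tau>" "V \<tau> \<le> S ^ k" if "\<tau> \<in> P" for \<tau>
  proof -
    have "(\<Prod>i<k. 1) \<le> U \<tau>" unfolding U_def
      by (rule prod_mono) (use ab(1) PJ[OF that] in simp)
    moreover have "(\<Prod>i<k. 1) \<le> V \<tau>" unfolding V_def
      by (rule prod_mono) (use ab(2) PJ[OF that] in simp)
    ultimately    show "1 \<le> U \<tau>" "1 \<le> V \<tau>" by simp_all
    have "U \<tau> \<le> (\<Prod>i<k. S)" unfolding U_def
      by (rule prod_mono) (use S(1) PJ[OF that] in simp)
    moreover have "V \<tau> \<le> (\<Prod>i<k. S)" unfolding V_def
      by (rule prod_mono) (use S(2) PJ[OF that] in simp)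
    ultimately show "U \<tau> \<le> S ^ k" "V \<tau> \<le> S ^ k" by simp_all
  qed
  \<comment> \<open>Primes of numerators lie in \<open>Q\<close> and primes of denominators outside,
    so even numerators and denominators of different tuples are coprime.\<close>
  have UV_cop: "coprime (U \<tau>) (V \<tau>')" if "\<tau> \<in> P" "\<tau>' \<in> P" for \<tau> \<tau>'
    unfolding U_def V_def
  proof (intro prod_coprime_left prod_coprime_right)
    fix i j assume ij: "i \<in> {..<k}" "j \<in> {..<k}"
    have i: "\<tau> i \<in> J'" "\<tau>' j \<in> J'" using ij that PJ' by auto
    then have AB: "A (\<tau> i) \<inter> B (\<tau>' j) = {}" by (auto simp: J'_def)
    show "coprime (a (\<tau> i)) (b (\<tau>' j))"
    proof (rule ccontr)
      assume "\<not> coprime (a (\<tau> i)) (b (\<tau>' j))"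
      then have "gcd (a (\<tau> i)) (b (\<tau>' j)) \<noteq> 1" unfolding coprime_iff_gcd_eq_1 .
      then obtain q where "prime q" "q dvd gcd (a (\<tau> i)) (b (\<tau>' j))" using prime_factor_nat by blast
      then have q: "prime q" "q dvd a (\<tau> i)" "q dvd b (\<tau>' j)" by simp_all
      moreover have "a (\<tau> i) \<noteq> 0" "b (\<tau>' j) \<noteq> 0" using ab(1)[OF J'J[OF i(1)]] ab(2)[OF J'J[OF i(2)]] by auto
      ultimately have "q \<in> A (\<tau> i) \<inter> B (\<tau>' j)" by (auto simp: A_def B_def in_prime_factors_iff)
      with AB show False by auto
    qed
  qed
  have UV_cong: "[int (U \<tau>) = sg \<tau> * int (V \<tau>) * h ^ tt \<tau>] (mod int p)" if "\<tau> \<in> P" for \<tau>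
  proof -
    have "[(\<Prod>i<k. int (a (\<tau> i))) = (\<Prod>i<k. \<sigma> (\<tau> i) * int (b (\<tau> i)) * h ^ \<tau> i)] (mod int p)"
      using PJ[OF that] by (intro cong_prod cong) auto
    then show ?thesis by (simp add: U_def V_def sg_def tt_def prod.distrib power_sum)
  qed
  \<comment> \<open>Sign and exponent sum fix the residue of the fraction. Cross products are at
    most \<open>S^(2k) < p\<close>, so congruent fractions are equal, and equal reduced fractions
    have the same terms.\<close>
  have UV_unique: "U \<tau> = U \<tau>' \<and> V \<tau> = V \<tau>'"
    if \<tau>: "\<tau> \<in> P" "\<tau>' \<in> P" "sg \<tau> = sg \<tau>'" "tt \<tau> = tt \<tau>'" for \<tau> \<tau>'
  proof -
    have "[int (U \<tau>) * int (V \<tau>') = (sg \<tau> * int (V \<tau>) * h ^ tt \<tau>) * int (V \<tau>')] (mod int p)"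
      by (rule cong_scalar_right[OF UV_cong[OF \<tau>(1)]])
    also have "(sg \<tau> * int (V \<tau>) * h ^ tt \<tau>) * int (V \<tau>') = (sg \<tau>' * int (V \<tau>') * h ^ tt \<tau>') * int (V \<tau>)"
      using \<tau> by (simp add: mult_ac)
    also have "[(sg \<tau>' * int (V \<tau>') * h ^ tt \<tau>') * int (V \<tau>) = int (U \<tau>') * int (V \<tau>)] (mod int p)"
      by (rule cong_scalar_right[OF cong_sym[OF UV_cong[OF \<tau>(2)]]])
    finally have c: "[U \<tau> * V \<tau>' = U \<tau>' * V \<tau>] (mod p)" by (simp flip: of_nat_mult add: cong_int_iff)
    have "U \<tau> * V \<tau>' \<le> S ^ k * S ^ k" "U \<tau>' * V \<tau> \<le> S ^ k * S ^ k"
      using U[OF \<tau>(1)] U[OF \<tau>(2)] by (auto intro!: mult_le_mono)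
    moreover have "S ^ k * S ^ k < p" using S(3) by (simp add: power_add[symmetric] mult_2)
    ultimately have "U \<tau> * V \<tau>' = U \<tau>' * V \<tau>" using c by (simp add: Cong.cong_def)
    then show ?thesis
      using coprime_crossproduct_nat[of "U \<tau>" "V \<tau>" "U \<tau>'" "V \<tau>'"] UV_cop[OF \<tau>(1,1)] UV_cop[OF \<tau>(2,2)]
      by simp
  qed
  define \<Phi> where "\<Phi> = (\<lambda>\<tau>. (U \<tau>, V \<tau>))"
  \<comment> \<open>Two signs and at most \<open>k * N\<close> exponent sums are possible.\<close>
  have card_image: "card (\<Phi> ` P) \<le> 2 * (k * N)"
  proof -
    define g where "g = (\<lambda>x. let \<tau> = inv_into P \<Phi> x in (sg \<tau>, tt \<tau>))"
    have inv: "inv_into P \<Phi> x \<in> P" "\<Phi> (inv_into P \<Phi> x) = x" if "x \<in> \<Phi> ` P" for x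
      using that by (simp_all add: inv_into_into f_inv_into_f)
    have "inj_on g (\<Phi> ` P)"
    proof (rule inj_onI)
      fix x y assume xy: "x \<in> \<Phi> ` P" "y \<in> \<Phi> ` P" "g x = g y"
      then have "\<Phi> (inv_into P \<Phi> x) = \<Phi> (inv_into P \<Phi> y)"
        using UV_unique[OF inv(1)[OF xy(1)] inv(1)[OF xy(2)]] by (simp add: g_def \<Phi>_def Let_def)
      then show "x = y" using inv xy by simp
    qed
    moreover have "g ` (\<Phi> ` P) \<subseteq> {1, -1} \<times> {..<k * N}"
    proof
      fix y assume "y \<in> g ` (\<Phi> ` P)"
      then obtain \<tau> where \<tau>: "\<tau> \<in> P" "y = (sg \<tau>, tt \<tau>)" using inv(1) by (auto simp: g_def Let_def)
      have "sg \<tau> \<in> {1, -1}"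
      proof -
        have "(\<Prod>i<n. \<sigma> (\<tau> i)) \<in> {1, -1}" if "n \<le> k" for n
          using that
        proof (induction n)
          case (Suc n)
          then have "\<sigma> (\<tau> n) = 1 \<or> \<sigma> (\<tau> n) = -1" using \<sigma> PJ[OF \<tau>(1), of n] by simp
          with Suc show ?case by auto
        qed auto
        then show ?thesis by (simp add: sg_def)
      qed
      moreover have "tt \<tau> < k * N"
      proof -
        have "tt \<tau> < (\<Sum>i<k. N)" unfolding tt_def
        proof (rule sum_strict_mono)
          show "{..<k} \<noteq> {}" using k by (auto simp: lessThan_empty_iff)
          show "\<tau> i < N" if "i \<in> {..<k}" for i using PJ[OF \<tau>(1), of i] that J by auto
        qed simp
        then show ?thesis by simp
      qed
      ultimately show "y \<in> {1, -1} \<times> {..<k * N}" using \<tau> by simp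
    qed
    ultimately have "card (\<Phi> ` P) \<le> card ({1, -1 :: int} \<times> {..<k * N})"
      by (intro card_inj_on_le[of g]) auto
    then show ?thesis by (simp add: card_cartesian_product)
  qed
  \<comment> \<open>Every \<open>a (\<tau> i)\<close> divides \<open>U\<close> and every
    \<open>b (\<tau> i)\<close> divides \<open>V\<close>; together with the sign they determine
    \<open>\<tau> i\<close>, since the powers of \<open>h\<close> are distinct.\<close>
  have card_fibre: "card {\<tau>\<in>P. \<Phi> \<tau> = x} \<le> (2 * Dv\<^sup>2) ^ k" if x: "x \<in> \<Phi> ` P" for x
  proof -
    obtain \<tau>0 where \<tau>0: "\<tau>0 \<in> P" "x = (U \<tau>0, V \<tau>0)" using x by (auto simp: \<Phi>_def)
    define T where "T = {t\<in>J. a t dvd U \<tau>0 \<and> b t dvd V \<tau>0}"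
    have finT: "finite T" using finJ by (simp add: T_def)
    have "{\<tau>\<in>P. \<Phi> \<tau> = x} \<subseteq> {..<k} \<rightarrow>\<^sub>E T"
    proof
      fix \<tau> assume "\<tau> \<in> {\<tau>\<in>P. \<Phi> \<tau> = x}"
      then have \<tau>: "\<tau> \<in> P" "U \<tau> = U \<tau>0" "V \<tau> = V \<tau>0" using \<tau>0 by (auto simp: \<Phi>_def)
      have "\<tau> i \<in> T" if "i < k" for i
      proof -
        have "a (\<tau> i) dvd U \<tau>" "b (\<tau> i) dvd V \<tau>" unfolding U_def V_def using that by (auto intro!: dvd_prodI)
        then show ?thesis using PJ[OF \<tau>(1) that] \<tau> by (simp add: T_def)
      qed
      then show "\<tau> \<in> {..<k} \<rightarrow>\<^sub>E T" using \<tau>(1) by (simp add: P_def PiE_iff)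
    qed
    then have "card {\<tau>\<in>P. \<Phi> \<tau> = x} \<le> card ({..<k} \<rightarrow>\<^sub>E T)"
      using finT by (intro card_mono finite_PiE) auto
    also have "\<dots> = card T ^ k" by (simp add: card_PiE)
    also have "card T \<le> 2 * Dv\<^sup>2"
    proof -
      let ?f = "\<lambda>t. (\<sigma> t, a t, b t)"
      have nz: "U \<tau>0 \<noteq> 0" "V \<tau>0 \<noteq> 0" using U[OF \<tau>0(1)] by auto
      have fin: "finite {d. d dvd U \<tau>0}" "finite {d. d dvd V \<tau>0}" using nz by auto
      have "inj_on ?f T"
      proof (rule inj_onI)
        fix s t assume st: "s \<in> T" "t \<in> T" "?f s = ?f t"
        then have sJ: "s \<in> J" and tJ: "t \<in> J" by (auto simp: T_def)
        have "[\<sigma> s * int (b s) * h ^ s = \<sigma> s * int (b s) * h ^ t] (mod int p)"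
          using cong[OF sJ] cong[OF tJ] st(3) by (metis cong_sym cong_trans prod.inject)
        moreover have "coprime (\<sigma> s * int (b s)) (int p)"
        proof -
          have "\<not> p dvd b s" using ab(2)[OF sJ] S(2)[OF sJ] Sp by (auto dest: dvd_imp_le)
          then have "coprime (int (b s)) (int p)" using p
            by (metis coprime_commute coprime_int_iff prime_imp_coprime_nat)
          then show ?thesis using \<sigma>[OF sJ] by auto
        qed
        ultimately have "[h ^ s = h ^ t] (mod int p)" by (simp add: cong_mult_lcancel)
        then show "s = t" using inj sJ tJ J by auto
      qed
      moreover have "?f ` T \<subseteq> {1, -1} \<times> {d. d dvd U \<tau>0} \<times> {d. d dvd V \<tau>0}"
        using \<sigma> by (auto simp: T_def)
      ultimately have "card T \<le> card ({1, -1 :: int} \<times> {d. d dvd U \<tau>0} \<times> {d. d dvd V \<tau>0})"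
        using fin by (intro card_inj_on_le[of ?f]) auto
      also have "\<dots> = 2 * (card {d. d dvd U \<tau>0} * card {d. d dvd V \<tau>0})" by (simp add: card_cartesian_product)
      also have "\<dots> \<le> 2 * (Dv * Dv)"
        using U[OF \<tau>0(1)] Spow[of k] by (intro mult_le_mono le_refl Dv) auto
      finally show ?thesis by (simp add: power2_eq_square)
    qed
    then have "card T ^ k \<le> (2 * Dv\<^sup>2) ^ k" by (rule power_mono) simp
    finally show ?thesis .
  qed
  have "card J' ^ k = card P" by (simp add: P_def card_PiE)
  also have "\<dots> \<le> card (\<Phi> ` P) * (2 * Dv\<^sup>2) ^ k"
    by (rule card_fibres_le[where f = \<Phi>]) (use finP card_fibre in auto)
  also have "\<dots> \<le> 2 * (k * N) * (2 * Dv\<^sup>2) ^ k" using card_image by (rule mult_right_mono) simp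
  finally have 1: "card J' ^ k \<le> 2 * (k * N) * (2 * Dv\<^sup>2) ^ k" .
  \<comment> \<open>Of the four factors \<open>Dv\<close> per index, two come from the separation
    and two from the divisors of \<open>U\<close> and \<open>V\<close>.\<close>
  have "card J ^ k \<le> (Dv * Dv * card J') ^ k" using Q unfolding J'_def by (rule power_mono) simp
  also have "\<dots> = (Dv * Dv) ^ k * card J' ^ k" by (rule power_mult_distrib)
  also have "\<dots> \<le> (Dv * Dv) ^ k * (2 * (k * N) * (2 * Dv\<^sup>2) ^ k)" using 1 by (rule mult_left_mono) simp
  also have "\<dots> = 2 * (k * N) * ((Dv * Dv) ^ k * (2 * Dv\<^sup>2) ^ k)" by (simp only: mult_ac)
  also have "(Dv * Dv) ^ k * (2 * Dv\<^sup>2) ^ k = (2 * Dv ^ 4) ^ k"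
  proof -
    have "Dv * Dv * (2 * Dv\<^sup>2) = 2 * Dv ^ 4" by (simp add: power2_eq_square power4_eq_xxxx)
    then show ?thesis by (simp only: power_mult_distrib[symmetric])
  qed
  finally show ?thesis .
qed

section \<open>Collisions among products\<close>

lemma short_divisor_bound:
  assumes "\<eta> > 0"
  obtains C :: real where "C \<ge> 1"
    "\<And>p n::nat. 1 \<le> n \<Longrightarrow> n \<le> p \<Longrightarrow> card {d. d dvd n} \<le> nat \<lfloor>C * real p powr \<eta>\<rfloor>"
    "\<And>p. real (nat \<lfloor>C * real p powr \<eta>\<rfloor>) \<le> C * real p powr \<eta>"
proof -
  obtain C :: real where C: "C \<ge> 1" "\<And>n::nat. n > 0 \<Longrightarrow> real (card {d. d dvd n}) \<le> C * real n powr \<eta>"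
    using divisor_bound[OF assms] by auto
  show ?thesis
  proof (rule that[OF C(1)])
    fix p n :: nat assume n: "1 \<le> n" "n \<le> p"
    have "C * real n powr \<eta> \<le> C * real p powr \<eta>"
      using n C(1) assms by (intro mult_left_mono powr_mono2) auto
    then have "real (card {d. d dvd n}) \<le> C * real p powr \<eta>" using C(2)[of n] n by linarith
    then show "card {d. d dvd n} \<le> nat \<lfloor>C * real p powr \<eta>\<rfloor>" by (simp add: le_nat_iff le_floor_iff)
  next
    fix p show "real (nat \<lfloor>C * real p powr \<eta>\<rfloor>) \<le> C * real p powr \<eta>" using C(1) by simp
  qed
qed

definition distinct_powers :: "nat \<Rightarrow> int \<Rightarrow> nat \<Rightarrow> bool" where
  "distinct_powers p h N \<longleftrightarrow> (\<forall>s<N. \<forall>t<N. [h ^ s = h ^ t] (mod int p) \<longrightarrow> s = t)"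

definition reduced_ratios :: "nat \<Rightarrow> int \<Rightarrow> nat \<Rightarrow> (nat \<Rightarrow> nat) \<Rightarrow> (nat \<Rightarrow> nat) \<Rightarrow> bool" where
  "reduced_ratios p h N a b \<longleftrightarrow> (\<forall>t<N. a t \<ge> 1 \<and> b t \<ge> 1 \<and> coprime (a t) (b t) \<and>
     (\<exists>\<sigma>. (\<sigma> = 1 \<or> \<sigma> = -1) \<and> [int (a t) = \<sigma> * int (b t) * h ^ t] (mod int p)))"

text \<open>The scale \<open>x k\<close>, about \<open>p^(1/(2k))\<close>, is the largest for which
  \<open>2k\<close>-fold products stay below \<open>p\<close>. Up to divisor functions, at most
  \<open>p^(1/(4k))\<close> exponents lie between \<open>x (k + 1)\<close> and \<open>x k\<close>,
  and each contributes at most about \<open>p^(-1/(2k+2))\<close>, which balances for all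
  \<open>k \<ge> 1\<close>. Beyond \<open>x 1\<close> the trivial count \<open>N\<close> suffices;
  below \<open>x (K + 1)\<close> there are too few exponents to matter.\<close>

lemma sum_inverse_ratios_bound:
  fixes \<epsilon> :: real
  assumes \<epsilon>: "\<epsilon> > 0"
  shows "eventually (\<lambda>p. \<forall>h N a b. prime p \<longrightarrow> N \<ge> 1 \<longrightarrow> real N \<le> 2 * real p powr (1/4) \<longrightarrow>
     distinct_powers p h N \<longrightarrow> reduced_ratios p h N a b \<longrightarrow>
     (\<Sum>t<N. 1 / real (max (a t) (b t))) \<le> real p powr \<epsilon>) sequentially"
proof -
  obtain C :: real where C: "C \<ge> 1"
    "\<And>p n::nat. 1 \<le> n \<Longrightarrow> n \<le> p \<Longrightarrow> card {d. d dvd n} \<le> nat \<lfloor>C * real p powr (\<epsilon>/16)\<rfloor>"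
    "\<And>p. real (nat \<lfloor>C * real p powr (\<epsilon>/16)\<rfloor>) \<le> C * real p powr (\<epsilon>/16)"
    using short_divisor_bound[of "\<epsilon>/16"] \<epsilon> by auto
  define K where "K = nat \<lceil>1 / \<epsilon>\<rceil>"
  have K: "real K \<ge> 1 / \<epsilon>" unfolding K_def by (rule real_nat_ceiling_ge)
  have K_eps: "1 / (4 * real (K + 1)) \<le> \<epsilon> / 4"
  proof -
    have "1 / real (K + 1) \<le> 1 / (1 / \<epsilon>)" using K \<epsilon> by (intro divide_left_mono) auto
    then have "1 / real (K + 1) \<le> \<epsilon>" by simp
    then have "1 / real (K + 1) / 4 \<le> \<epsilon> / 4" by (rule divide_right_mono) simp
    then show ?thesis by (simp only: divide_divide_eq_left mult.commute)
  qed
  define C3 where "C3 = (4 + 16 * real K ^ 2 + 8 * real (K + 1)) * C ^ 4"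
  have "eventually (\<lambda>p. C3 \<le> real p powr (\<epsilon>/2)) sequentially" using \<epsilon> by (intro eventually_le_powr) auto
  then show ?thesis
  proof eventually_elim
    case (elim p)
    show ?case
    proof (intro allI impI)
      fix h :: int and N :: nat and a b :: "nat \<Rightarrow> nat"
      assume p: "prime p" and N1: "N \<ge> 1" and N: "real N \<le> 2 * real p powr (1/4)"
        and inj: "distinct_powers p h N" and rr: "reduced_ratios p h N a b"
      define P where "P = real p"
      have P1: "P > 1" using prime_gt_1_nat[OF p] by (simp add: P_def)
      define s where "s = (\<lambda>t. max (a t) (b t))"
      define Dv where "Dv = nat \<lfloor>C * P powr (\<epsilon>/16)\<rfloor>"
      have Dv: "card {d. d dvd n} \<le> Dv" if "1 \<le> n" "n < p" for n :: nat
        using C(2)[of n p] that by (simp add: Dv_def P_def)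
      have Dv4: "real Dv ^ 4 \<le> C ^ 4 * P powr (\<epsilon>/4)"
      proof -
        have "real Dv ^ 4 \<le> (C * P powr (\<epsilon>/16)) ^ 4" using C(3)[of p] by (intro power_mono) (auto simp: Dv_def P_def)
        also have "\<dots> = C ^ 4 * P powr (\<epsilon>/4)" using P1 by (simp add: power_mult_distrib powr_power)
        finally show ?thesis .
      qed
      \<comment> \<open>The factor 1/2 makes \<open>x k ^ (2 * k)\<close> strictly smaller than
        \<open>p\<close>.\<close>
      define x where "x = (\<lambda>k. P powr (1 / real (2 * k)) / 2)"
      have x0: "x k > 0" for k using P1 by (simp add: x_def)
      define J where "J = (\<lambda>k. {t\<in>{..<N}. real (s t) \<le> x k})"
      obtain \<sigma> where \<sigma>: "\<And>t. t < N \<Longrightarrow> (\<sigma> t = 1 \<or> \<sigma> t = -1) \<and> [int (a t) = \<sigma> t * int (b t) * h ^ t] (mod int p)"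
        using rr unfolding reduced_ratios_def by metis
      have ab: "a t \<ge> 1" "b t \<ge> 1" "coprime (a t) (b t)" if "t < N" for t
        using rr that by (auto simp: reduced_ratios_def)
      have s1: "s t \<ge> 1" if "t < N" for t using ab(1)[OF that] by (simp add: s_def)
      have card_J: "real (card (J k)) \<le> 8 * real k * real Dv ^ 4 * P powr (1 / (4 * real k))" if k: "k \<ge> 1" for k
      proof -
        define S where "S = nat \<lfloor>x k\<rfloor>"
        have S_le: "real S \<le> x k" using x0[of k] by (simp add: S_def)
        have "S ^ (2 * k) < p"
        proof -
          have "real S ^ (2 * k) \<le> x k ^ (2 * k)" using S_le by (intro power_mono) auto
          also have "\<dots> = P / 2 ^ (2 * k)" using k P1 by (simp add: x_def power_divide powr_power)
          also have "\<dots> < P / 1" using P1 k by (intro divide_strict_left_mono one_less_power) auto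
          finally have "real (S ^ (2 * k)) < real p" by (simp add: P_def)
          then show ?thesis by (simp only: of_nat_less_iff)
        qed
        moreover have "a t \<le> S" "b t \<le> S" if "t \<in> J k" for t
          using that by (auto simp: J_def S_def s_def le_nat_iff le_floor_iff)
        ultimately have "card (J k) ^ k \<le> 2 * (k * N) * (2 * Dv ^ 4) ^ k"
          using inj ab \<sigma> Dv unfolding distinct_powers_def
          by (intro few_small_ratios[OF p k N1, where h = h and a = a and b = b and \<sigma> = \<sigma> and S = S]) (auto simp: J_def)
        then have "real (card (J k) ^ k) \<le> real (2 * (k * N) * (2 * Dv ^ 4) ^ k)" by (rule of_nat_mono)
        then have "real (card (J k)) ^ k \<le> 2 * real k * real N * (2 * real Dv ^ 4) ^ k" by simp
        also have "\<dots> \<le> 2 * real k * (2 * P powr (1/4)) * (2 * real Dv ^ 4) ^ k"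
          using N by (intro mult_right_mono mult_left_mono) (auto simp: P_def)
        also have "\<dots> = (4 * real k) * P powr (1/4) * (2 * real Dv ^ 4) ^ k" by simp
        also have "\<dots> \<le> (4 * real k) ^ k * (P powr (1 / (4 * real k))) ^ k * (2 * real Dv ^ 4) ^ k"
        proof (intro mult_right_mono mult_mono)
          show "4 * real k \<le> (4 * real k) ^ k" using k by (intro self_le_power) auto
          show "P powr (1/4) \<le> (P powr (1 / (4 * real k))) ^ k" using k P1 by (simp add: powr_power)
        qed auto
        also have "\<dots> = (4 * real k * P powr (1 / (4 * real k)) * (2 * real Dv ^ 4)) ^ k"
          by (simp only: power_mult_distrib)
        finally have "real (card (J k)) \<le> 4 * real k * P powr (1 / (4 * real k)) * (2 * real Dv ^ 4)"
          using k power_mono_iff[of "real (card (J k))" "4 * real k * P powr (1 / (4 * real k)) * (2 * real Dv ^ 4)" k] by simp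
        then show ?thesis by (simp add: mult_ac)
      qed
      have pointwise: "1 / real (s t) \<le> 2 / sqrt P + (\<Sum>k=1..K. if t \<in> J k then 1 / x (k + 1) else 0) + (if t \<in> J (K + 1) then 1 else 0)"
        if t: "t < N" for t
      proof (cases "t \<in> J (K + 1)")
        case True
        have "1 / real (s t) \<le> 1" using s1[OF t] by simp
        moreover have "(\<Sum>k=1..K. if t \<in> J k then 1 / x (k + 1) else 0) \<ge> 0" using x0 by (intro sum_nonneg) (auto simp: less_imp_le)
        moreover have "2 / sqrt P \<ge> 0" using P1 by simp
        ultimately have "1 / real (s t) \<le> 2 / sqrt P + (\<Sum>k=1..K. if t \<in> J k then 1 / x (k + 1) else 0) + 1" by linarith
        then show ?thesis by (simp only: True if_True)
      next
        case False
        \<comment> \<open>\<open>k0\<close> is the first scale that \<open>s t\<close> exceeds. The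
          term of level \<open>k0 - 1\<close> then covers \<open>1 / s t\<close>, or
          \<open>2 / sqrt P\<close> does so if \<open>k0 = 1\<close>.\<close>
        define k0 where "k0 = (LEAST k. k \<ge> 1 \<and> t \<notin> J k)"
        have k0: "k0 \<ge> 1 \<and> t \<notin> J k0" unfolding k0_def by (rule LeastI[of _ "K + 1"]) (use False in simp)
        have k0_le: "k0 \<le> K + 1" unfolding k0_def by (rule Least_le) (use False in simp)
        have k0_min: "t \<in> J k" if "1 \<le> k" "k < k0" for k using not_less_Least[of k "\<lambda>k. k \<ge> 1 \<and> t \<notin> J k"] that by (auto simp: k0_def)
        have big: "1 / real (s t) \<le> 1 / x k0"
          using k0 t x0[of k0] s1[OF t] by (intro divide_left_mono) (auto simp: J_def)
        show ?thesis
        proof (cases "k0 = 1")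
          case True
          have "1 / x k0 = 2 / sqrt P" using P1 by (simp add: True x_def powr_half_sqrt)
          moreover have "(\<Sum>k=1..K. if t \<in> J k then 1 / x (k + 1) else 0) \<ge> 0" using x0 by (intro sum_nonneg) (auto simp: less_imp_le)
          ultimately have "1 / real (s t) \<le> 2 / sqrt P + (\<Sum>k=1..K. if t \<in> J k then 1 / x (k + 1) else 0) + 0"
            using big by linarith
          then show ?thesis by (simp only: False if_False)
        next
          case f: False
          then have k1: "1 \<le> k0 - 1" "k0 - 1 \<le> K" "k0 - 1 < k0" using k0 k0_le by auto
          have "(if t \<in> J (k0 - 1) then 1 / x (k0 - 1 + 1) else 0) \<le> (\<Sum>k=1..K. if t \<in> J k then 1 / x (k + 1) else 0)"
            using x0 k1 by (intro member_le_sum) (auto simp: less_imp_le)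
          then have "1 / x k0 \<le> (\<Sum>k=1..K. if t \<in> J k then 1 / x (k + 1) else 0)"
            using k0_min[OF k1(1,3)] k1 by simp
          moreover have "2 / sqrt P \<ge> 0" using P1 by simp
          ultimately have "1 / real (s t) \<le> 2 / sqrt P + (\<Sum>k=1..K. if t \<in> J k then 1 / x (k + 1) else 0) + 0"
            using big by linarith
          then show ?thesis by (simp only: False if_False)
        qed
      qed
      have ind: "(\<Sum>t<N. if t \<in> J k then c else 0) = real (card (J k)) * c" for k and c :: real
      proof -
        have "(\<Sum>t<N. if t \<in> J k then c else 0) = (\<Sum>t\<in>{t\<in>{..<N}. t \<in> J k}. c)" by (simp only: sum.inter_filter finite_lessThan)
        also have "{t\<in>{..<N}. t \<in> J k} = J k" by (auto simp: J_def)
        finally show ?thesis by simp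
      qed
      have "(\<Sum>t<N. 1 / real (s t)) \<le> (\<Sum>t<N. 2 / sqrt P + (\<Sum>k=1..K. if t \<in> J k then 1 / x (k + 1) else 0) + (if t \<in> J (K + 1) then 1 else 0))"
        by (intro sum_mono pointwise) simp
      also have "\<dots> = real N * (2 / sqrt P) + (\<Sum>k=1..K. real (card (J k)) * (1 / x (k + 1))) + real (card (J (K + 1))) * 1"
        unfolding sum.distrib ind by (subst sum.swap) (simp only: ind sum_constant card_lessThan)
      also have "\<dots> \<le> 4 + (\<Sum>k=1..K. 16 * real K * real Dv ^ 4) + 8 * real (K + 1) * real Dv ^ 4 * P powr (\<epsilon>/4)"
      proof (intro add_mono sum_mono)
        have "real N * (2 / sqrt P) \<le> 2 * P powr (1/4) * (2 / sqrt P)" using N P1 by (intro mult_right_mono) (auto simp: P_def)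
        also have "\<dots> = 4 * (P powr (1/4) / P powr (1/2))" using P1 by (simp add: powr_half_sqrt)
        also have "P powr (1/4) / P powr (1/2) \<le> 1" using P1 by (simp add: powr_mono)
        finally show "real N * (2 / sqrt P) \<le> 4" by simp
      next
        fix k assume k: "k \<in> {1..K}"
        have "real (card (J k)) * (1 / x (k + 1)) \<le> (8 * real k * real Dv ^ 4 * P powr (1 / (4 * real k))) * (1 / x (k + 1))"
          using k x0[of "k + 1"] by (intro mult_right_mono card_J) auto
        also have "\<dots> = 16 * real k * real Dv ^ 4 * (P powr (1 / (4 * real k)) / P powr (1 / real (2 * (k + 1))))" by (simp add: x_def)
        also have "\<dots> \<le> 16 * real K * real Dv ^ 4 * 1"
        proof (intro mult_mono)
          have "1 / (4 * real k) \<le> 1 / real (2 * (k + 1))" using k by (intro divide_left_mono) auto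
          then show "P powr (1 / (4 * real k)) / P powr (1 / real (2 * (k + 1))) \<le> 1" using P1 by (simp add: powr_mono)
        qed (use k in auto)
        finally show "real (card (J k)) * (1 / x (k + 1)) \<le> 16 * real K * real Dv ^ 4" by simp
      next
        have "real (card (J (K + 1))) \<le> 8 * real (K + 1) * real Dv ^ 4 * P powr (1 / (4 * real (K + 1)))" by (rule card_J) simp
        also have "\<dots> \<le> 8 * real (K + 1) * real Dv ^ 4 * P powr (\<epsilon>/4)"
          using K_eps P1 by (intro mult_left_mono powr_mono) auto
        finally show "real (card (J (K + 1))) * 1 \<le> 8 * real (K + 1) * real Dv ^ 4 * P powr (\<epsilon>/4)" by simp
      qed
      also have "\<dots> = 4 + (16 * real K ^ 2) * real Dv ^ 4 + 8 * real (K + 1) * (real Dv ^ 4 * P powr (\<epsilon>/4))"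
        by (simp add: power2_eq_square)
      also have "\<dots> \<le> C3 * P powr (\<epsilon>/2)"
      proof -
        have e1: "P powr (\<epsilon>/4) \<ge> 1" "P powr (\<epsilon>/2) \<ge> 1" using P1 \<epsilon> by (auto intro: ge_one_powr_ge_zero)
        have C4: "C ^ 4 \<ge> 1" using C(1) by (rule one_le_power)
        have pp: "P powr (\<epsilon>/4) * P powr (\<epsilon>/4) = P powr (\<epsilon>/2)" by (simp add: powr_add[symmetric])
        have "1 * 1 \<le> C ^ 4 * P powr (\<epsilon>/2)" using C4 e1 by (intro mult_mono) auto
        moreover have d1: "real Dv ^ 4 * P powr (\<epsilon>/4) \<le> C ^ 4 * P powr (\<epsilon>/2)"
          using mult_right_mono[OF Dv4, of "P powr (\<epsilon>/4)"] pp by (simp add: mult.assoc)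
        moreover have "real Dv ^ 4 * 1 \<le> real Dv ^ 4 * P powr (\<epsilon>/4)" using e1 by (intro mult_left_mono) auto
        ultimately have "4 + (16 * real K ^ 2) * real Dv ^ 4 + 8 * real (K + 1) * (real Dv ^ 4 * P powr (\<epsilon>/4))
          \<le> 4 * (C ^ 4 * P powr (\<epsilon>/2)) + (16 * real K ^ 2) * (C ^ 4 * P powr (\<epsilon>/2)) + 8 * real (K + 1) * (C ^ 4 * P powr (\<epsilon>/2))"
          by (intro add_mono mult_left_mono) auto
        also have "\<dots> = C3 * P powr (\<epsilon>/2)" by (simp only: C3_def distrib_right mult.assoc)
        finally show ?thesis .
      qed
      also have "\<dots> \<le> P powr (\<epsilon>/2) * P powr (\<epsilon>/2)" using elim by (intro mult_right_mono) (auto simp: P_def)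
      also have "\<dots> = P powr \<epsilon>" by (simp add: powr_add[symmetric])
      finally show "(\<Sum>t<N. 1 / real (max (a t) (b t))) \<le> real p powr \<epsilon>" by (simp add: s_def P_def)
    qed
  qed
qed

section \<open>Counting the collisions\<close>

definition triple_power_collisions :: "nat \<Rightarrow> int \<Rightarrow> nat \<Rightarrow> nat \<Rightarrow> (((nat \<times> nat \<times> nat) \<times> nat) \<times> ((nat \<times> nat \<times> nat) \<times> nat)) set" where
  "triple_power_collisions p h B N = {(((x, y, z), i), ((x', y', z'), j)).
     ((x, y, z), i) \<in> ({1..B} \<times> {1..B} \<times> {1..B}) \<times> {..<N} \<and> ((x', y', z'), j) \<in> ({1..B} \<times> {1..B} \<times> {1..B}) \<times> {..<N} \<and>
     [int (x * y * z) * h ^ i = int (x' * y' * z') * h ^ j] (mod int p)}"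

lemma card_triples_with_product:
  assumes "u \<ge> 1" "card {d. d dvd u} \<le> Dv"
  shows "card {(x, y, z). x * y * z = (u::nat)} \<le> Dv\<^sup>2" "finite {(x, y, z). x * y * z = (u::nat)}"
proof -
  let ?D = "{d. d dvd u}"
  have finD: "finite ?D" using assms(1) by simp
  have sub: "{(x, y, z). x * y * z = u} \<subseteq> (\<lambda>(x, y). (x, y, u div (x * y))) ` (?D \<times> ?D)"
  proof
    fix q assume "q \<in> {(x, y, z). x * y * z = u}"
    then obtain x y z where q: "q = (x, y, z)" "x * y * z = u" by auto
    then have "x * y > 0" using assms(1) by auto
    then have "z = u div (x * y)" using q(2) by auto
    moreover have "x dvd u" "y dvd u" using q(2) by auto
    ultimately show "q \<in> (\<lambda>(x, y). (x, y, u div (x * y))) ` (?D \<times> ?D)" using q(1) by force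
  qed
  show "finite {(x, y, z). x * y * z = u}" by (rule finite_subset[OF sub]) (use finD in simp)
  have "card {(x, y, z). x * y * z = u} \<le> card (?D \<times> ?D)"
    using finD by (intro surj_card_le[OF _ sub]) simp
  also have "\<dots> \<le> Dv * Dv" using assms(2) by (simp add: card_cartesian_product mult_le_mono)
  finally show "card {(x, y, z). x * y * z = u} \<le> Dv\<^sup>2" by (simp add: power2_eq_square)
qed

text \<open>Triples are replaced by their products, which are less than \<open>p\<close> and have at
  most \<open>Dv^2\<close> representations each. After that only the difference of the two exponents
  matters, and every difference arises from at most \<open>2 * N\<close> pairs.\<close>

lemma card_triple_power_collisions_le:
  assumes p: "prime p" and h: "\<not> int p dvd h" and B: "B ^ 3 < p"
    and Dv: "\<And>n. 1 \<le> n \<Longrightarrow> n \<le> p \<Longrightarrow> card {d. d dvd n} \<le> Dv"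
  shows "card (triple_power_collisions p h B N) \<le> 2 * N * (\<Sum>t<N. card (ratio_pairs p (h ^ t) (B ^ 3))) * Dv ^ 4"
proof -
  let ?M = "B ^ 3"
  define E where "E = triple_power_collisions p h B N"
  define G where "G = {((u, i), (v, j)). u \<in> {1..?M} \<and> v \<in> {1..?M} \<and> i < N \<and> j < N \<and>
     [int u * h ^ i = int v * h ^ j] (mod int p)}"
  define f where "f = (\<lambda>(((x, y, z), i::nat), ((x', y', z'), j::nat)). ((x * y * z :: nat, i), (x' * y' * z' :: nat, j)))"
  have finG: "finite G"
    by (rule finite_subset[of _ "({1..?M} \<times> {..<N}) \<times> ({1..?M} \<times> {..<N})"]) (auto simp: G_def)
  have finE: "finite E"
    by (rule finite_subset[of _ "(({1..B} \<times> {1..B} \<times> {1..B}) \<times> {..<N}) \<times> (({1..B} \<times> {1..B} \<times> {1..B}) \<times> {..<N})"])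
       (auto simp: E_def triple_power_collisions_def)
  have prod_range: "x * y * z \<in> {1..?M}" if "x \<in> {1..B}" "y \<in> {1..B}" "z \<in> {1..B}" for x y z
  proof -
    have "x * y * z \<le> B * B * B" using that by (intro mult_le_mono) auto
    then show ?thesis using that by (simp add: power3_eq_cube)
  qed
  have img: "f ` E \<subseteq> G"
    using prod_range by (auto simp: E_def triple_power_collisions_def f_def G_def)
  have fib: "card {e\<in>E. f e = k} \<le> Dv ^ 4" if k: "k \<in> G" for k
  proof -
    obtain u i v j where k: "k = ((u, i), (v, j))" "u \<in> {1..?M}" "v \<in> {1..?M}" using k by (auto simp: G_def)
    let ?T = "\<lambda>u. {(x, y, z). x * y * z = (u::nat)}"
    have Tu: "card (?T u) \<le> Dv\<^sup>2" "finite (?T u)" "card (?T v) \<le> Dv\<^sup>2" "finite (?T v)"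
      using card_triples_with_product[of u Dv] card_triples_with_product[of v Dv] Dv[of u] Dv[of v] k B by auto
    have "{e\<in>E. f e = k} \<subseteq> (\<lambda>(q, q'). ((q, i), (q', j))) ` (?T u \<times> ?T v)"
    proof
      fix e assume "e \<in> {e\<in>E. f e = k}"
      then have "f e = k" by simp
      moreover obtain x y z i' x' y' z' j' where e: "e = (((x, y, z), i'), ((x', y', z'), j'))" by (metis surj_pair)
      ultimately have "(x, y, z) \<in> ?T u" "(x', y', z') \<in> ?T v" "i' = i" "j' = j" by (auto simp: f_def k)
      then show "e \<in> (\<lambda>(q, q'). ((q, i), (q', j))) ` (?T u \<times> ?T v)"
        unfolding e by (intro image_eqI[of _ _ "((x, y, z), (x', y', z'))"]) auto
    qed
    then have "card {e\<in>E. f e = k} \<le> card (?T u \<times> ?T v)" using Tu by (intro surj_card_le) auto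
    also have "\<dots> \<le> Dv\<^sup>2 * Dv\<^sup>2" using Tu by (simp only: card_cartesian_product mult_le_mono)
    also have "\<dots> = Dv ^ 4" by (simp add: power_add[symmetric])
    finally show ?thesis .
  qed
  have EG: "card E \<le> card G * Dv ^ 4" by (rule card_fibres_le[OF finE finG img fib])
  define L where "L = (\<lambda>t. card (ratio_pairs p (h ^ t) ?M))"
  have G_le: "card G \<le> 2 * N * (\<Sum>t<N. L t)"
  proof -
    have cancel: "[x = y * h ^ (j - i)] (mod int p)" if "[x * h ^ i = y * h ^ j] (mod int p)" "i \<le> j" for x y :: int and i j
    proof -
      have "[x * h ^ i = (y * h ^ (j - i)) * h ^ i] (mod int p)" using that by (simp add: mult.assoc power_add[symmetric])
      moreover have "coprime (h ^ i) (int p)"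
        using p h by (metis coprime_commute coprime_power_right_iff prime_imp_coprime prime_nat_int_transfer coprime_power_left_iff)
      ultimately show ?thesis by (simp add: cong_mult_rcancel)
    qed
    have finR: "finite (ratio_pairs p z M)" for z M
      by (rule finite_subset[of _ "{1..M} \<times> {1..M}"]) (auto simp: ratio_pairs_def)
    have fibG: "card {g\<in>G. (snd (fst g), snd (snd g)) = (i, j)} \<le> (if i \<le> j then L (j - i) else 0) + (if j \<le> i then L (i - j) else 0)" for i j
    proof (cases "i \<le> j")
      case True
      have "{g\<in>G. (snd (fst g), snd (snd g)) = (i, j)} \<subseteq> (\<lambda>(u, v). ((u, i), (v, j))) ` ratio_pairs p (h ^ (j - i)) ?M"
      proof
        fix g assume "g \<in> {g\<in>G. (snd (fst g), snd (snd g)) = (i, j)}"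
        then obtain u v where g: "g = ((u, i), (v, j))" "g \<in> G" by (cases g) auto
        then have "(u, v) \<in> ratio_pairs p (h ^ (j - i)) ?M" using cancel[of "int u" i "int v" j] True
          by (auto simp: G_def ratio_pairs_def)
        then show "g \<in> (\<lambda>(u, v). ((u, i), (v, j))) ` ratio_pairs p (h ^ (j - i)) ?M" using g by force
      qed
      then have "card {g\<in>G. (snd (fst g), snd (snd g)) = (i, j)} \<le> L (j - i)"
        unfolding L_def by (intro surj_card_le finR)
      then show ?thesis using True by simp
    next
      case False
      have "{g\<in>G. (snd (fst g), snd (snd g)) = (i, j)} \<subseteq> (\<lambda>(v, u). ((u, i), (v, j))) ` ratio_pairs p (h ^ (i - j)) ?M"
      proof
        fix g assume "g \<in> {g\<in>G. (snd (fst g), snd (snd g)) = (i, j)}"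
        then obtain u v where g: "g = ((u, i), (v, j))" "g \<in> G" by (cases g) auto
        then have "(v, u) \<in> ratio_pairs p (h ^ (i - j)) ?M" using cancel[of "int v" j "int u" i] False
          by (auto simp: G_def ratio_pairs_def cong_sym_eq)
        then show "g \<in> (\<lambda>(v, u). ((u, i), (v, j))) ` ratio_pairs p (h ^ (i - j)) ?M" using g by force
      qed
      then have "card {g\<in>G. (snd (fst g), snd (snd g)) = (i, j)} \<le> L (i - j)"
        unfolding L_def by (intro surj_card_le finR)
      then show ?thesis using False by simp
    qed
    have diff_sum: "(\<Sum>j<N. if i \<le> j then L (j - i) else 0) \<le> (\<Sum>t<N. L t)" for i
    proof -
      have "(\<Sum>j<N. if i \<le> j then L (j - i) else 0) = (\<Sum>j\<in>{j\<in>{..<N}. i \<le> j}. L (j - i))" by (simp only: sum.inter_filter finite_lessThan)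
      also have "\<dots> = (\<Sum>t\<in>(\<lambda>j. j - i) ` {j\<in>{..<N}. i \<le> j}. L t)"
        by (subst sum.reindex) (auto intro!: inj_onI)
      also have "\<dots> \<le> (\<Sum>t<N. L t)" by (intro sum_mono2) auto
      finally show ?thesis .
    qed
    have "card G = (\<Sum>ij\<in>{..<N} \<times> {..<N}. card {g\<in>G. (snd (fst g), snd (snd g)) = ij})"
    proof -
      have im: "(\<lambda>g. (snd (fst g), snd (snd g))) ` G \<subseteq> {..<N} \<times> {..<N}" by (auto simp: G_def)
      show ?thesis using sum.group[OF finG _ im, of "\<lambda>_. 1::nat"] by simp
    qed
    also have "\<dots> \<le> (\<Sum>(i, j)\<in>{..<N} \<times> {..<N}. (if i \<le> j then L (j - i) else 0) + (if j \<le> i then L (i - j) else 0))"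
      using fibG by (intro sum_mono) auto
    also have "\<dots> = (\<Sum>i<N. \<Sum>j<N. if i \<le> j then L (j - i) else 0) + (\<Sum>i<N. \<Sum>j<N. if j \<le> i then L (i - j) else 0)"
      by (simp only: sum.cartesian_product[symmetric] sum.distrib)
    also have "(\<Sum>i<N. \<Sum>j<N. if j \<le> i then L (i - j) else 0) = (\<Sum>j<N. \<Sum>i<N. if j \<le> i then L (i - j) else 0)" by (rule sum.swap)
    also have "(\<Sum>i<N. \<Sum>j<N. if i \<le> j then L (j - i) else 0) + \<dots> \<le> (\<Sum>i<N. \<Sum>t<N. L t) + (\<Sum>i<N. \<Sum>t<N. L t)"
      by (intro add_mono sum_mono diff_sum)
    also have "\<dots> = 2 * N * (\<Sum>t<N. L t)" by simp
    finally show ?thesis .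
  qed
  have "card G * Dv ^ 4 \<le> 2 * N * (\<Sum>t<N. L t) * Dv ^ 4" by (rule mult_right_mono[OF G_le]) simp
  with EG show ?thesis unfolding E_def L_def by (rule le_trans)
qed

theorem triple_power_collisions_bound:
  fixes \<epsilon> \<tau> :: real
  assumes \<epsilon>: "0 < \<epsilon>" "\<epsilon> \<le> 1/16" and \<tau>: "\<tau> > 0"
  shows "eventually (\<lambda>p. \<forall>h N. prime p \<longrightarrow> \<not> int p dvd h \<longrightarrow> real N \<ge> real p powr (1/4) \<longrightarrow>
     real N \<le> 2 * real p powr (1/4) \<longrightarrow> distinct_powers p h N \<longrightarrow>
     real (card (triple_power_collisions p h (short_length (1/4 + \<epsilon>) p) N))
       \<le> real p powr \<tau> * (real (short_length (1/4 + \<epsilon>) p) ^ 6 * real N ^ 2 / real p)) sequentially"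
proof -
  obtain C :: real where C: "C \<ge> 1"
    "\<And>p n::nat. 1 \<le> n \<Longrightarrow> n \<le> p \<Longrightarrow> card {d. d dvd n} \<le> nat \<lfloor>C * real p powr (\<tau>/8)\<rfloor>"
    "\<And>p. real (nat \<lfloor>C * real p powr (\<tau>/8)\<rfloor>) \<le> C * real p powr (\<tau>/8)"
    using short_divisor_bound[of "\<tau>/8"] \<tau> by auto
  have ev: "eventually (\<lambda>p. 18 * C ^ 4 \<le> real p powr (\<tau>/2)) sequentially"
    "eventually (\<lambda>p. 56 \<le> real p powr (2 * \<epsilon>)) sequentially"
    "eventually (\<lambda>p. 64 \<le> real p powr (1/2)) sequentially"
    using \<epsilon> \<tau> by (auto intro!: eventually_le_powr)
  show ?thesis
    using ev sum_inverse_ratios_bound[OF \<epsilon>(1)]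
  proof eventually_elim
    case (elim p)
    show ?case
    proof (intro allI impI)
      fix h :: int and N :: nat
      assume p: "prime p" and h: "\<not> int p dvd h" and N_ge: "real N \<ge> real p powr (1/4)"
        and N_le: "real N \<le> 2 * real p powr (1/4)" and inj: "distinct_powers p h N"
      define P where "P = real p"
      define B where "B = short_length (1/4 + \<epsilon>) p"
      define M where "M = B ^ 3"
      have P1: "P > 1" using prime_gt_1_nat[OF p] by (simp add: P_def)
      have N1: "N \<ge> 1"
      proof -
        have "real N \<ge> 1" using N_ge P1 ge_one_powr_ge_zero[of P "1/4"] by (simp add: P_def)
        then show ?thesis by simp
      qed
      have B_le: "real B \<le> P powr (1/4 + \<epsilon>)" using short_length_le by (simp add: B_def P_def)
      have B_ge: "P powr (1/4 + \<epsilon>) / 2 \<le> real B"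
        using short_length_ge(1)[of p "1/4 + \<epsilon>"] prime_gt_1_nat[OF p] \<epsilon> by (simp add: B_def P_def)
      have pow3: "(P powr (1/4 + \<epsilon>)) ^ 3 = P powr (3/4 + 3 * \<epsilon>)"
        using P1 by (simp add: powr_power)
      \<comment> \<open>This uses the upper bound on \<open>\<epsilon>\<close>: the exponent is at
        most \<open>3/4 + 3/16 < 1\<close>.\<close>
      have M_lt: "M < p"
      proof -
        have "real M \<le> (P powr (1/4 + \<epsilon>)) ^ 3" using B_le by (simp add: M_def power_mono)
        also have "\<dots> = P powr (3/4 + 3 * \<epsilon>)" by (rule pow3)
        also have "\<dots> < P powr 1" using P1 \<epsilon> by (intro powr_less_mono) auto
        finally show ?thesis using P1 by (simp add: P_def)
      qed
      have M_ge: "real M \<ge> P powr (3/4 + 3 * \<epsilon>) / 8"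
      proof -
        have "(P powr (1/4 + \<epsilon>) / 2) ^ 3 \<le> real B ^ 3" using B_ge by (intro power_mono) auto
        then have "(P powr (1/4 + \<epsilon>)) ^ 3 / 8 \<le> real M" by (simp add: M_def power_divide)
        then show ?thesis by (simp only: pow3)
      qed
      have pM: "p \<le> M\<^sup>2"
      proof -
        have "P * 64 \<le> P * P powr (1/2)" using elim(3) P1 by (intro mult_left_mono) (auto simp: P_def)
        also have "\<dots> = P powr (3/2)" using P1 powr_add[of P 1 "1/2"] by simp
        also have "\<dots> \<le> P powr (2 * (3/4 + 3 * \<epsilon>))" using P1 \<epsilon> by (intro powr_mono) auto
        also have "\<dots> = (P powr (3/4 + 3 * \<epsilon>))\<^sup>2" using P1 by (simp add: powr_power mult.commute)
        finally have "P \<le> (P powr (3/4 + 3 * \<epsilon>) / 8)\<^sup>2" by (simp add: power_divide)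
        also have "\<dots> \<le> (real M)\<^sup>2" using M_ge by (intro power_mono) auto
        finally have "real p \<le> real (M\<^sup>2)" by (simp add: P_def)
        then show ?thesis by (simp only: of_nat_le_iff)
      qed
      have "\<forall>t<N. \<exists>a b. a \<ge> 1 \<and> b \<ge> 1 \<and> coprime a b \<and> (\<exists>\<sigma>. (\<sigma> = 1 \<or> \<sigma> = -1) \<and> [int a = \<sigma> * int b * h ^ t] (mod int p)) \<and>
        real (card (ratio_pairs p (h ^ t) M)) \<le> 8 * real M ^ 2 / real p + 7 * real M / real (max a b)"
      proof (intro allI impI)
        fix t
        have "\<not> int p dvd h ^ t" using h p by (meson prime_dvd_power prime_nat_int_transfer)
        from ratio_pairs_bound[OF p this pM]
        show "\<exists>a b. a \<ge> 1 \<and> b \<ge> 1 \<and> coprime a b \<and> (\<exists>\<sigma>. (\<sigma> = 1 \<or> \<sigma> = -1) \<and> [int a = \<sigma> * int b * h ^ t] (mod int p)) \<and>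
          real (card (ratio_pairs p (h ^ t) M)) \<le> 8 * real M ^ 2 / real p + 7 * real M / real (max a b)" by metis
      qed
      then obtain a b where ab: "\<And>t. t < N \<Longrightarrow> a t \<ge> 1 \<and> b t \<ge> 1 \<and> coprime (a t) (b t) \<and>
          (\<exists>\<sigma>. (\<sigma> = 1 \<or> \<sigma> = -1) \<and> [int (a t) = \<sigma> * int (b t) * h ^ t] (mod int p)) \<and>
          real (card (ratio_pairs p (h ^ t) M)) \<le> 8 * real M ^ 2 / real p + 7 * real M / real (max (a t) (b t))"
        by metis
      have "reduced_ratios p h N a b" using ab by (simp add: reduced_ratios_def)
      then have inv_sum: "(\<Sum>t<N. 1 / real (max (a t) (b t))) \<le> P powr \<epsilon>"
        using elim(4) p N1 N_le inj by (simp add: P_def)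
      have "(\<Sum>t<N. real (card (ratio_pairs p (h ^ t) M))) \<le> (\<Sum>t<N. 8 * real M ^ 2 / P + 7 * real M * (1 / real (max (a t) (b t))))"
        using ab by (intro sum_mono) (auto simp: P_def)
      also have "\<dots> = 8 * real M ^ 2 * real N / P + 7 * real M * (\<Sum>t<N. 1 / real (max (a t) (b t)))"
        by (simp add: sum.distrib sum_distrib_left)
      also have "\<dots> \<le> 8 * real M ^ 2 * real N / P + 7 * real M * P powr \<epsilon>"
        using inv_sum by (intro add_left_mono mult_left_mono) auto
      \<comment> \<open>From \<open>M \<ge> p^(3/4+3\<epsilon>) / 8\<close> and
        \<open>N \<ge> p^(1/4)\<close> follows
        \<open>8 M N \<ge> p^(2\<epsilon>) p^(1+\<epsilon>)\<close>, and the spare power exceeds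
        \<open>56 = 7 * 8\<close>.\<close>
      also have "\<dots> \<le> 8 * real M ^ 2 * real N / P + real M ^ 2 * real N / P"
      proof -
        have "56 * P powr (1 + \<epsilon>) \<le> P powr (2 * \<epsilon>) * P powr (1 + \<epsilon>)" using elim(2) by (intro mult_right_mono) (auto simp: P_def)
        also have "\<dots> = P powr (3/4 + 3 * \<epsilon>) * P powr (1/4)" by (simp add: powr_add[symmetric] add.commute)
        also have "\<dots> \<le> (8 * real M) * real N" using M_ge N_ge by (intro mult_mono) (auto simp: P_def)
        finally have "7 * (P powr \<epsilon> * P) \<le> real M * real N" using P1 by (simp add: powr_add mult.commute)
        then have "7 * P powr \<epsilon> \<le> real M * real N / P" using P1 by (simp add: pos_le_divide_eq mult.assoc)
        then have "real M * (7 * P powr \<epsilon>) \<le> real M * (real M * real N / P)" by (rule mult_left_mono) simp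
        moreover have "real M * (real M * real N / P) = real M ^ 2 * real N / P" by (simp add: power2_eq_square)
        moreover have "7 * real M * P powr \<epsilon> = real M * (7 * P powr \<epsilon>)" by simp
        ultimately show ?thesis by linarith
      qed
      also have "\<dots> = 9 * (real M ^ 2 * real N / P)" by simp
      finally have L_sum: "(\<Sum>t<N. real (card (ratio_pairs p (h ^ t) M))) \<le> 9 * (real M ^ 2 * real N / P)" .
      define Dv where "Dv = nat \<lfloor>C * P powr (\<tau>/8)\<rfloor>"
      have Dv: "card {d. d dvd n} \<le> Dv" if "1 \<le> n" "n \<le> p" for n :: nat
        using C(2)[OF that] by (simp add: Dv_def P_def)
      have Dv4: "real Dv ^ 4 \<le> C ^ 4 * P powr (\<tau>/2)"
      proof -
        have "real Dv ^ 4 \<le> (C * P powr (\<tau>/8)) ^ 4" using C(3)[of p] by (intro power_mono) (auto simp: Dv_def P_def)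
        also have "\<dots> = C ^ 4 * P powr (\<tau>/2)" using P1 by (simp add: power_mult_distrib powr_power)
        finally show ?thesis .
      qed
      have "card (triple_power_collisions p h B N) \<le> 2 * N * (\<Sum>t<N. card (ratio_pairs p (h ^ t) M)) * Dv ^ 4"
        unfolding M_def by (rule card_triple_power_collisions_le[OF p h _ Dv]) (use M_lt in \<open>auto simp: M_def\<close>)
      then have "real (card (triple_power_collisions p h B N)) \<le> real (2 * N * (\<Sum>t<N. card (ratio_pairs p (h ^ t) M)) * Dv ^ 4)"
        by (rule of_nat_mono)
      also have "\<dots> = 2 * real N * (\<Sum>t<N. real (card (ratio_pairs p (h ^ t) M))) * real Dv ^ 4" by simp
      also have "\<dots> \<le> 2 * real N * (9 * (real M ^ 2 * real N / P)) * (C ^ 4 * P powr (\<tau>/2))"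
        using L_sum Dv4 C(1) P1 by (intro mult_mono mult_left_mono) (auto intro!: mult_nonneg_nonneg sum_nonneg)
      also have "\<dots> = (18 * C ^ 4) * P powr (\<tau>/2) * (real M ^ 2 * real N ^ 2 / P)" by (simp add: power2_eq_square)
      also have "\<dots> \<le> P powr (\<tau>/2) * P powr (\<tau>/2) * (real M ^ 2 * real N ^ 2 / P)"
        using elim(1) P1 by (intro mult_right_mono) (auto simp: P_def)
      also have "P powr (\<tau>/2) * P powr (\<tau>/2) = P powr \<tau>" by (simp add: powr_add[symmetric])
      also have "real M ^ 2 = real B ^ 6" by (simp add: M_def power_mult[symmetric])
      finally show "real (card (triple_power_collisions p h (short_length (1/4 + \<epsilon>) p) N))
       \<le> real p powr \<tau> * (real (short_length (1/4 + \<epsilon>) p) ^ 6 * real N ^ 2 / real p)"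
        by (simp add: B_def P_def)
    qed
  qed
qed

section \<open>Residues missed by the product set\<close>

locale primitive_root =
  fixes p g :: nat
  assumes prime_p: "prime p" and primroot: "residue_primroot p g"
begin

lemma p_gt_1: "p > 1" using prime_p by (rule prime_gt_1_nat)

lemma totient_p: "totient p = p - 1" using prime_p by (rule totient_prime)

lemma ord_g: "ord p g = p - 1" and coprime_g: "coprime p g"
  using primroot totient_p by (auto simp: residue_primroot_def)

lemma g_power_cong: "[int g ^ i = int g ^ j] (mod int p) \<longleftrightarrow> [i = j] (mod (p - 1))"
  using order_divides_expdiff[OF coprime_g, of i j] ord_g by (simp flip: of_nat_power add: cong_int_iff)

lemma not_dvd_g_power: "\<not> int p dvd int g ^ i"
proof
  assume "int p dvd int g ^ i"
  then have "p dvd g ^ i" by (simp flip: of_nat_power)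
  then have "p dvd g" using prime_p by (meson prime_dvd_power)
  with coprime_g p_gt_1 show False by (metis coprime_absorb_left nat_dvd_1_iff_1 less_irrefl)
qed

lemma unit_is_power:
  assumes "\<not> int p dvd a"
  obtains i where "i < p - 1" "[int g ^ i = a] (mod int p)"
proof -
  define b where "b = nat (a mod int p)"
  have b: "int b = a mod int p" using p_gt_1 by (simp add: b_def)
  have "b < p" using p_gt_1 by (simp add: b_def nat_less_iff)
  moreover have "b \<noteq> 0" using assms b by (metis dvd_eq_mod_eq_0 of_nat_0)
  ultimately have "b \<in> totatives p"
    using prime_p by (auto simp: totatives_prime)
  also have "totatives p = (\<lambda>i. g ^ i mod p) ` {..<p - 1}"
    using residue_primroot_is_generator[OF p_gt_1 primroot] unfolding totient_p by (simp only: bij_betw_def)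
  finally obtain i where i: "i < p - 1" "g ^ i mod p = b" by auto
  have "[int g ^ i = a] (mod int p)"
    using arg_cong[OF i(2), of int] b by (simp only: Cong.cong_def zmod_int of_nat_power)
  with i(1) show ?thesis by (rule that)
qed

text \<open>Determined only modulo \<open>p - 1\<close>, which is all that the powers of
  \<open>unity_root\<close> can see.\<close>

definition ind :: "int \<Rightarrow> nat" where
  "ind a = (SOME i. [int g ^ i = a] (mod int p))"

lemma ind: "\<not> int p dvd a \<Longrightarrow> [int g ^ ind a = a] (mod int p)"
  unfolding ind_def by (rule someI_ex) (meson unit_is_power)

lemma ind_cong_iff:
  assumes "\<not> int p dvd a" "\<not> int p dvd b"
  shows "[ind a = ind b] (mod (p - 1)) \<longleftrightarrow> [a = b] (mod int p)"
  unfolding g_power_cong[symmetric] using ind[OF assms(1)] ind[OF assms(2)] by (simp only: Cong.cong_def)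

definition unity_root :: complex where "unity_root = exp (2 * of_real pi * \<i> / of_nat (p - 1))"

lemma root_power: "unity_root ^ i = exp (2 * of_real pi * \<i> * of_nat i / of_nat (p - 1))"
  by (simp add: unity_root_def exp_of_nat_mult[symmetric] mult_ac)

lemma root_power_eq_iff: "unity_root ^ i = unity_root ^ j \<longleftrightarrow> [i = j] (mod (p - 1))"
  unfolding root_power using complex_root_unity_eq[of "p - 1" i j] p_gt_1 by (simp add: Cong.cong_def)

lemma norm_root_power: "norm (unity_root ^ i) = 1"
  by (simp add: unity_root_def norm_power norm_exp_eq_Re)

lemma root_power_eq_1_iff: "unity_root ^ i = 1 \<longleftrightarrow> (p - 1) dvd i"
  using root_power_eq_iff[of i 0] by (simp add: cong_0_iff)

text \<open>For \<open>j < p - 1\<close> these are all the characters modulo \<open>p\<close>, the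
  trivial one being \<open>j = 0\<close>.\<close>

definition index_char :: "nat \<Rightarrow> int \<Rightarrow> complex" where
  "index_char j a = (if int p dvd a then 0 else unity_root ^ (j * ind a))"

lemma index_char_dirichlet: "dirichlet_char p (index_char j)"
  unfolding dirichlet_char_def
proof (intro conjI allI impI)
  have root0: "unity_root \<noteq> 0" by (simp add: unity_root_def)
  show "index_char j a = 0 \<longleftrightarrow> int p dvd a" for a using root0 by (simp add: index_char_def)
  fix a b :: int
  have pp: "prime (int p)" using prime_p by simp
  show "index_char j (a * b) = index_char j a * index_char j b"
  proof (cases "int p dvd a \<or> int p dvd b")
    case False
    then have nd: "\<not> int p dvd a" "\<not> int p dvd b" "\<not> int p dvd a * b" using pp by (auto simp: prime_dvd_mult_iff)
    have "[int g ^ (ind a + ind b) = a * b] (mod int p)"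
      unfolding power_add by (intro cong_mult ind nd)
    then have "[int g ^ ind (a * b) = int g ^ (ind a + ind b)] (mod int p)"
      using ind[OF nd(3)] by (simp only: Cong.cong_def)
    then have "[j * ind (a * b) = j * (ind a + ind b)] (mod (p - 1))"
      unfolding g_power_cong by (rule cong_scalar_left)
    then have "unity_root ^ (j * ind (a * b)) = unity_root ^ (j * (ind a + ind b))" by (simp only: root_power_eq_iff)
    then have "unity_root ^ (j * ind (a * b)) = unity_root ^ (j * ind a) * unity_root ^ (j * ind b)" by (simp only: distrib_left power_add)
    then show ?thesis using nd by (simp only: index_char_def if_False)
  qed (auto simp: index_char_def)
  assume ab: "[a = b] (mod int p)"
  then have "int p dvd a \<longleftrightarrow> int p dvd b" by (rule cong_dvd_iff)
  moreover have "unity_root ^ (j * ind a) = unity_root ^ (j * ind b)" if "\<not> int p dvd a" "\<not> int p dvd b"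
    unfolding root_power_eq_iff using ind_cong_iff[OF that] ab by (intro cong_scalar_left) simp
  ultimately show "index_char j a = index_char j b" by (auto simp: index_char_def)
qed

lemma index_char_order:
  assumes "1 \<le> j" "j < p - 1"
  shows "char_order p (index_char j) > 1"
proof -
  have p3: "p > 2" using assms by simp
  have nd: "\<not> int p dvd 1" "\<not> int p dvd int g" using not_dvd_g_power[of 0] not_dvd_g_power[of 1] by auto
  have i1: "[ind 1 = 0] (mod (p - 1))" using ind[OF nd(1)] g_power_cong[of "ind 1" 0] by simp
  have ig: "[ind (int g) = 1] (mod (p - 1))" using ind[OF nd(2)] g_power_cong[of "ind (int g)" 1] by simp
  have one: "index_char j 1 = 1"
  proof -
    have "[j * ind 1 = j * 0] (mod (p - 1))" using i1 by (rule cong_scalar_left)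
    then show ?thesis using nd by (simp add: index_char_def root_power_eq_1_iff cong_0_iff)
  qed
  have gen: "index_char j (int g) \<noteq> 1"
  proof
    assume "index_char j (int g) = 1"
    then have "[j * ind (int g) = 0] (mod (p - 1))" using nd by (simp add: index_char_def root_power_eq_1_iff cong_0_iff)
    moreover have "[j * ind (int g) = j * 1] (mod (p - 1))" using ig by (rule cong_scalar_left)
    ultimately have "[j = 0] (mod (p - 1))" by (simp only: Cong.cong_def mult_1_right)
    then have "(p - 1) dvd j" by (simp only: cong_0_iff)
    then show False using assms by (auto dest: dvd_imp_le)
  qed
  have gm: "index_char j (int g mod int p) = index_char j (int g)"
    by (rule dirichlet_charD(2)[OF index_char_dirichlet]) (simp add: Cong.cong_def)
  have mem: "int g mod int p \<in> {1..<int p}"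
  proof -
    have "int g mod int p \<noteq> 0" using nd(2) by (rule contrapos_nn) (rule mod_0_imp_dvd)
    moreover have "0 \<le> int g mod int p" "int g mod int p < int p" using p_gt_1 by simp_all
    ultimately show ?thesis by simp
  qed
  have ne: "index_char j 1 \<noteq> index_char j (int g mod int p)"
    unfolding gm one by (rule gen[symmetric])
  have "1 \<in> {1..<int p}" using p_gt_1 by simp
  then have "{index_char j 1, index_char j (int g mod int p)} \<subseteq> index_char j ` {1..<int p}"
    using mem by (intro iffD2[OF insert_subset] conjI imageI empty_subsetI)
  then have "card {index_char j 1, index_char j (int g mod int p)} \<le> char_order p (index_char j)"
    unfolding char_order_def by (intro card_mono) auto
  with ne show ?thesis by simp
qed

lemma index_char_0: "\<not> int p dvd a \<Longrightarrow> index_char 0 a = 1"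
  by (simp add: index_char_def)

lemma norm_index_char_le_1: "norm (index_char j a) \<le> 1"
  by (simp add: index_char_def norm_root_power)

lemmas index_char_mult = dirichlet_charD(1)[OF index_char_dirichlet]

lemma index_char_prod: "finite A \<Longrightarrow> index_char j (prod f A) = (\<Prod>i\<in>A. index_char j (f i))"
proof (induction A rule: finite_induct)
  case empty
  interpret dirichlet p "index_char j" "char_order p (index_char j)"
    by unfold_locales (use prime_p index_char_dirichlet in auto)
  show ?case by simp
qed (simp add: index_char_mult)

lemma orthogonality:
  assumes "\<not> int p dvd a" "\<not> int p dvd b"
  shows "(\<Sum>j<p - 1. index_char j a * cnj (index_char j b)) = (if [a = b] (mod int p) then of_nat (p - 1) else 0)"
proof -
  define z where "z = unity_root ^ ind a * cnj (unity_root ^ ind b)"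
  have inv: "unity_root ^ i * cnj (unity_root ^ i) = 1" for i
    using norm_root_power[of i] by (simp add: complex_norm_square[symmetric] del: complex_cnj_power)
  have sum: "(\<Sum>j<p - 1. index_char j a * cnj (index_char j b)) = (\<Sum>j<p - 1. z ^ j)"
    using assms by (simp add: index_char_def z_def power_mult_distrib power_mult[symmetric] mult.commute)
  show ?thesis
  proof (cases "[a = b] (mod int p)")
    case True
    then have "unity_root ^ ind a = unity_root ^ ind b" using ind_cong_iff[OF assms] root_power_eq_iff by simp
    then have "z = 1" using inv by (simp add: z_def)
    then show ?thesis using True sum by simp
  next
    case False
    then have ne: "unity_root ^ ind a \<noteq> unity_root ^ ind b" using ind_cong_iff[OF assms] root_power_eq_iff by simp
    have "z \<noteq> 1"
    proof
      assume "z = 1"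
      then have "unity_root ^ ind a * cnj (unity_root ^ ind b) * unity_root ^ ind b = unity_root ^ ind b" by (simp add: z_def)
      then have "unity_root ^ ind a * (unity_root ^ ind b * cnj (unity_root ^ ind b)) = unity_root ^ ind b" by (simp only: mult_ac)
      with ne inv show False by simp
    qed
    moreover have "z ^ (p - 1) = 1"
    proof -
      have "(unity_root ^ i) ^ (p - 1) = 1" for i by (simp add: power_mult[symmetric] root_power_eq_1_iff)
      then have "(unity_root ^ ind a) ^ (p - 1) = 1" "cnj ((unity_root ^ ind b) ^ (p - 1)) = 1" by simp_all
      then show ?thesis by (simp add: z_def power_mult_distrib)
    qed
    ultimately have "(\<Sum>j<p - 1. z ^ j) = 0" by (simp add: geometric_sum)
    then show ?thesis using False sum by simp
  qed
qed

text \<open>Opening the squares and applying orthogonality leaves the congruent pairs.\<close>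

lemma parseval:
  assumes "finite A" "\<And>x. x \<in> A \<Longrightarrow> \<not> int p dvd \<phi> x"
  shows "(\<Sum>j<p - 1. norm (\<Sum>x\<in>A. index_char j (\<phi> x)) ^ 2)
     = real (p - 1) * real (card {(x, y). x \<in> A \<and> y \<in> A \<and> [\<phi> x = \<phi> y] (mod int p)})"
proof -
  have "complex_of_real (\<Sum>j<p - 1. norm (\<Sum>x\<in>A. index_char j (\<phi> x)) ^ 2)
    = (\<Sum>j<p - 1. \<Sum>x\<in>A. \<Sum>y\<in>A. index_char j (\<phi> x) * cnj (index_char j (\<phi> y)))"
    by (simp add: complex_norm_square sum_product cnj_sum del: of_real_power)
  also have "\<dots> = (\<Sum>x\<in>A. \<Sum>j<p - 1. \<Sum>y\<in>A. index_char j (\<phi> x) * cnj (index_char j (\<phi> y)))" by (rule sum.swap)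
  also have "\<dots> = (\<Sum>x\<in>A. \<Sum>y\<in>A. \<Sum>j<p - 1. index_char j (\<phi> x) * cnj (index_char j (\<phi> y)))"
    by (rule sum.cong[OF refl], rule sum.swap)
  also have "\<dots> = (\<Sum>x\<in>A. \<Sum>y\<in>A. if [\<phi> x = \<phi> y] (mod int p) then of_nat (p - 1) else 0)"
    using assms(2) by (intro sum.cong refl orthogonality) auto
  also have "\<dots> = (\<Sum>q\<in>A \<times> A. if [\<phi> (fst q) = \<phi> (snd q)] (mod int p) then of_nat (p - 1) else 0)"
    by (simp add: sum.cartesian_product case_prod_beta)
  also have "\<dots> = (\<Sum>q\<in>{q\<in>A \<times> A. [\<phi> (fst q) = \<phi> (snd q)] (mod int p)}. of_nat (p - 1))"
    using assms(1) by (intro sum.inter_filter[symmetric] finite_cartesian_product)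
  also have "{q\<in>A \<times> A. [\<phi> (fst q) = \<phi> (snd q)] (mod int p)} = {(x, y). x \<in> A \<and> y \<in> A \<and> [\<phi> x = \<phi> y] (mod int p)}"
    by auto
  finally have "complex_of_real (\<Sum>j<p - 1. norm (\<Sum>x\<in>A. index_char j (\<phi> x)) ^ 2)
    = complex_of_real (real (p - 1) * real (card {(x, y). x \<in> A \<and> y \<in> A \<and> [\<phi> x = \<phi> y] (mod int p)}))"
    by (simp add: mult.commute)
  then show ?thesis by (simp only: of_real_eq_iff)
qed

lemma not_dvd_small: "1 \<le> n \<Longrightarrow> n < p \<Longrightarrow> \<not> int p dvd int n"
  by (auto dest: dvd_imp_le)

lemma not_dvd_mult: "\<not> int p dvd a \<Longrightarrow> \<not> int p dvd b \<Longrightarrow> \<not> int p dvd a * b"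
  using prime_p by (simp add: prime_dvd_mult_iff)

lemma not_dvd_power: "\<not> int p dvd a \<Longrightarrow> \<not> int p dvd a ^ k"
  using prime_p by (meson prime_dvd_power prime_nat_int_transfer)

text \<open>The \<open>2k\<close>-th moment over all characters counts solutions of \<open>v\<^sub>1\<cdots>v\<^sub>k = w\<^sub>1\<cdots>w\<^sub>k\<close>
  in integers, because the products are smaller than \<open>p\<close>.\<close>

lemma short_sum_high_moment:
  assumes k: "k \<ge> 1" and A: "A < p" "A ^ k \<le> p"
    and Dv: "\<And>n. 1 \<le> n \<Longrightarrow> n \<le> p \<Longrightarrow> card {d. d dvd n} \<le> Dv"
  shows "(\<Sum>j<p - 1. norm (\<Sum>a=1..A. index_char j (int a)) ^ (2 * k)) \<le> real (p - 1) * real (A ^ k * Dv ^ k)"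
proof -
  define P where "P = {..<k} \<rightarrow>\<^sub>E {1..A}"
  define \<phi> where "\<phi> = (\<lambda>v::nat \<Rightarrow> nat. \<Prod>i<k. v i)"
  have finP: "finite P" by (simp add: P_def finite_PiE)
  have v_mem: "v i \<in> {1..A}" if "v \<in> P" "i < k" for v i
    using that PiE_mem[of v "{..<k}" "\<lambda>_. {1..A}" i] by (simp add: P_def)
  have \<phi>_le: "1 \<le> \<phi> v" "\<phi> v \<le> A ^ k" if "v \<in> P" for v
  proof -
    have "(\<Prod>i<k. 1) \<le> \<phi> v" unfolding \<phi>_def by (rule prod_mono) (use v_mem[OF that] in simp)
    then show "1 \<le> \<phi> v" by simp
    have "\<phi> v \<le> (\<Prod>i<k. A)" unfolding \<phi>_def by (rule prod_mono) (use v_mem[OF that] in simp)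
    then show "\<phi> v \<le> A ^ k" by simp
  qed
  have nd: "\<not> int p dvd int (\<phi> v)" if "v \<in> P" for v
  proof
    assume "int p dvd int (\<phi> v)"
    then have "p dvd (\<Prod>i<k. v i)" by (simp only: \<phi>_def int_dvd_int_iff)
    then obtain i where i: "i < k" "p dvd v i" using prime_p by (auto simp: prime_dvd_prod_iff)
    then have "p \<le> v i" using v_mem[OF that i(1)] by (intro dvd_imp_le) auto
    then show False using v_mem[OF that i(1)] A by auto
  qed
  have \<phi>_lt: "\<phi> v < p" if "v \<in> P" for v
    using \<phi>_le[OF that] nd[OF that] A by (metis dvd_refl le_less le_trans)
  have pow: "(\<Sum>a=1..A. index_char j (int a)) ^ k = (\<Sum>v\<in>P. index_char j (int (\<phi> v)))" for j
  proof -
    have "(\<Sum>a=1..A. index_char j (int a)) ^ k = (\<Prod>i<k. \<Sum>a\<in>{1..A}. index_char j (int a))" by simp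
    also have "\<dots> = (\<Sum>v\<in>P. \<Prod>i<k. index_char j (int (v i)))"
      unfolding P_def by (rule prod_sum_PiE) simp_all
    also have "\<dots> = (\<Sum>v\<in>P. index_char j (int (\<phi> v)))"
      by (simp add: \<phi>_def index_char_prod)
    finally show ?thesis .
  qed
  have "norm (\<Sum>a=1..A. index_char j (int a)) ^ (2 * k) = norm (\<Sum>v\<in>P. index_char j (int (\<phi> v))) ^ 2" for j
    unfolding pow[symmetric] by (simp add: norm_power power_mult[symmetric] mult.commute)
  then have "(\<Sum>j<p - 1. norm (\<Sum>a=1..A. index_char j (int a)) ^ (2 * k))
    = real (p - 1) * real (card {(x, y). x \<in> P \<and> y \<in> P \<and> [int (\<phi> x) = int (\<phi> y)] (mod int p)})"
    using parseval[OF finP, of "\<lambda>v. int (\<phi> v)"] nd by simp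
  \<comment> \<open>Given \<open>x\<close>, every entry of \<open>y\<close> divides the number
    \<open>\<phi> x\<close>, which leaves at most \<open>Dv\<close> choices for each.\<close>
  also have "card {(x, y). x \<in> P \<and> y \<in> P \<and> [int (\<phi> x) = int (\<phi> y)] (mod int p)} \<le> A ^ k * Dv ^ k"
  proof -
    have "{(x, y). x \<in> P \<and> y \<in> P \<and> [int (\<phi> x) = int (\<phi> y)] (mod int p)} \<subseteq> (SIGMA x:P. {..<k} \<rightarrow>\<^sub>E {d. d dvd \<phi> x})"
    proof
      fix q assume "q \<in> {(x, y). x \<in> P \<and> y \<in> P \<and> [int (\<phi> x) = int (\<phi> y)] (mod int p)}"
      then obtain x y where q: "q = (x, y)" "x \<in> P" "y \<in> P" "[int (\<phi> x) = int (\<phi> y)] (mod int p)" by auto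
      then have "\<phi> x = \<phi> y" using \<phi>_lt by (simp add: cong_int_iff Cong.cong_def)
      then have "y i dvd \<phi> x" if "i < k" for i using that by (auto simp: \<phi>_def intro!: dvd_prodI)
      then have "y \<in> {..<k} \<rightarrow>\<^sub>E {d. d dvd \<phi> x}" using q(3) by (auto simp: P_def PiE_iff)
      then show "q \<in> (SIGMA x:P. {..<k} \<rightarrow>\<^sub>E {d. d dvd \<phi> x})" using q by simp
    qed
    moreover have finD: "finite ({..<k} \<rightarrow>\<^sub>E {d. d dvd \<phi> x})" if "x \<in> P" for x
      using \<phi>_le(1)[OF that] by (intro finite_PiE) auto
    ultimately have "card {(x, y). x \<in> P \<and> y \<in> P \<and> [int (\<phi> x) = int (\<phi> y)] (mod int p)} \<le> card (SIGMA x:P. {..<k} \<rightarrow>\<^sub>E {d. d dvd \<phi> x})"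
      using finP by (intro card_mono finite_SigmaI) auto
    also have "\<dots> = (\<Sum>x\<in>P. card {d. d dvd \<phi> x} ^ k)"
      using finP finD by (simp add: card_SigmaI card_PiE)
    also have "\<dots> \<le> (\<Sum>x\<in>P. Dv ^ k)"
      using \<phi>_le(1) \<phi>_lt by (intro sum_mono power_mono Dv) (auto intro: less_imp_le)
    also have "\<dots> = A ^ k * Dv ^ k" by (simp add: P_def card_PiE)
    finally show ?thesis .
  qed
  finally show ?thesis by (simp add: mult_left_mono)
qed

lemma missed_residues_bound:
  fixes \<Lambda> :: "int set" and A B N :: nat and \<alpha> \<beta> :: real
  assumes A: "1 \<le> A" "A < p" and B: "1 \<le> B" "B < p" and N: "1 \<le> N" and h: "\<not> int p dvd h"
    and \<Lambda>: "\<Lambda> \<subseteq> {1..<int p}"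
    and missed: "\<And>a x y z i l. a \<in> {1..A} \<Longrightarrow> x \<in> {1..B} \<Longrightarrow> y \<in> {1..B} \<Longrightarrow> z \<in> {1..B} \<Longrightarrow> i < N \<Longrightarrow> l \<in> \<Lambda> \<Longrightarrow>
       \<not> [int a * (int (x * y * z) * h ^ i) = l] (mod int p)"
    and \<alpha>: "\<alpha> \<ge> 0" and \<beta>: "\<beta> \<ge> 0"
    and burgess: "\<And>j. 1 \<le> j \<Longrightarrow> j < p - 1 \<Longrightarrow> norm (\<Sum>n=1..B. index_char j (int n)) \<le> real B * \<beta>"
    and few: "real (card {j\<in>{1..<p - 1}. norm (\<Sum>n=1..A. index_char j (int n)) > real A * \<alpha>}) * \<beta> ^ 3 \<le> 1 / 2"
  shows "real B ^ 6 * real N ^ 2 * real (card \<Lambda>) \<le> 4 * \<alpha>\<^sup>2 * real p ^ 2 * real (card (triple_power_collisions p h B N))"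
proof -
  define SA where "SA = (\<lambda>j. \<Sum>n=1..A. index_char j (int n))"
  define SB where "SB = (\<lambda>j. \<Sum>n=1..B. index_char j (int n))"
  define SL where "SL = (\<lambda>j. \<Sum>l\<in>\<Lambda>. index_char j l)"
  define Q where "Q = ({1..B} \<times> {1..B} \<times> {1..B}) \<times> {..<N}"
  define \<phi> where "\<phi> = (\<lambda>((x, y, z), i). int (x * y * z) * h ^ i)"
  define T where "T = (\<lambda>j. \<Sum>q\<in>Q. index_char j (\<phi> q))"
  define L where "L = card \<Lambda>"
  define E where "E = card (triple_power_collisions p h B N)"
  define R where "R = {j\<in>{1..<p - 1}. norm (SA j) > real A * \<alpha>}"
  have finL: "finite \<Lambda>" using \<Lambda> by (rule finite_subset) simp
  have finQ: "finite Q" by (simp add: Q_def)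
  have cardQ: "real (card Q) = real B ^ 3 * real N" by (simp add: Q_def card_cartesian_product power3_eq_cube)
  have nd\<phi>: "\<not> int p dvd \<phi> q" if "q \<in> Q" for q
  proof -
    obtain x y z i where q: "q = ((x, y, z), i)" by (metis surj_pair)
    have "\<not> int p dvd int x" "\<not> int p dvd int y" "\<not> int p dvd int z"
      using that B not_dvd_small[of x] not_dvd_small[of y] not_dvd_small[of z] by (auto simp: q Q_def)
    then show ?thesis using h by (simp add: q \<phi>_def not_dvd_mult not_dvd_power)
  qed
  have ndA: "\<not> int p dvd int a" if "a \<in> {1..A}" for a using that A by (intro not_dvd_small) auto
  have ndL: "\<not> int p dvd l" if "l \<in> \<Lambda>" for l using subsetD[OF \<Lambda> that] zdvd_imp_le[of "int p" l] by auto
  have T_eq: "T j = SB j ^ 3 * (\<Sum>i<N. index_char j (h ^ i))" for j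
  proof -
    have "T j = (\<Sum>x=1..B. \<Sum>y=1..B. \<Sum>z=1..B. \<Sum>i<N. index_char j (int x) * index_char j (int y) * index_char j (int z) * index_char j (h ^ i))"
      by (simp add: T_def Q_def sum.cartesian_product' \<phi>_def index_char_mult mult.assoc)
    also have "\<dots> = SB j * SB j * SB j * (\<Sum>i<N. index_char j (h ^ i))"
      by (simp only: SB_def sum_distrib_left[symmetric] sum_distrib_right[symmetric])
    finally show ?thesis by (simp add: power3_eq_cube)
  qed
  have norm_T: "norm (T j) \<le> (real B * \<beta>) ^ 3 * real N" if "1 \<le> j" "j < p - 1" for j
  proof -
    have "norm (\<Sum>i<N. index_char j (h ^ i)) \<le> (\<Sum>i<N. 1)" by (intro sum_norm_le norm_index_char_le_1)
    then have "norm (\<Sum>i<N. index_char j (h ^ i)) \<le> real N" by simp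
    then show ?thesis unfolding T_eq norm_mult norm_power using burgess[OF that] \<beta>
      by (intro mult_mono power_mono) (auto simp: SB_def)
  qed
  have norm_SA: "norm (SA j) \<le> real A" for j
    using sum_norm_le[of "{1..A}" "\<lambda>n. index_char j (int n)" "\<lambda>_. 1"] norm_index_char_le_1 by (simp add: SA_def)
  have norm_SL: "norm (SL j) \<le> real L" for j
    using sum_norm_le[of \<Lambda> "\<lambda>n. index_char j n" "\<lambda>_. 1"] norm_index_char_le_1 by (simp add: SL_def L_def)
  \<comment> \<open>Orthogonality turns this sum into a count of the representations of elements of
    \<open>\<Lambda>\<close>, and there are none.\<close>
  have vanish: "(\<Sum>j<p - 1. SA j * T j * cnj (SL j)) = 0"
  proof -
    have "(\<Sum>j<p - 1. SA j * T j * cnj (SL j)) =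
      (\<Sum>j<p - 1. \<Sum>w\<in>{1..A} \<times> Q \<times> \<Lambda>. index_char j (int (fst w) * \<phi> (fst (snd w))) * cnj (index_char j (snd (snd w))))"
    proof (rule sum.cong[OF refl])
      fix j
      have "(\<Sum>w\<in>{1..A} \<times> Q \<times> \<Lambda>. index_char j (int (fst w) * \<phi> (fst (snd w))) * cnj (index_char j (snd (snd w))))
        = (\<Sum>a=1..A. \<Sum>q\<in>Q. \<Sum>l\<in>\<Lambda>. index_char j (int a) * (index_char j (\<phi> q) * cnj (index_char j l)))"
        by (simp add: sum.cartesian_product case_prod_beta index_char_mult mult.assoc)
      also have "\<dots> = SA j * (T j * cnj (SL j))"
        by (simp only: SA_def T_def SL_def cnj_sum sum_distrib_left[symmetric] sum_distrib_right[symmetric])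
      finally show "SA j * T j * cnj (SL j) = (\<Sum>w\<in>{1..A} \<times> Q \<times> \<Lambda>. index_char j (int (fst w) * \<phi> (fst (snd w))) * cnj (index_char j (snd (snd w))))"
        by (simp add: mult.assoc)
    qed
    also have "\<dots> = (\<Sum>w\<in>{1..A} \<times> Q \<times> \<Lambda>. \<Sum>j<p - 1. index_char j (int (fst w) * \<phi> (fst (snd w))) * cnj (index_char j (snd (snd w))))"
      by (rule sum.swap)
    also have "\<dots> = (\<Sum>w\<in>{1..A} \<times> Q \<times> \<Lambda>. 0)"
    proof (rule sum.cong[OF refl])
      fix w assume w: "w \<in> {1..A} \<times> Q \<times> \<Lambda>"
      obtain a x y z i l where we: "w = (a, ((x, y, z), i), l)" by (metis surj_pair)
      have "\<not> [int a * \<phi> ((x, y, z), i) = l] (mod int p)"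
        using missed[of a x y z i l] w by (simp add: we Q_def \<phi>_def)
      moreover have "\<not> int p dvd int a * \<phi> ((x, y, z), i)" "\<not> int p dvd l"
        using w ndA nd\<phi> ndL not_dvd_mult by (auto simp: we)
      ultimately show "(\<Sum>j<p - 1. index_char j (int (fst w) * \<phi> (fst (snd w))) * cnj (index_char j (snd (snd w)))) = 0"
        using orthogonality[of "int a * \<phi> ((x, y, z), i)" l] by (simp add: we)
    qed
    finally show ?thesis by simp
  qed
  have zero: "SA 0 * T 0 * cnj (SL 0) = of_real (real A * (real B ^ 3 * real N) * real L)"
  proof -
    have "SA 0 = of_nat A" using ndA by (simp add: SA_def index_char_0)
    moreover have "T 0 = of_nat (card Q)" using nd\<phi> by (simp add: T_def index_char_0)
    moreover have "SL 0 = of_nat L" using ndL by (simp add: SL_def L_def index_char_0)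
    moreover have "(of_nat (card Q) :: complex) = of_real (real B ^ 3 * real N)"
      unfolding cardQ[symmetric] by (rule of_real_of_nat_eq[symmetric])
    ultimately show ?thesis by (simp only: complex_cnj_of_nat of_real_mult of_real_of_nat_eq)
  qed
  have p1: "{..<p - 1} = insert 0 {1..<p - 1}" using p_gt_1 by auto
  have minus: "SA 0 * T 0 * cnj (SL 0) = - (\<Sum>j\<in>{1..<p - 1}. SA j * T j * cnj (SL j))"
    using vanish unfolding p1 by (simp add: eq_neg_iff_add_eq_0)
  have "real A * (real B ^ 3 * real N) * real L = norm (\<Sum>j\<in>{1..<p - 1}. SA j * T j * cnj (SL j))"
    using arg_cong[OF minus, of norm] unfolding zero norm_minus_cancel norm_of_real
    by (subst (asm) abs_of_nonneg) auto
  also have "\<dots> \<le> (\<Sum>j\<in>{1..<p - 1}. norm (SA j) * (norm (T j) * norm (SL j)))"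
    by (rule order.trans[OF norm_sum]) (simp add: norm_mult mult.assoc)
  \<comment> \<open>\<open>R\<close> collects the exceptional characters. By \<open>few\<close> they
    account for at most half of the contribution of the trivial character; the half that is left
    explains the factor 2 and, after squaring, 4.\<close>
  also have "\<dots> = (\<Sum>j\<in>R. norm (SA j) * (norm (T j) * norm (SL j))) + (\<Sum>j\<in>{1..<p - 1} - R. norm (SA j) * (norm (T j) * norm (SL j)))"
    by (subst add.commute) (rule sum.subset_diff, auto simp: R_def)
  also have "\<dots> \<le> (\<Sum>j\<in>R. real A * ((real B * \<beta>) ^ 3 * real N * real L)) + (\<Sum>j\<in>{1..<p - 1} - R. real A * \<alpha> * (norm (T j) * norm (SL j)))"
  proof (intro add_mono sum_mono)
    fix j assume "j \<in> R"
    then have "1 \<le> j" "j < p - 1" by (auto simp: R_def)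
    then show "norm (SA j) * (norm (T j) * norm (SL j)) \<le> real A * ((real B * \<beta>) ^ 3 * real N * real L)"
      using norm_SA norm_T norm_SL \<beta> by (intro mult_mono) auto
  next
    fix j assume "j \<in> {1..<p - 1} - R"
    then have "norm (SA j) \<le> real A * \<alpha>" by (auto simp: R_def)
    then show "norm (SA j) * (norm (T j) * norm (SL j)) \<le> real A * \<alpha> * (norm (T j) * norm (SL j))"
      by (intro mult_right_mono) auto
  qed
  also have "(\<Sum>j\<in>R. real A * ((real B * \<beta>) ^ 3 * real N * real L)) = real A * (real B ^ 3 * real N) * real L * (real (card R) * \<beta> ^ 3)"
    by (simp add: power_mult_distrib mult_ac)
  also have "real A * (real B ^ 3 * real N) * real L * (real (card R) * \<beta> ^ 3) \<le> real A * (real B ^ 3 * real N) * real L * (1 / 2)"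
    using few by (intro mult_left_mono) (auto simp: R_def SA_def)
  finally have "real A * (real B ^ 3 * real N) * real L
     \<le> real A * (real B ^ 3 * real N) * real L * (1 / 2) + (\<Sum>j\<in>{1..<p - 1} - R. real A * \<alpha> * (norm (T j) * norm (SL j)))" by simp
  also have "(\<Sum>j\<in>{1..<p - 1} - R. real A * \<alpha> * (norm (T j) * norm (SL j)))
      = real A * \<alpha> * (\<Sum>j\<in>{1..<p - 1} - R. norm (T j) * norm (SL j))"
    by (simp only: sum_distrib_left)
  finally have "real A * (real B ^ 3 * real N * real L) \<le> real A * (2 * \<alpha> * (\<Sum>j\<in>{1..<p - 1} - R. norm (T j) * norm (SL j)))"
    by (simp add: mult_ac)
  then have "real B ^ 3 * real N * real L \<le> 2 * \<alpha> * (\<Sum>j\<in>{1..<p - 1} - R. norm (T j) * norm (SL j))"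
    using A by (subst (asm) mult_le_cancel_left_pos) auto
  also have "\<dots> \<le> 2 * \<alpha> * (\<Sum>j<p - 1. norm (T j) * norm (SL j))"
    using \<alpha> by (intro mult_left_mono sum_mono2) auto
  finally have "(real B ^ 3 * real N * real L)\<^sup>2 \<le> (2 * \<alpha> * (\<Sum>j<p - 1. norm (T j) * norm (SL j)))\<^sup>2"
    by (intro power_mono) auto
  also have "\<dots> = 4 * \<alpha>\<^sup>2 * (\<Sum>j<p - 1. norm (T j) * norm (SL j))\<^sup>2" by (simp add: power_mult_distrib)
  also have "\<dots> \<le> 4 * \<alpha>\<^sup>2 * ((\<Sum>j<p - 1. norm (T j) ^ 2) * (\<Sum>j<p - 1. norm (SL j) ^ 2))"
    by (intro mult_left_mono Cauchy_Schwarz_ineq_sum) auto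
  also have "(\<Sum>j<p - 1. norm (T j) ^ 2) = real (p - 1) * real E"
  proof -
    have "{(x, y). x \<in> Q \<and> y \<in> Q \<and> [\<phi> x = \<phi> y] (mod int p)} = triple_power_collisions p h B N"
      by (auto simp: triple_power_collisions_def Q_def \<phi>_def)
    then show ?thesis unfolding T_def E_def using parseval[OF finQ nd\<phi>] by simp
  qed
  also have "(\<Sum>j<p - 1. norm (SL j) ^ 2) = real (p - 1) * real L"
  proof -
    have "{(x, y). x \<in> \<Lambda> \<and> y \<in> \<Lambda> \<and> [x = y] (mod int p)} = (\<lambda>x. (x, x)) ` \<Lambda>"
    proof -
      have "x = y" if "x \<in> \<Lambda>" "y \<in> \<Lambda>" "[x = y] (mod int p)" for x y
      proof -
        have "x \<in> {1..<int p}" "y \<in> {1..<int p}" using that \<Lambda> by auto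
        then show ?thesis using that(3) by (simp add: Cong.cong_def)
      qed
      then show ?thesis by auto
    qed
    then have "card {(x, y). x \<in> \<Lambda> \<and> y \<in> \<Lambda> \<and> [x = y] (mod int p)} = L"
      by (simp add: L_def card_image inj_on_def)
    then show ?thesis unfolding SL_def using parseval[OF finL ndL] by simp
  qed
  also have "4 * \<alpha>\<^sup>2 * (real (p - 1) * real E * (real (p - 1) * real L)) \<le> 4 * \<alpha>\<^sup>2 * (real p * real E * (real p * real L))"
    by (intro mult_left_mono mult_mono) auto
  finally have main: "(real B ^ 6 * real N ^ 2 * real L) * real L \<le> (4 * \<alpha>\<^sup>2 * real p ^ 2 * real E) * real L"
    by (simp add: power2_eq_square power_mult_distrib mult_ac flip: power_add)
  show ?thesis
  proof (cases "L = 0")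
    case True
    then show ?thesis by (simp add: L_def)
  next
    case False
    then show ?thesis using main by (simp add: L_def E_def)
  qed
qed

end

section \<open>Product sets in the residue field\<close>

text \<open>The equation \<open>x^n = 1\<close> with \<open>n = card G\<close> has as solutions the
  \<open>c\<close> powers of \<open>g^((p-1)/c)\<close>, where \<open>c = gcd n (p - 1)\<close>.
  Since \<open>G\<close> consists of \<open>n\<close> solutions and \<open>c \<le> n\<close>, it
  contains all of them and \<open>c = n\<close>.\<close>

lemma (in primitive_root) exponent_set_is_power_range:
  assumes G: "G \<subseteq> {1..<int p}" "card G \<ge> 1" and exponent: "\<And>x. x \<in> G \<Longrightarrow> [x ^ card G = 1] (mod int p)"
  obtains h where "\<not> int p dvd h" "distinct_powers p h (card G)" "\<And>i. i < card G \<Longrightarrow> h ^ i mod int p \<in> G"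
proof -
  define n where "n = card G"
  define c where "c = gcd n (p - 1)"
  define m where "m = (p - 1) div c"
  define h where "h = int g ^ m"
  have c_pos: "c > 0" using G(2) by (simp add: c_def n_def)
  have mc: "p - 1 = m * c" by (simp add: m_def c_def)
  have nc: "n = (n div c) * c" by (simp add: c_def)
  have cop: "coprime m (n div c)"
    using div_gcd_coprime[of n "p - 1"] G(2) by (simp add: m_def c_def n_def coprime_commute)
  have sub: "G \<subseteq> (\<lambda>k. h ^ k mod int p) ` {..<c}"
  proof
    fix x assume x: "x \<in> G"
    then have xr: "1 \<le> x" "x < int p" using G(1) by auto
    then have "\<not> int p dvd x" using zdvd_imp_le[of "int p" x] by auto
    then obtain i where i: "i < p - 1" "[int g ^ i = x] (mod int p)" by (rule unit_is_power)
    have "[(int g ^ i) ^ n = x ^ n] (mod int p)" using i(2) by (rule cong_pow)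
    also have "[x ^ n = int g ^ 0] (mod int p)" using exponent[OF x] by (simp add: n_def)
    finally have "[int g ^ (i * n) = int g ^ 0] (mod int p)" by (simp only: power_mult)
    then have "m * c dvd i * n" unfolding g_power_cong mc[symmetric] by (simp add: cong_0_iff)
    also have "i * n = i * (n div c) * c" by (subst nc) (rule mult.assoc[symmetric])
    finally have "m * c dvd i * (n div c) * c" .
    then have "m dvd i * (n div c)" using c_pos by simp
    then have "m dvd i" using cop by (simp add: coprime_dvd_mult_left_iff)
    then obtain k where k: "i = m * k" ..
    have "k < c" using i(1) k mc by simp
    moreover have "x = h ^ k mod int p"
      using i(2) xr by (simp add: h_def k power_mult[symmetric] Cong.cong_def)
    ultimately show "x \<in> (\<lambda>k. h ^ k mod int p) ` {..<c}" by blast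
  qed
  have "n \<le> card ((\<lambda>k. h ^ k mod int p) ` {..<c})" unfolding n_def using sub by (intro card_mono) auto
  moreover have "card ((\<lambda>k. h ^ k mod int p) ` {..<c}) \<le> c" using card_image_le[of "{..<c}"] by simp
  moreover have "c \<le> n" using G(2) unfolding c_def n_def by (intro gcd_le1_nat) simp
  ultimately have eq: "c = n" "card ((\<lambda>k. h ^ k mod int p) ` {..<c}) = card G" by (auto simp: n_def)
  have "G = (\<lambda>k. h ^ k mod int p) ` {..<c}" using sub eq(2) by (intro card_subset_eq) auto
  moreover have "inj_on (\<lambda>k. h ^ k mod int p) {..<c}" using eq n_def by (intro eq_card_imp_inj_on) auto
  ultimately show ?thesis
    using eq(1) not_dvd_g_power by (intro that[of h]) (auto simp: h_def n_def distinct_powers_def Cong.cong_def inj_on_def)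
qed

lemma subgroup_units_Fp:
  assumes "prime p" "subgroup G (units_of (Fp p))"
  shows "G \<subseteq> {1..<int p}" "card G \<ge> 1" "\<And>x. x \<in> G \<Longrightarrow> [x ^ card G = 1] (mod int p)"
proof -
  interpret residues_prime p "Fp p" by unfold_locales (use assms(1) in simp_all)
  interpret U: group "units_of (Fp p)" by (rule units_group)
  interpret S: group "units_of (Fp p)\<lparr>carrier := G\<rparr>" by (rule subgroup.subgroup_is_group[OF assms(2) U.group_axioms])
  have sub: "G \<subseteq> Units (Fp p)" using subgroup.subset[OF assms(2)] by (simp add: units_of_carrier)
  have "Units (Fp p) \<subseteq> {1..<int p}" unfolding res_prime_units_eq using prime_gt_1_nat[OF assms(1)] by auto
  with sub show "G \<subseteq> {1..<int p}" by (rule order.trans)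
  then have fin: "finite G" by (rule finite_subset) simp
  show "card G \<ge> 1" using S.one_closed fin by (auto simp: card_gt_0_iff Suc_le_eq)
  fix x assume x: "x \<in> G"
  have "x [^]\<^bsub>units_of (Fp p)\<lparr>carrier := G\<rparr>\<^esub> card G = \<one>\<^bsub>units_of (Fp p)\<lparr>carrier := G\<rparr>\<^esub>"
    using S.pow_order_eq_1[of x] x by (simp add: Coset.order_def)
  then have "x [^]\<^bsub>units_of (Fp p)\<^esub> card G = \<one>\<^bsub>units_of (Fp p)\<^esub>"
    by (simp add: U.nat_pow_consistent[symmetric])
  then have "x [^]\<^bsub>Fp p\<^esub> card G = \<one>\<^bsub>Fp p\<^esub>"
    using x sub units_of_pow[of x "card G"] by (auto simp: units_of_one)
  moreover have "x mod int p = x" using x \<open>G \<subseteq> {1..<int p}\<close> by auto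
  ultimately have "x ^ card G mod int p = 1" using pow_cong[of x "card G"] by (simp add: res_one_eq)
  then show "[x ^ card G = 1] (mod int p)" using m_gt_one by (simp add: Cong.cong_def)
qed

text \<open>A subgroup is a full set of powers of a suitable \<open>h\<close>, a progression
  consists of powers of the primitive root itself. In both cases only the first \<open>N\<close>
  powers are kept.\<close>

lemma subgroup_or_progression_powers:
  assumes p: "prime p" and G: "subgroup_or_progression p G" "N \<le> card G"
  obtains h where "\<not> int p dvd h" "distinct_powers p h N" "\<And>i. i < N \<Longrightarrow> h ^ i mod int p \<in> G"
proof -
  have "\<exists>h. \<not> int p dvd h \<and> distinct_powers p h (card G) \<and> (\<forall>i<card G. h ^ i mod int p \<in> G)"
  proof (cases "subgroup G (units_of (Fp p))")
    case True
    have "\<exists>g. residue_primroot p g" using p prime_primitive_root_exists[of p] prime_gt_1_nat[of p] by simp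
    then obtain g where "residue_primroot p g" ..
    then interpret primitive_root p g by unfold_locales (use p in simp_all)
    show ?thesis using exponent_set_is_power_range[of G] subgroup_units_Fp[OF p True] by metis
  next
    case False
    then obtain g n where g: "residue_primroot p g" "G = geometric_progression p g n" "card G = n"
      using G(1) by (auto simp: subgroup_or_progression_def)
    interpret primitive_root p g by unfold_locales (use p g in simp_all)
    have "inj_on (\<lambda>k. int g ^ k mod int p) {..<n}"
      using g by (intro eq_card_imp_inj_on) (auto simp: geometric_progression_def)
    then have "distinct_powers p (int g) (card G)" using g(3) by (auto simp: distinct_powers_def Cong.cong_def inj_on_def)
    moreover have "\<forall>i<card G. int g ^ i mod int p \<in> G" using g(2,3) by (auto simp: geometric_progression_def)
    moreover have "\<not> int p dvd int g" using not_dvd_g_power[of 1] by simp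
    ultimately show ?thesis by blast
  qed
  with G(2) that show ?thesis by (auto simp: distinct_powers_def)
qed

lemma Fp_mult: "x \<otimes>\<^bsub>Fp p\<^esub> y = (x * y) mod int p"
  by (simp add: residue_ring_def)

definition four_fold_product :: "nat \<Rightarrow> nat \<Rightarrow> int set \<Rightarrow> int set" where
  "four_fold_product p H G = initial_interval p H <#>\<^bsub>Fp p\<^esub> initial_interval p H <#>\<^bsub>Fp p\<^esub> initial_interval p H <#>\<^bsub>Fp p\<^esub> G"

lemma set_multI: "x \<in> S \<Longrightarrow> y \<in> T \<Longrightarrow> x \<otimes>\<^bsub>R\<^esub> y \<in> S <#>\<^bsub>R\<^esub> T"
  by (auto simp: set_mult_def)

lemma four_fold_product_I:
  assumes "x \<in> {1..H}" "y \<in> {1..H}" "z \<in> {1..H}" "u mod int p \<in> G"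
  shows "int x * int y * int z * u mod int p \<in> four_fold_product p H G"
proof -
  have mem: "int n mod int p \<in> initial_interval p H" if "n \<in> {1..H}" for n
    using that by (auto simp: initial_interval_def)
  have "int x mod int p \<otimes>\<^bsub>Fp p\<^esub> (int y mod int p) \<otimes>\<^bsub>Fp p\<^esub> (int z mod int p) \<otimes>\<^bsub>Fp p\<^esub> (u mod int p) \<in> four_fold_product p H G"
    unfolding four_fold_product_def by (intro set_multI mem assms)
  then show ?thesis by (simp only: Fp_mult mod_mult_eq)
qed

lemma four_fold_product_subset: "p > 0 \<Longrightarrow> four_fold_product p H G \<subseteq> {0..<int p}"
  unfolding four_fold_product_def by (subst set_mult_def) (auto simp: Fp_mult)

text \<open>The residue 0 may be missing from the product set as well, which accounts for the
  summand 1.\<close>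

lemma card_four_fold_product:
  assumes "p > 0"
  shows "\<bar>real (card (four_fold_product p H G)) - real p\<bar> \<le> 1 + real (card ({1..<int p} - four_fold_product p H G))"
proof -
  let ?P = "four_fold_product p H G"
  have sub: "?P \<subseteq> {0..<int p}" using assms by (rule four_fold_product_subset)
  then have fin: "finite ?P" by (rule finite_subset) simp
  have "card ?P \<le> p" using card_mono[OF _ sub] by simp
  have "{0..<int p} \<subseteq> insert 0 (?P \<union> ({1..<int p} - ?P))" by auto
  then have "card {0..<int p} \<le> card (insert 0 (?P \<union> ({1..<int p} - ?P)))" using fin by (intro card_mono) auto
  also have "\<dots> \<le> Suc (card (?P \<union> ({1..<int p} - ?P)))" by (rule card_insert_le_m1) simp_all
  also have "\<dots> \<le> Suc (card ?P + card ({1..<int p} - ?P))" using card_Un_le by (intro Suc_leI le_imp_less_Suc) 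
  finally have "p \<le> Suc (card ?P + card ({1..<int p} - ?P))" by simp
  then have "real p \<le> 1 + real (card ?P) + real (card ({1..<int p} - ?P))" by linarith
  with \<open>card ?P \<le> p\<close> show ?thesis by linarith
qed


text \<open>For length \<open>A = p\<^bsup>1/k\<^esup>\<close> the \<open>k\<close>-fold products fill a positive proportion of \<open>{1..p}\<close>, so the
  \<open>2k\<close>-th moment loses only divisor functions.\<close>

lemma few_large_short_sums:
  fixes \<delta> :: real and k :: nat
  assumes \<delta>: "0 < \<delta>" and k: "k \<ge> 2"
  shows "eventually (\<lambda>p. \<forall>g. primitive_root p g \<longrightarrow>
     real (card {j\<in>{1..<p - 1}. norm (\<Sum>n=1..short_length (1 / real k) p. primitive_root.index_char p g j (int n))
        > real (short_length (1 / real k) p) * real p powr (- (\<delta> / (2 * real k)))}) * (real p powr (-\<delta>)) ^ 3 \<le> 1 / 2) sequentially"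
proof -
  \<comment> \<open>With this choice the \<open>2k\<close>-th power of the threshold loses
    \<open>p^(-\<delta>)\<close>, and the \<open>k\<close> divisor functions cost
    \<open>p^(\<delta>/2)\<close>. The exceptional set thus has size \<open>p^(3\<delta>/2)\<close>
    up to a constant, well below the \<open>p^(3\<delta>)\<close> that three Burgess savings can
    afford.\<close>
  define \<tau> where "\<tau> = \<delta> / (2 * real k)"
  have \<tau>: "\<tau> > 0" "\<tau> * real k = \<delta> / 2" using \<delta> k by (simp_all add: \<tau>_def)
  obtain C :: real where C: "C \<ge> 1"
    "\<And>p n::nat. 1 \<le> n \<Longrightarrow> n \<le> p \<Longrightarrow> card {d. d dvd n} \<le> nat \<lfloor>C * real p powr \<tau>\<rfloor>"
    "\<And>p. real (nat \<lfloor>C * real p powr \<tau>\<rfloor>) \<le> C * real p powr \<tau>"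
    using short_divisor_bound[OF \<tau>(1)] by auto
  have "eventually (\<lambda>p::nat. 2 * (2 * C) ^ k \<le> real p powr (3 * \<delta> / 2)) sequentially"
    using \<delta> by (intro eventually_le_powr) simp
  then show ?thesis
  proof eventually_elim
    fix p :: nat assume large: "2 * (2 * C) ^ k \<le> real p powr (3 * \<delta> / 2)"
    show "\<forall>g. primitive_root p g \<longrightarrow>
     real (card {j\<in>{1..<p - 1}. norm (\<Sum>n=1..short_length (1 / real k) p. primitive_root.index_char p g j (int n))
        > real (short_length (1 / real k) p) * real p powr (- (\<delta> / (2 * real k)))}) * (real p powr (-\<delta>)) ^ 3 \<le> 1 / 2"
    proof (intro allI impI)
      fix g assume "primitive_root p g"
      then interpret primitive_root p g .
      define P where "P = real p"
      have P: "P > 1" using p_gt_1 by (simp add: P_def)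
      define A where "A = short_length (1 / real k) p"
      define D where "D = nat \<lfloor>C * real p powr \<tau>\<rfloor>"
      define S where "S = (\<lambda>j. norm (\<Sum>n=1..A. index_char j (int n)))"
      define R where "R = {j\<in>{1..<p - 1}. S j > real A * P powr (-\<tau>)}"
      have A_le: "real A \<le> P powr (1 / real k)" using short_length_le by (simp add: A_def P_def)
      have A_ge: "P powr (1 / real k) / 2 \<le> real A" "1 \<le> A"
        using short_length_ge[of p "1 / real k"] p_gt_1 by (simp_all add: A_def P_def)
      have root: "(P powr (1 / real k)) ^ k = P" using k P by (simp add: powr_realpow[symmetric] powr_powr)
      have "real A ^ k \<le> P" using power_mono[OF A_le, of k] root by simp
      then have Ak: "A ^ k \<le> p" by (simp add: P_def flip: of_nat_power)
      have "P powr (1 / real k) < P powr 1" using P k by (intro powr_less_mono) auto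
      then have "A < p" using A_le P by (simp add: P_def)
      have "real (card R) * (real A * P powr (-\<tau>)) ^ (2 * k) = (\<Sum>j\<in>R. (real A * P powr (-\<tau>)) ^ (2 * k))" by simp
      also have "\<dots> \<le> (\<Sum>j\<in>R. S j ^ (2 * k))" by (intro sum_mono power_mono) (auto simp: R_def)
      also have "\<dots> \<le> (\<Sum>j<p - 1. S j ^ (2 * k))" by (intro sum_mono2) (auto simp: R_def S_def)
      also have "\<dots> \<le> real (p - 1) * real (A ^ k * D ^ k)"
        unfolding S_def using k \<open>A < p\<close> Ak C(2)[of _ p] by (intro short_sum_high_moment) (auto simp: D_def)
      also have "\<dots> \<le> P * (real A ^ k * (C * P powr \<tau>) ^ k)"
        using C(3)[of p] by (auto intro!: mult_mono power_mono simp: D_def P_def)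
      finally have main: "real (card R) * (real A * P powr (-\<tau>)) ^ (2 * k) \<le> P * (real A ^ k * (C * P powr \<tau>) ^ k)" .
      have pk: "(P powr a) ^ k = P powr (a * real k)" "(P powr a) ^ (2 * k) = P powr (2 * (a * real k))" for a
        using P by (simp_all add: powr_realpow[symmetric] powr_powr mult_ac)
      have eq1: "(real A * P powr (-\<tau>)) ^ (2 * k) = real A ^ k * (real A ^ k * P powr (-\<delta>))"
      proof -
        have "(P powr (-\<tau>)) ^ (2 * k) = P powr (-\<delta>)" unfolding pk using \<tau>(2) by (simp add: mult_ac)
        moreover have "real A ^ (2 * k) = real A ^ k * real A ^ k" by (simp only: mult_2 power_add)
        ultimately show ?thesis by (simp only: power_mult_distrib mult.assoc)
      qed
      have eq2: "(C * P powr \<tau>) ^ k = C ^ k * P powr (\<delta> / 2)" using \<tau>(2) by (simp only: power_mult_distrib pk)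
      have "real A ^ k * (real (card R) * (real A ^ k * P powr (-\<delta>))) \<le> real A ^ k * (P * (C ^ k * P powr (\<delta> / 2)))"
        using main unfolding eq1 eq2 by (simp only: mult_ac)
      then have 1: "real (card R) * (real A ^ k * P powr (-\<delta>)) \<le> P * (C ^ k * P powr (\<delta> / 2))"
        using A_ge(2) by (subst (asm) mult_le_cancel_left_pos) auto
      have "P / 2 ^ k \<le> real A ^ k" using power_mono[OF A_ge(1), of k] P by (simp add: power_divide root)
      then have "real (card R) * (P / 2 ^ k * P powr (-\<delta>)) \<le> real (card R) * (real A ^ k * P powr (-\<delta>))"
        by (intro mult_left_mono mult_right_mono) auto
      also note 1
      finally have "P * (real (card R) * P powr (-\<delta>) / 2 ^ k) \<le> P * (C ^ k * P powr (\<delta> / 2))" by (simp add: mult_ac)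
      then have "real (card R) * P powr (-\<delta>) / 2 ^ k \<le> C ^ k * P powr (\<delta> / 2)"
        using P by (subst (asm) mult_le_cancel_left_pos) auto
      then have "real (card R) * P powr (-\<delta>) \<le> (2 * C) ^ k * P powr (\<delta> / 2)"
        by (simp add: pos_divide_le_eq power_mult_distrib mult_ac)
      then have "real (card R) * P powr (-\<delta>) * P powr (- (2 * \<delta>)) \<le> (2 * C) ^ k * P powr (\<delta> / 2) * P powr (- (2 * \<delta>))"
        by (rule mult_right_mono) simp
      then have 2: "real (card R) * P powr (- (3 * \<delta>)) \<le> (2 * C) ^ k * P powr (- (3 * \<delta> / 2))"
        by (simp add: mult.assoc flip: powr_add)
      have "2 * ((2 * C) ^ k * P powr (- (3 * \<delta> / 2))) \<le> P powr (3 * \<delta> / 2) * P powr (- (3 * \<delta> / 2))"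
        using mult_right_mono[OF large, of "P powr (- (3 * \<delta> / 2))"] by (simp add: P_def mult.assoc)
      also have "\<dots> = 1" using P by (simp flip: powr_add)
      finally have "real (card R) * P powr (- (3 * \<delta>)) \<le> 1 / 2" using 2 by linarith
      moreover have "(P powr (-\<delta>)) ^ 3 = P powr (- (3 * \<delta>))" using P by (simp add: powr_realpow[symmetric] powr_powr mult.commute)
      ultimately show "real (card {j\<in>{1..<p - 1}. norm (\<Sum>n=1..short_length (1 / real k) p. index_char j (int n))
        > real (short_length (1 / real k) p) * real p powr (- (\<delta> / (2 * real k)))}) * (real p powr (-\<delta>)) ^ 3 \<le> 1 / 2"
        by (simp add: R_def S_def A_def P_def \<tau>_def)
    qed
  qed
qed

lemma few_missed_residues:
  fixes e :: real
  assumes e: "0 < e" "e \<le> 1/16" and k: "k \<ge> 2"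
  obtains \<tau> where "0 < \<tau>" "\<tau> \<le> 1"
    "eventually (\<lambda>p. \<forall>h N \<Lambda>. prime p \<longrightarrow> \<not> int p dvd h \<longrightarrow> real N \<ge> real p powr (1/4) \<longrightarrow>
       real N \<le> 2 * real p powr (1/4) \<longrightarrow> distinct_powers p h N \<longrightarrow> \<Lambda> \<subseteq> {1..<int p} \<longrightarrow>
       (\<forall>a\<in>{1..short_length (1 / real k) p}. \<forall>x\<in>{1..short_length (1/4 + e) p}. \<forall>y\<in>{1..short_length (1/4 + e) p}.
         \<forall>z\<in>{1..short_length (1/4 + e) p}. \<forall>i<N. \<forall>l\<in>\<Lambda>. \<not> [int a * (int (x * y * z) * h ^ i) = l] (mod int p)) \<longrightarrow>
       real (card \<Lambda>) \<le> 4 * real p powr (1 - \<tau>)) sequentially"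
proof -
  obtain \<delta>1 where \<delta>1: "\<delta>1 > 0"
    "eventually (\<lambda>p. \<forall>chi. prime p \<longrightarrow> dirichlet_char p chi \<longrightarrow> char_order p chi > 1 \<longrightarrow>
       norm (\<Sum>n=1..short_length (1/4 + e) p. chi (int n)) \<le> real (short_length (1/4 + e) p) * real p powr (-\<delta>1)) sequentially"
    using burgess_bound[of e] e by auto
  \<comment> \<open>The minimum with 1 serves to keep \<open>\<tau> \<le> 1\<close>, so that
    \<open>p^(1-\<tau>)\<close> is at least 1 later on.\<close>
  define \<delta> where "\<delta> = min \<delta>1 1"
  define \<tau> where "\<tau> = \<delta> / (2 * real k)"
  have \<delta>: "0 < \<delta>" "\<delta> \<le> \<delta>1" "\<delta> \<le> 1" using \<delta>1 by (auto simp: \<delta>_def)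
  have \<tau>: "0 < \<tau>" "\<tau> \<le> 1"
  proof -
    show "0 < \<tau>" using \<delta> k by (simp add: \<tau>_def)
    have "\<delta> \<le> 1 * (2 * real k)" using \<delta> k by simp
    then show "\<tau> \<le> 1" using k by (simp add: \<tau>_def pos_divide_le_eq)
  qed
  show ?thesis
  proof (rule that[OF \<tau>])
    show "eventually (\<lambda>p. \<forall>h N \<Lambda>. prime p \<longrightarrow> \<not> int p dvd h \<longrightarrow> real N \<ge> real p powr (1/4) \<longrightarrow>
       real N \<le> 2 * real p powr (1/4) \<longrightarrow> distinct_powers p h N \<longrightarrow> \<Lambda> \<subseteq> {1..<int p} \<longrightarrow>
       (\<forall>a\<in>{1..short_length (1 / real k) p}. \<forall>x\<in>{1..short_length (1/4 + e) p}. \<forall>y\<in>{1..short_length (1/4 + e) p}.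
         \<forall>z\<in>{1..short_length (1/4 + e) p}. \<forall>i<N. \<forall>l\<in>\<Lambda>. \<not> [int a * (int (x * y * z) * h ^ i) = l] (mod int p)) \<longrightarrow>
       real (card \<Lambda>) \<le> 4 * real p powr (1 - \<tau>)) sequentially"
      using \<delta>1(2) few_large_short_sums[OF \<delta>(1) k] triple_power_collisions_bound[OF e \<tau>(1)]
    proof eventually_elim
      fix p :: nat
      define P where "P = real p"
      define A where "A = short_length (1 / real k) p"
      define B where "B = short_length (1/4 + e) p"
      assume burgess: "\<forall>chi. prime p \<longrightarrow> dirichlet_char p chi \<longrightarrow> char_order p chi > 1 \<longrightarrow>
          norm (\<Sum>n=1..short_length (1/4 + e) p. chi (int n)) \<le> real (short_length (1/4 + e) p) * real p powr (-\<delta>1)"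
        and few: "\<forall>g. primitive_root p g \<longrightarrow>
          real (card {j\<in>{1..<p - 1}. norm (\<Sum>n=1..short_length (1 / real k) p. primitive_root.index_char p g j (int n))
          > real (short_length (1 / real k) p) * real p powr (- (\<delta> / (2 * real k)))}) * (real p powr (-\<delta>)) ^ 3 \<le> 1 / 2"
        and coll: "\<forall>h N. prime p \<longrightarrow> \<not> int p dvd h \<longrightarrow> real N \<ge> real p powr (1/4) \<longrightarrow>
          real N \<le> 2 * real p powr (1/4) \<longrightarrow> distinct_powers p h N \<longrightarrow>
          real (card (triple_power_collisions p h (short_length (1/4 + e) p) N))
          \<le> real p powr \<tau> * (real (short_length (1/4 + e) p) ^ 6 * real N ^ 2 / real p)"
      show "\<forall>h N \<Lambda>. prime p \<longrightarrow> \<not> int p dvd h \<longrightarrow> real N \<ge> real p powr (1/4) \<longrightarrow>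
       real N \<le> 2 * real p powr (1/4) \<longrightarrow> distinct_powers p h N \<longrightarrow> \<Lambda> \<subseteq> {1..<int p} \<longrightarrow>
       (\<forall>a\<in>{1..short_length (1 / real k) p}. \<forall>x\<in>{1..short_length (1/4 + e) p}. \<forall>y\<in>{1..short_length (1/4 + e) p}.
         \<forall>z\<in>{1..short_length (1/4 + e) p}. \<forall>i<N. \<forall>l\<in>\<Lambda>. \<not> [int a * (int (x * y * z) * h ^ i) = l] (mod int p)) \<longrightarrow>
       real (card \<Lambda>) \<le> 4 * real p powr (1 - \<tau>)"
        unfolding A_def[symmetric] B_def[symmetric] P_def[symmetric]
      proof (intro allI impI)
        fix h :: int and N :: nat and \<Lambda> :: "int set"
        assume prime: "prime p" and h: "\<not> int p dvd h" and N: "P powr (1/4) \<le> real N" "real N \<le> 2 * P powr (1/4)"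
          and dist: "distinct_powers p h N" and \<Lambda>: "\<Lambda> \<subseteq> {1..<int p}"
          and missed: "\<forall>a\<in>{1..A}. \<forall>x\<in>{1..B}. \<forall>y\<in>{1..B}. \<forall>z\<in>{1..B}. \<forall>i<N. \<forall>l\<in>\<Lambda>. \<not> [int a * (int (x * y * z) * h ^ i) = l] (mod int p)"
        have "\<exists>g. residue_primroot p g" using prime prime_primitive_root_exists[of p] prime_gt_1_nat[of p] by simp
        then obtain g where "residue_primroot p g" ..
        then interpret primitive_root p g by unfold_locales (use prime in simp_all)
        have P: "P > 1" using p_gt_1 by (simp add: P_def)
        have "1 \<le> P powr (1/4)" using P by (intro ge_one_powr_ge_zero) auto
        then have N1: "1 \<le> N" using N(1) by linarith
        have less_p: "short_length a p < p" if "a < 1" for a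
        proof -
          have "P powr a < P powr 1" using P that by (intro powr_less_mono) auto
          then show ?thesis using short_length_le[of a p] P by (simp add: P_def)
        qed
        have AB: "1 \<le> A" "A < p" "1 \<le> B" "B < p"
          using short_length_ge(2)[of p] less_p p_gt_1 e k by (auto simp: A_def B_def)
        have "real B ^ 6 * real N ^ 2 * real (card \<Lambda>) \<le> 4 * (P powr (-\<tau>))\<^sup>2 * real p ^ 2 * real (card (triple_power_collisions p h B N))"
        proof (rule missed_residues_bound[OF AB N1 h \<Lambda>, where \<beta> = "P powr (-\<delta>)"])
          show "norm (\<Sum>n=1..B. index_char j (int n)) \<le> real B * P powr (-\<delta>)" if "1 \<le> j" "j < p - 1" for j
          proof -
            have "norm (\<Sum>n=1..B. index_char j (int n)) \<le> real B * P powr (-\<delta>1)"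
              using burgess prime index_char_dirichlet[of j] index_char_order[OF that] by (auto simp: B_def P_def)
            also have "\<dots> \<le> real B * P powr (-\<delta>)" using P \<delta>(2) by (intro mult_left_mono powr_mono) auto
            finally show ?thesis .
          qed
          show "real (card {j\<in>{1..<p - 1}. norm (\<Sum>n=1..A. index_char j (int n)) > real A * P powr (-\<tau>)}) * (P powr (-\<delta>)) ^ 3 \<le> 1 / 2"
            using few[rule_format, OF primitive_root_axioms] by (simp only: A_def P_def \<tau>_def)
        qed (use missed in auto)
        also have "\<dots> \<le> 4 * (P powr (-\<tau>))\<^sup>2 * real p ^ 2 * (P powr \<tau> * (real B ^ 6 * real N ^ 2 / P))"
          using coll prime h N dist by (intro mult_left_mono) (auto simp: B_def P_def)
        also have "\<dots> = real B ^ 6 * real N ^ 2 * (4 * ((P powr (-\<tau>))\<^sup>2 * P powr \<tau> * (P\<^sup>2 / P)))" by (simp add: P_def mult_ac)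
        \<comment> \<open>The squared saving \<open>p^(-2\<tau>)\<close> of the shortest sum is set
          against the loss \<open>p^\<tau>\<close> of the collision count.\<close>
        also have "(P powr (-\<tau>))\<^sup>2 * P powr \<tau> * (P\<^sup>2 / P) = P powr (1 - \<tau>)"
        proof -
          have "(P powr (-\<tau>))\<^sup>2 * P powr \<tau> = P powr (-\<tau>)" using P by (simp add: power2_eq_square flip: powr_add)
          moreover have "P\<^sup>2 / P = P powr 1" using P by (simp add: power2_eq_square)
          ultimately show ?thesis by (simp only: powr_add[symmetric]) simp
        qed
        finally have "(real B ^ 6 * real N ^ 2) * real (card \<Lambda>) \<le> (real B ^ 6 * real N ^ 2) * (4 * P powr (1 - \<tau>))" .
        moreover have "real B ^ 6 * real N ^ 2 > 0" using AB N1 by simp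
        ultimately show "real (card \<Lambda>) \<le> 4 * P powr (1 - \<tau>)" by (subst (asm) mult_le_cancel_left_pos)
      qed
    qed
  qed
qed

theorem theorem4:
  fixes \<epsilon> :: real
  assumes "\<epsilon> > 0"
  shows "\<exists>\<delta>>0. \<exists>C::real. \<forall>(p::nat) (H::nat) (G::int set).
           prime p \<longrightarrow> H > 0 \<longrightarrow> card (initial_interval p H) = H \<longrightarrow>
           subgroup_or_progression p G \<longrightarrow>
           real (card (initial_interval p H)) > real p powr (1/4 + \<epsilon>) \<longrightarrow>
           real (card G) > real p powr (1/4) \<longrightarrow>
           \<bar>real (card (initial_interval p H <#>\<^bsub>Fp p\<^esub> initial_interval p H
                          <#>\<^bsub>Fp p\<^esub> initial_interval p H <#>\<^bsub>Fp p\<^esub> G)) - real p\<bar>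
             \<le> C * real p powr (1 - \<delta>)"
proof -
  \<comment> \<open>Halving leaves room for the factor \<open>a\<close>: the product
    \<open>a * x \<le> p^(1/4 + 2 * e)\<close> has to lie in the interval. The cap 1/16 keeps
    \<open>B^3\<close> below \<open>p\<close>.\<close>
  define e where "e = min \<epsilon> (1/16) / 2"
  have e: "0 < e" "e \<le> 1/16" "2 * e \<le> \<epsilon>" using assms by (auto simp: e_def)
  \<comment> \<open>This makes the length \<open>p^(1/k)\<close> of the range of \<open>a\<close> at
    most \<open>p^e\<close>.\<close>
  define k where "k = nat \<lceil>1 / e\<rceil>"
  have ke: "1 / e \<le> real k" unfolding k_def by linarith
  then have "1 \<le> real k * e" using e(1) by (simp add: pos_divide_le_eq)
  have "16 \<le> 1 / e" using e by (simp add: pos_le_divide_eq)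
  then have k: "k \<ge> 2" using ke by linarith
  have inv_k: "1 / real k \<le> e" using \<open>1 \<le> real k * e\<close> k by (simp add: pos_divide_le_eq mult.commute)
  obtain \<tau> where \<tau>: "0 < \<tau>" "\<tau> \<le> 1"
    and ev: "eventually (\<lambda>p. \<forall>h N \<Lambda>. prime p \<longrightarrow> \<not> int p dvd h \<longrightarrow> real N \<ge> real p powr (1/4) \<longrightarrow>
       real N \<le> 2 * real p powr (1/4) \<longrightarrow> distinct_powers p h N \<longrightarrow> \<Lambda> \<subseteq> {1..<int p} \<longrightarrow>
       (\<forall>a\<in>{1..short_length (1 / real k) p}. \<forall>x\<in>{1..short_length (1/4 + e) p}. \<forall>y\<in>{1..short_length (1/4 + e) p}.
         \<forall>z\<in>{1..short_length (1/4 + e) p}. \<forall>i<N. \<forall>l\<in>\<Lambda>. \<not> [int a * (int (x * y * z) * h ^ i) = l] (mod int p)) \<longrightarrow>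
       real (card \<Lambda>) \<le> 4 * real p powr (1 - \<tau>)) sequentially"
    by (rule few_missed_residues[OF e(1,2) k])
  from ev obtain M where M: "\<And>p h N \<Lambda>. p \<ge> M \<Longrightarrow> prime p \<Longrightarrow> \<not> int p dvd h \<Longrightarrow> real N \<ge> real p powr (1/4) \<Longrightarrow>
       real N \<le> 2 * real p powr (1/4) \<Longrightarrow> distinct_powers p h N \<Longrightarrow> \<Lambda> \<subseteq> {1..<int p} \<Longrightarrow>
       (\<forall>a\<in>{1..short_length (1 / real k) p}. \<forall>x\<in>{1..short_length (1/4 + e) p}. \<forall>y\<in>{1..short_length (1/4 + e) p}.
         \<forall>z\<in>{1..short_length (1/4 + e) p}. \<forall>i<N. \<forall>l\<in>\<Lambda>. \<not> [int a * (int (x * y * z) * h ^ i) = l] (mod int p)) \<Longrightarrow>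
       real (card \<Lambda>) \<le> 4 * real p powr (1 - \<tau>)"
    unfolding eventually_sequentially by blast
  have bound: "\<bar>real (card (four_fold_product p H G)) - real p\<bar> \<le> (5 + real M) * real p powr (1 - \<tau>)"
    if p: "prime p" and H: "real H > real p powr (1/4 + \<epsilon>)"
      and G: "subgroup_or_progression p G" "real (card G) > real p powr (1/4)" for p H G
  proof -
    define P where "P = real p"
    have P: "P > 1" using prime_gt_1_nat[OF p] by (simp add: P_def)
    have one_le: "1 \<le> P powr (1 - \<tau>)" using P \<tau> by (intro ge_one_powr_ge_zero) auto
    define \<Lambda> where "\<Lambda> = {1..<int p} - four_fold_product p H G"
    have p0: "p > 0" using P by (simp add: P_def)
    have card_L: "\<bar>real (card (four_fold_product p H G)) - P\<bar> \<le> 1 + real (card \<Lambda>)"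
      using card_four_fold_product[OF p0] by (simp add: P_def \<Lambda>_def)
    show ?thesis
    proof (cases "p \<ge> M")
      case False
      \<comment> \<open>Below the threshold \<open>M\<close> the trivial bound \<open>p\<close> is
        absorbed by the constant.\<close>
      have "card \<Lambda> \<le> card {1..<int p}" by (rule card_mono) (auto simp: \<Lambda>_def)
      then have "1 + real (card \<Lambda>) \<le> P" using p0 by (simp add: P_def)
      also have "\<dots> \<le> (5 + real M) * 1" using False by (simp add: P_def)
      also have "\<dots> \<le> (5 + real M) * P powr (1 - \<tau>)" using one_le by (intro mult_left_mono) auto
      finally show ?thesis using card_L by (simp add: P_def)
    next
      case True
      \<comment> \<open>Only about \<open>p^(1/4)\<close> powers are used even if \<open>G\<close>
        is larger, because the collision count is stated for
        \<open>N \<le> 2 p^(1/4)\<close>.\<close>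
      define N where "N = nat \<lceil>P powr (1/4)\<rceil>"
      have N_ge: "P powr (1/4) \<le> real N" unfolding N_def by linarith
      have "1 \<le> P powr (1/4)" using P by (intro ge_one_powr_ge_zero) auto
      then have N_le: "real N \<le> 2 * P powr (1/4)" unfolding N_def by linarith
      have "N \<le> card G" using G(2) unfolding N_def P_def by (simp add: nat_le_iff ceiling_le_iff)
      then obtain h where h: "\<not> int p dvd h" "distinct_powers p h N" "\<And>i. i < N \<Longrightarrow> h ^ i mod int p \<in> G"
        using subgroup_or_progression_powers[OF p G(1)] by blast
      have B_le: "short_length (1/4 + e) p \<le> H"
      proof -
        have "real (short_length (1/4 + e) p) \<le> P powr (1/4 + e)" using short_length_le by (simp add: P_def)
        also have "\<dots> \<le> P powr (1/4 + \<epsilon>)" using P e by (intro powr_mono) auto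
        also have "\<dots> < real H" using H by (simp add: P_def)
        finally show ?thesis by simp
      qed
      have AB_le: "a * x \<le> H" if "a \<le> short_length (1 / real k) p" "x \<le> short_length (1/4 + e) p" for a x
      proof -
        have "real a \<le> P powr (1 / real k)" using that(1) short_length_le[of "1 / real k" p] by (simp add: P_def)
        also have "\<dots> \<le> P powr e" using P inv_k by (intro powr_mono) auto
        finally have a: "real a \<le> P powr e" .
        have x: "real x \<le> P powr (1/4 + e)" using that(2) short_length_le[of "1/4 + e" p] by (simp add: P_def)
        have "real a * real x \<le> P powr e * P powr (1/4 + e)" using a x by (intro mult_mono) auto
        also have "\<dots> = P powr (1/4 + 2 * e)" by (simp add: algebra_simps flip: powr_add)
        also have "\<dots> \<le> P powr (1/4 + \<epsilon>)" using P e by (intro powr_mono) auto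
        also have "\<dots> < real H" using H by (simp add: P_def)
        finally show ?thesis by (simp flip: of_nat_mult)
      qed
      have "real (card \<Lambda>) \<le> 4 * real p powr (1 - \<tau>)"
      proof (rule M[OF True p h(1) _ _ h(2)])
        show "real p powr (1/4) \<le> real N" "real N \<le> 2 * real p powr (1/4)" using N_ge N_le by (simp_all add: P_def)
        show "\<Lambda> \<subseteq> {1..<int p}" by (auto simp: \<Lambda>_def)
        show "\<forall>a\<in>{1..short_length (1 / real k) p}. \<forall>x\<in>{1..short_length (1/4 + e) p}. \<forall>y\<in>{1..short_length (1/4 + e) p}.
         \<forall>z\<in>{1..short_length (1/4 + e) p}. \<forall>i<N. \<forall>l\<in>\<Lambda>. \<not> [int a * (int (x * y * z) * h ^ i) = l] (mod int p)"
        proof (intro ballI allI impI notI)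
          fix a x y z i l
          assume a: "a \<in> {1..short_length (1 / real k) p}" and x: "x \<in> {1..short_length (1/4 + e) p}"
            and y: "y \<in> {1..short_length (1/4 + e) p}" and z: "z \<in> {1..short_length (1/4 + e) p}"
            and i: "i < N" and l: "l \<in> \<Lambda>" and eq: "[int a * (int (x * y * z) * h ^ i) = l] (mod int p)"
          have "a * x \<in> {1..H}" using AB_le[of a x] a x by (simp add: Suc_le_eq)
          moreover have "y \<in> {1..H}" "z \<in> {1..H}" using y z B_le by auto
          ultimately have "int (a * x) * int y * int z * h ^ i mod int p \<in> four_fold_product p H G"
            using h(3)[OF i] by (rule four_fold_product_I)
          moreover have "int (a * x) * int y * int z * h ^ i = int a * (int (x * y * z) * h ^ i)" by simp
          moreover have "l mod int p = l" using l by (auto simp: \<Lambda>_def)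
          ultimately have "l \<in> four_fold_product p H G" using eq by (simp only: Cong.cong_def)
          with l show False by (simp add: \<Lambda>_def)
        qed
      qed
      then have "1 + real (card \<Lambda>) \<le> 5 * P powr (1 - \<tau>)" using one_le by (simp add: P_def)
      also have "\<dots> \<le> (5 + real M) * P powr (1 - \<tau>)" by (intro mult_right_mono) auto
      finally show ?thesis using card_L by (simp add: P_def)
    qed
  qed
  show ?thesis
    by (rule exI[of _ \<tau>], intro conjI \<tau>(1) exI[of _ "5 + real M"] allI impI)
       (use bound in \<open>auto simp: four_fold_product_def\<close>)
qed

end
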